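(* Let $p\ge 3$ be an integer, $\sigma\ge p-1$, $\lambda\ge 3$ and $C_0>0$. Then there is a constant $C>0$, which may depend on $p,\sigma,\lambda,C_0$ but is independent of $\varepsilon$ and $N$, such that the following holds. Let $0<\varepsilon\le 1$, let $N\ge 4$ be an integer divisible by $4$ with $\sigma\varepsilon\ln N\le \tfrac14$, and let $f\in L_2(\Omega)$ be such that the solution $u$ of the boundary value problem $$\varepsilon^4u^{(4)}+4u=f\ \text{ in }\Omega=(0,1),\qquad u(\xi)=u'(\xi)=0,\ \xi\in\{0,1\},$$ admits a layer decomposition of order $K=p+3$ with constant $C_0$. Let $(u_h,v_h)\in V_h$ be the finite element solution on the Shishkin mesh with parameters $N,\sigma,\varepsilon$, i.e. $\mathcal{B}\bigl((u_h,v_h),(u_*,v_* )\bigr)=\mathcal{F}\bigl((u_*,v_* )\bigr)$ for all $(u_*,v_* )\in V_h$. Then $$\left|\left|\left|\bigl(u-u_h,\ \varepsilon^{3/2}u''-v_h\bigr)\right|\right|\right|\le C\left(N^{-1}\ln N\right)^{p-1}.$$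
   Context: $\Omega=(0,1)$; $\langle\cdot,\cdot\rangle$ and $\|\cdot\|$ are the $L_2(\Omega)$ inner product and norm. $V:=H_0^2(\Omega)\times H^2(\Omega)$, where $H^2_0(\Omega)$ is the space of $w\in H^2(\Omega)$ with $w=w'=0$ at $0$ and $1$. Bilinear form and functional (for given $\lambda>0$, $\varepsilon$, $f$): $$\mathcal{B}\bigl((u,v),(u_*,v_* )\bigr):=\lambda\langle v-\varepsilon^{3/2}u'',v_*-\varepsilon^{3/2}u_*''\rangle+\langle\varepsilon^{5/2}v''+4u,\varepsilon^{3/2}v_*''+4u_*\rangle,\qquad \mathcal{F}\bigl((u_*,v_* )\bigr):=\langle f,\varepsilon^{3/2}v_*''+4u_*\rangle .$$ Balanced norm on $V$: $|||(u,v)|||^2:=\|u\|^2+\varepsilon^3\|u''\|^2+\|v\|^2+\varepsilon^4\|v''\|^2$. Layer decomposition of order $K$ with constant $C_0$: there are functions $u_{\mathrm{reg}},u_{\mathrm{bl},0},u_{\mathrm{bl},1}\in C^K([0,1])$ with $u=u_{\mathrm{bl},0}+u_{\mathrm{reg}}+u_{\mathrm{bl},1}$ on $[0,1]$ such that for all $x\in[0,1]$ and $\kappa=0,1,\dots,K$ $$|u_{\mathrm{reg}}^{(\kappa)}(x)|\le C_0,\quad |u_{\mathrm{bl},0}^{(\kappa)}(x)|\le C_0\varepsilon^{-\kappa}e^{-x/\varepsilon},\quad |u_{\mathrm{bl},1}^{(\kappa)}(x)|\le C_0\varepsilon^{-\kappa}e^{-(1-x)/\varepsilon},$$ and $\varepsilon^4u_{\mathrm{reg}}^{(4)}+4u_{\mathrm{reg}}=f$,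 $\varepsilon^4u_{\mathrm{bl},i}^{(4)}+4u_{\mathrm{bl},i}=0$ ($i=0,1$) in $\Omega$. Shishkin mesh: with transition point $\tau:=\sigma\varepsilon\ln N$ (the case $\sigma\varepsilon\ln N\le\frac14$), the intervals $[0,\tau]$ and $[1-\tau,1]$ are each divided uniformly into $N/4$ subintervals and $[\tau,1-\tau]$ is divided uniformly into $N/2$ subintervals; this gives a partition $\omega: 0=x_0<x_1<\dots<x_N=1$. Finite element space: $\mathcal{S}_p^1(\omega):=\{s\in C^1[0,1]: s|_{(x_{i-1},x_i)}\text{ is a polynomial of degree at most } p,\ i=1,\dots,N\}$ and $V_h:=\bigl(\mathcal{S}_p^1(\omega)\times\mathcal{S}_p^1(\omega)\bigr)\cap V$. *)

theory Defs
  imports "HOL-Analysis.Analysis" "HOL-Computational_Algebra.Polynomial"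
begin

text \<open>
  Functions on \<open>\<Omega> = (0,1)\<close> and on \<open>[0,1]\<close> are represented by total functions \<open>real \<Rightarrow> real\<close>; their
  values outside these sets are irrelevant throughout. Elements of Lebesgue and Sobolev spaces are
  representatives, not equivalence classes.
\<close>

abbreviation Omega :: "real set" where
  "Omega \<equiv> {0<..<1}"

abbreviation Omega_measure :: "real measure" where
  "Omega_measure \<equiv> lebesgue_on Omega"


section \<open>Lebesgue and Sobolev spaces on the unit interval\<close>

definition L2_space :: "(real \<Rightarrow> real) set" where
  "L2_space = {f \<in> borel_measurable Omega_measure. integrable Omega_measure (\<lambda>x. (f x)\<^sup>2)}"

definition L2_inner :: "(real \<Rightarrow> real) \<Rightarrow> (real \<Rightarrow> real) \<Rightarrow> real" where
  "L2_inner f g = (LINT x|Omega_measure. f x * g x)"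

definition L2_norm :: "(real \<Rightarrow> real) \<Rightarrow> real" where
  "L2_norm f = sqrt (L2_inner f f)"

text \<open>
  One-sided derivatives at the end points are intended, hence the restriction to \<open>{0..1}\<close>; the
  \<open>k\<close>-th derivative on \<open>[0,1]\<close> is \<open>(deriv01 ^^ k) f\<close>.
\<close>

definition deriv01 :: "(real \<Rightarrow> real) \<Rightarrow> real \<Rightarrow> real" where
  "deriv01 f = (\<lambda>x. vector_derivative f (at x within {0..1}))"

definition C_space :: "nat \<Rightarrow> (real \<Rightarrow> real) set" where
  "C_space K = {f. (\<forall>k<K. (deriv01 ^^ k) f differentiable_on {0..1})
                 \<and> continuous_on {0..1} ((deriv01 ^^ K) f)}"

text \<open>
  Smooth functions with compact support in \<open>\<Omega>\<close>; compactness is automatic, since the support is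
  closed and \<open>\<Omega>\<close> is bounded.
\<close>

definition test_functions :: "(real \<Rightarrow> real) set" where
  "test_functions = {\<phi>. (\<forall>k. (deriv ^^ k) \<phi> differentiable_on UNIV)
                       \<and> closure {x. \<phi> x \<noteq> 0} \<subseteq> Omega}"

definition has_weak_deriv :: "nat \<Rightarrow> (real \<Rightarrow> real) \<Rightarrow> (real \<Rightarrow> real) \<Rightarrow> bool" where
  "has_weak_deriv k u g \<longleftrightarrow>
     u \<in> L2_space \<and> g \<in> L2_space \<and>
     (\<forall>\<phi>\<in>test_functions. L2_inner u ((deriv ^^ k) \<phi>) = (- 1) ^ k * L2_inner g \<phi>)"

text \<open>
  The weak derivative is determined only up to a null set; every notion below is insensitive to
  the representative that is chosen here.
\<close>

definition weak_deriv :: "nat \<Rightarrow> (real \<Rightarrow> real) \<Rightarrow> real \<Rightarrow> real" where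
  "weak_deriv k u = (SOME g. has_weak_deriv k u g)"

definition H_space :: "nat \<Rightarrow> (real \<Rightarrow> real) set" where
  "H_space k = {u \<in> L2_space. \<forall>j\<in>{1..k}. \<exists>g. has_weak_deriv j u g}"

text \<open>The boundary values are those of the continuously differentiable representative.\<close>

definition H20_space :: "(real \<Rightarrow> real) set" where
  "H20_space = {w \<in> H_space 2. \<exists>w'\<in>C_space 1. (AE x in Omega_measure. w x = w' x) \<and>
                   (\<forall>\<xi>\<in>{0, 1}. w' \<xi> = 0 \<and> deriv01 w' \<xi> = 0)}"

definition V_space :: "((real \<Rightarrow> real) \<times> (real \<Rightarrow> real)) set" where
  "V_space = H20_space \<times> H_space 2"


section \<open>The boundary value problem and its mixed formulation\<close>

text \<open>Since the right-hand side is only in \<open>L\<^sub>2\<close>, the differential equation holds almost everywhere.\<close>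

definition bvp_solution :: "real \<Rightarrow> (real \<Rightarrow> real) \<Rightarrow> (real \<Rightarrow> real) \<Rightarrow> bool" where
  "bvp_solution \<epsilon> f u \<longleftrightarrow>
     u \<in> H_space 4 \<and> u \<in> H20_space \<and>
     (AE x in Omega_measure. \<epsilon> ^ 4 * weak_deriv 4 u x + 4 * u x = f x)"

fun bilinear_B :: "real \<Rightarrow> real \<Rightarrow> (real \<Rightarrow> real) \<times> (real \<Rightarrow> real) \<Rightarrow>
    (real \<Rightarrow> real) \<times> (real \<Rightarrow> real) \<Rightarrow> real" where
  "bilinear_B lam \<epsilon> (u, v) (us, vs) =
     lam * L2_inner (\<lambda>x. v x - \<epsilon> powr (3/2) * weak_deriv 2 u x)
                  (\<lambda>x. vs x - \<epsilon> powr (3/2) * weak_deriv 2 us x)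
     + L2_inner (\<lambda>x. \<epsilon> powr (5/2) * weak_deriv 2 v x + 4 * u x)
                (\<lambda>x. \<epsilon> powr (3/2) * weak_deriv 2 vs x + 4 * us x)"

fun functional_F :: "real \<Rightarrow> (real \<Rightarrow> real) \<Rightarrow> (real \<Rightarrow> real) \<times> (real \<Rightarrow> real) \<Rightarrow> real" where
  "functional_F \<epsilon> f (us, vs) = L2_inner f (\<lambda>x. \<epsilon> powr (3/2) * weak_deriv 2 vs x + 4 * us x)"

fun balanced_norm :: "real \<Rightarrow> (real \<Rightarrow> real) \<times> (real \<Rightarrow> real) \<Rightarrow> real" where
  "balanced_norm \<epsilon> (u, v) =
     sqrt ((L2_norm u)\<^sup>2 + \<epsilon> ^ 3 * (L2_norm (weak_deriv 2 u))\<^sup>2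
           + (L2_norm v)\<^sup>2 + \<epsilon> ^ 4 * (L2_norm (weak_deriv 2 v))\<^sup>2)"

definition layer_decomposition ::
    "real \<Rightarrow> (real \<Rightarrow> real) \<Rightarrow> nat \<Rightarrow> real \<Rightarrow> (real \<Rightarrow> real) \<Rightarrow> bool" where
  "layer_decomposition \<epsilon> f K C0 u \<longleftrightarrow>
     (\<exists>ureg\<in>C_space K. \<exists>ubl0\<in>C_space K. \<exists>ubl1\<in>C_space K.
        (\<forall>x\<in>{0..1}. u x = ubl0 x + ureg x + ubl1 x) \<and>
        (\<forall>x\<in>{0..1}. \<forall>k\<le>K.
           \<bar>(deriv01 ^^ k) ureg x\<bar> \<le> C0 \<and>
           \<bar>(deriv01 ^^ k) ubl0 x\<bar> \<le> C0 * (1 / \<epsilon> ^ k) * exp (- x / \<epsilon>) \<and>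
           \<bar>(deriv01 ^^ k) ubl1 x\<bar> \<le> C0 * (1 / \<epsilon> ^ k) * exp (- (1 - x) / \<epsilon>)) \<and>
        (AE x in Omega_measure. \<epsilon> ^ 4 * (deriv01 ^^ 4) ureg x + 4 * ureg x = f x) \<and>
        (\<forall>x\<in>Omega. \<epsilon> ^ 4 * (deriv01 ^^ 4) ubl0 x + 4 * ubl0 x = 0) \<and>
        (\<forall>x\<in>Omega. \<epsilon> ^ 4 * (deriv01 ^^ 4) ubl1 x + 4 * ubl1 x = 0))"


section \<open>Discretization\<close>

definition shishkin_tau :: "real \<Rightarrow> real \<Rightarrow> nat \<Rightarrow> real" where
  "shishkin_tau \<sigma> \<epsilon> N = \<sigma> * \<epsilon> * ln (real N)"

text \<open>
  The \<open>i\<close>-th mesh point, \<open>i \<le> N\<close>; meaningful if \<open>4\<close> divides \<open>N > 0\<close> and the transition point is in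
  \<open>(0, 1/4]\<close>.
\<close>

definition shishkin_mesh :: "real \<Rightarrow> real \<Rightarrow> nat \<Rightarrow> nat \<Rightarrow> real" where
  "shishkin_mesh \<sigma> \<epsilon> N i =
     (let \<tau> = shishkin_tau \<sigma> \<epsilon> N; n = real N; j = real i in
        if j \<le> n / 4 then j * (\<tau> / (n / 4))
        else if j \<le> 3 * n / 4 then \<tau> + (j - n / 4) * ((1 - 2 * \<tau>) / (n / 2))
        else 1 - \<tau> + (j - 3 * n / 4) * (\<tau> / (n / 4)))"

definition spline_space :: "nat \<Rightarrow> nat \<Rightarrow> (nat \<Rightarrow> real) \<Rightarrow> (real \<Rightarrow> real) set" where
  "spline_space p N x =
     {s \<in> C_space 1. \<forall>i\<in>{1..N}. \<exists>q :: real poly. degree q \<le> p \<and>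
                        (\<forall>t\<in>{x (i - 1)<..<x i}. s t = poly q t)}"

definition Vh_space :: "nat \<Rightarrow> nat \<Rightarrow> (nat \<Rightarrow> real) \<Rightarrow> ((real \<Rightarrow> real) \<times> (real \<Rightarrow> real)) set" where
  "Vh_space p N x = (spline_space p N x \<times> spline_space p N x) \<inter> V_space"

definition fe_solution :: "nat \<Rightarrow> nat \<Rightarrow> (nat \<Rightarrow> real) \<Rightarrow> real \<Rightarrow> real \<Rightarrow> (real \<Rightarrow> real) \<Rightarrow>
    (real \<Rightarrow> real) \<times> (real \<Rightarrow> real) \<Rightarrow> bool" where
  "fe_solution p N x lam \<epsilon> f w \<longleftrightarrow>
     w \<in> Vh_space p N x \<and>
     (\<forall>ws\<in>Vh_space p N x. bilinear_B lam \<epsilon> w ws = functional_F \<epsilon> f ws)"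

end

theory Submission
  imports Defs
begin

text \<open>
  Two facts carry the estimate: the Galerkin solution is quasi-optimal in the balanced norm, and the
  spline space contains a good approximation of a function with two exponential layers.

  Quasi-optimality. Let \<open>\<eta>\<close> be the error of some pair of splines with the correct boundary values and
  \<open>\<xi>\<close> the difference between this pair and the Galerkin solution, which is an admissible test pair.
  In the bilinear form the mixed product \<open>\<epsilon>\<^sup>3\<^sup>/\<^sup>2\<langle>u, v\<^sub>*''\<rangle>\<close> is not under the control of the balanced
  norm, which contains \<open>v\<^sub>*''\<close> only with the smaller weight \<open>\<epsilon>\<^sup>2\<close>. Since the first components and
  their slopes vanish at both ends, \<open>green_formula\<close> turns it into \<open>\<epsilon>\<^sup>3\<^sup>/\<^sup>2\<langle>u'', v\<^sub>*\<rangle>\<close>, a product of two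
  terms of the norm; its companion with \<open>\<langle>v'', u\<^sub>*\<rangle>\<close> is treated alike. After this step the
  Galerkin equation says that the integral of a single quadratic form in the eight scaled components
  of \<open>\<eta>\<close> and \<open>\<xi>\<close> vanishes, and a pointwise lower bound for that form
  (\<open>weighted_form_lower_bound\<close>, the place where \<open>\<lambda> \<ge> 3\<close> enters) gives \<open>quasi_optimality\<close>.

  Approximation. On each cell, a Taylor polynomial at the left end plus a cubic that repairs value and
  slope at the right end is a Hermite interpolant of optimal order (\<open>hermite_local\<close>). On the fine
  cells, whose width is of order \<open>\<epsilon> N\<^sup>-\<^sup>1 ln N\<close>, the powers of the width cancel the powers of
  \<open>1/\<epsilon>\<close> in the derivatives of a layer function. On the coarse cells Hermite interpolation of a layer
  is not good enough: its slope at the transition point \<open>\<tau>\<close> is of size \<open>\<epsilon>\<^sup>-\<^sup>1 N\<^sup>-\<^sup>\<sigma>\<close>, and multiplied by a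
  coarse width this is unbounded as \<open>\<epsilon> \<rightarrow> 0\<close>. Beyond \<open>\<tau>\<close> the layer is therefore
  approximated essentially by zero, and continuity is restored by subtracting from the interpolant
  on the whole of \<open>[0,\<tau>]\<close> one cubic that carries value and slope of the layer at \<open>\<tau>\<close>. Because
  \<open>\<tau> \<ge> \<epsilon>\<close>, this costs, relative to the \<open>L\<^sub>2\<close> norm of the layer and
  up to a constant, no more than \<open>(ln N)\<^sup>3\<^sup>/\<^sup>2 N\<^sup>-\<^sup>\<sigma>\<close>, which is within
  the claimed bound since \<open>p - 1 \<ge> 2\<close> and \<open>\<sigma> \<ge> p - 1\<close>. A second cubic on \<open>[0,1]\<close> restores the
  exponentially small boundary data at the far end, so that the approximation of \<open>u\<close> satisfies the
  boundary conditions (\<open>layer_part_approx\<close>, \<open>layered_function_approx\<close>). The same estimate serves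
  \<open>u\<close>, with layers of amplitude \<open>C\<^sub>0\<close>, and \<open>\<epsilon>\<^sup>3\<^sup>/\<^sup>2 u''\<close>, with layers of amplitude
  \<open>C\<^sub>0 \<epsilon>\<^sup>-\<^sup>1\<^sup>/\<^sup>2\<close>.

  All functions involved are \<open>C\<^sup>1\<close> and piecewise \<open>C\<^sup>2\<close>. Their second weak derivatives agree almost
  everywhere with the classical ones by \<open>weak_deriv_unique\<close>, so that both parts are statements about
  classical derivatives.
\<close>

section \<open>Uniqueness of weak derivatives\<close>

text \<open>
  These functions are flat at \<open>0\<close>. The polynomial factor makes the family closed
  under differentiation; smoothness then needs no formula for higher derivatives.
\<close>

definition flat_exp :: "real poly \<Rightarrow> real \<Rightarrow> real \<Rightarrow> real" where
  "flat_exp P c t = (if t > 0 then poly P (1 / t) * exp (- c / t) else 0)"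

lemma poly_times_exp_decay:
  assumes "c > 0"
  shows "((\<lambda>x::real. poly P x * exp (- c * x)) \<longlongrightarrow> 0) at_top"
proof (induction P rule: pCons_induct)
  case 0
  then show ?case by simp
next
  case (pCons a P)
  have mono: "((\<lambda>x::real. x ^ k * exp (- c * x)) \<longlongrightarrow> 0) at_top" for k
  proof -
    have f: "filterlim (\<lambda>x::real. c * x) at_top at_top"
      using assms by (simp add: filterlim_tendsto_pos_mult_at_top[OF tendsto_const] filterlim_ident)
    have "((\<lambda>x. (1 / c ^ k) * ((c * x) ^ k / exp (c * x))) \<longlongrightarrow> (1 / c ^ k) * 0) at_top"
      by (intro tendsto_mult tendsto_const filterlim_compose[OF tendsto_power_div_exp_0 f])
    then show ?thesis
      using assms by (simp add: power_mult_distrib exp_minus field_simps)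
  qed
  have "((\<lambda>x. \<Sum>i\<le>degree (pCons a P). coeff (pCons a P) i * (x ^ i * exp (- c * x))) \<longlongrightarrow>
         (\<Sum>i\<le>degree (pCons a P). coeff (pCons a P) i * 0)) at_top"
    by (intro tendsto_sum tendsto_mult tendsto_const mono)
  then show ?case
    by (simp add: poly_altdef sum_distrib_right mult.assoc)
qed

lemma flat_exp_at_right_0:
  assumes "c > 0"
  shows "(flat_exp P c \<longlongrightarrow> 0) (at_right 0)"
proof -
  have "((\<lambda>x. flat_exp P c (inverse x)) \<longlongrightarrow> 0) at_top"
    by (rule Lim_transform_eventually[OF poly_times_exp_decay[OF assms, of P]])
       (auto intro!: eventually_mono[OF eventually_gt_at_top[of 0]] simp: flat_exp_def field_simps)
  then show ?thesis by (simp add: filterlim_at_right_to_top)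
qed

text \<open>
  At \<open>0\<close> the difference quotient of \<open>flat_exp P c\<close> is itself the member
  of the family with polynomial \<open>pCons 0 P\<close>, so its limit is known.
\<close>

lemma flat_exp_deriv:
  assumes "c > 0"
  shows "(flat_exp P c has_real_derivative
           flat_exp (monom 1 2 * (smult c P - pderiv P)) c t) (at t)"
proof -
  consider "t > 0" | "t < 0" | "t = 0" by linarith
  then show ?thesis
  proof cases
    case 1
    have "((\<lambda>t. poly P (1 / t) * exp (- c / t)) has_real_derivative
           flat_exp (monom 1 2 * (smult c P - pderiv P)) c t) (at t)"
      using 1 by (auto intro!: derivative_eq_intros
          simp: flat_exp_def poly_monom field_simps power2_eq_square)
    then show ?thesis
      by (rule has_field_derivative_transform_within_open[where S = "{0<..}"])
         (use 1 in \<open>auto simp: flat_exp_def\<close>)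
  next
    case 2
    have "((\<lambda>t. 0) has_real_derivative 0) (at t)" by simp
    then have "(flat_exp P c has_real_derivative 0) (at t)"
      by (rule has_field_derivative_transform_within_open[where S = "{..<0}"])
         (use 2 in \<open>auto simp: flat_exp_def\<close>)
    then show ?thesis using 2 by (simp add: flat_exp_def)
  next
    case 3
    have "((\<lambda>h. flat_exp P c h / h) \<longlongrightarrow> 0) (at_right 0)"
      by (rule Lim_transform_eventually[OF flat_exp_at_right_0[OF assms, of "pCons 0 P"]])
         (auto intro!: eventually_at_right_less[THEN eventually_mono] simp: flat_exp_def)
    moreover have "((\<lambda>h. flat_exp P c h / h) \<longlongrightarrow> 0) (at_left 0)"
      by (rule Lim_transform_eventually[OF tendsto_const])
         (auto simp: eventually_at_filter flat_exp_def)
    ultimately have "((\<lambda>h. flat_exp P c h / h) \<longlongrightarrow> 0) (at 0)"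
      by (simp add: filterlim_split_at)
    then show ?thesis using 3 by (simp add: DERIV_def) (simp add: flat_exp_def)
  qed
qed

text \<open>
  A set of functions that contains derivatives of all its members consists of smooth functions.
  The closure under sums and products is what the product rule asks for.
\<close>

inductive_set smooth_bumps :: "(real \<Rightarrow> real) set" where
  flat: "c > 0 \<Longrightarrow> (\<lambda>x. flat_exp P c (s * x + a)) \<in> smooth_bumps"
| add: "f \<in> smooth_bumps \<Longrightarrow> g \<in> smooth_bumps \<Longrightarrow> (\<lambda>x. f x + g x) \<in> smooth_bumps"
| mult: "f \<in> smooth_bumps \<Longrightarrow> g \<in> smooth_bumps \<Longrightarrow> (\<lambda>x. f x * g x) \<in> smooth_bumps"

lemma smooth_bumps_deriv:
  assumes "f \<in> smooth_bumps"
  shows "\<exists>g\<in>smooth_bumps. \<forall>x. (f has_real_derivative g x) (at x)"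
  using assms
proof induction
  case (flat c P s a)
  define Q where "Q = monom 1 2 * (smult c P - pderiv P)"
  have "((\<lambda>x. flat_exp P c (s * x + a)) has_real_derivative flat_exp (smult s Q) c (s * x + a)) (at x)" for x
  proof -
    have "((\<lambda>x. flat_exp P c (s * x + a)) has_real_derivative flat_exp Q c (s * x + a) * s) (at x)"
      by (rule DERIV_chain2[OF flat_exp_deriv[OF flat, of P, folded Q_def]])
         (auto intro!: derivative_eq_intros)
    then show ?thesis by (simp add: flat_exp_def mult_ac split: if_splits)
  qed
  then show ?case
    using smooth_bumps.flat[OF flat, of "smult s Q" s a]
    by (intro bexI[of _ "\<lambda>x. flat_exp (smult s Q) c (s * x + a)"]) auto
next
  case (add f g)
  then obtain f' g' where "f' \<in> smooth_bumps" "g' \<in> smooth_bumps"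
    "\<And>x. (f has_real_derivative f' x) (at x)" "\<And>x. (g has_real_derivative g' x) (at x)" by blast
  then show ?case
    by (intro bexI[of _ "\<lambda>x. f' x + g' x"]) (auto intro!: derivative_eq_intros smooth_bumps.intros)
next
  case (mult f g)
  then obtain f' g' where "f' \<in> smooth_bumps" "g' \<in> smooth_bumps"
    "\<And>x. (f has_real_derivative f' x) (at x)" "\<And>x. (g has_real_derivative g' x) (at x)" by blast
  then show ?case using mult
    by (intro bexI[of _ "\<lambda>x. f' x * g x + f x * g' x"])
       (auto intro!: derivative_eq_intros smooth_bumps.intros)
qed

lemma smooth_bumps_smooth:
  assumes "f \<in> smooth_bumps"
  shows "(deriv ^^ k) f \<in> smooth_bumps" "(deriv ^^ k) f differentiable_on UNIV"
proof -
  show mem: "(deriv ^^ k) f \<in> smooth_bumps" for k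
  proof (induction k)
    case (Suc k)
    from smooth_bumps_deriv[OF Suc] obtain g where
      g: "g \<in> smooth_bumps" "\<And>x. ((deriv ^^ k) f has_real_derivative g x) (at x)" by blast
    then have "deriv ((deriv ^^ k) f) = g" by (auto intro: DERIV_imp_deriv)
    with g show ?case by simp
  qed (use assms in simp)
  from smooth_bumps_deriv[OF mem[of k]] show "(deriv ^^ k) f differentiable_on UNIV"
    by (meson differentiable_at_imp_differentiable_on real_differentiable_def)
qed

text \<open>
  The parameter \<open>c\<close> controls how steeply the bump rises: for \<open>c \<rightarrow>
  0\<close> it tends to the indicator of \<open>(a,b)\<close>, staying below \<open>1\<close>.
\<close>

definition bump :: "real \<Rightarrow> real \<Rightarrow> real \<Rightarrow> real \<Rightarrow> real" where
  "bump c a b x = flat_exp 1 c (x - a) * flat_exp 1 c (b - x)"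

lemma bump_test_function:
  assumes "c > 0" "0 < a" "a < b" "b < 1"
  shows "bump c a b \<in> test_functions"
proof -
  have "bump c a b = (\<lambda>x. flat_exp 1 c (1 * x + - a) * flat_exp 1 c ((-1) * x + b))"
    by (auto simp: bump_def)
  then have "bump c a b \<in> smooth_bumps"
    using assms by (simp only:) (intro smooth_bumps.intros)
  moreover have "closure {x. bump c a b x \<noteq> 0} \<subseteq> {a..b}"
    by (rule closure_minimal) (auto simp: bump_def flat_exp_def split: if_splits)
  ultimately show ?thesis
    using assms smooth_bumps_smooth by (force simp: test_functions_def)
qed

lemma bump_bounds: "c > 0 \<Longrightarrow> \<bar>bump c a b x\<bar> \<le> 1"
  by (auto simp: bump_def flat_exp_def abs_mult intro!: mult_le_one)

text \<open>
  The support shrinks slightly away from the end points so that each bump is a test function even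
  if \<open>a = 0\<close> or \<open>b = 1\<close>.
\<close>

lemma bump_tendsto_indicator:
  assumes "a < b"
  shows "(\<lambda>n. bump (1 / real (Suc n)) (a + (b - a) / real (n + 3)) (b - (b - a) / real (n + 3)) x)
           \<longlonglongrightarrow> indicator {a<..<b} x"
proof (cases "x \<in> {a<..<b}")
  case False
  have pos: "(b - a) / real (n + 3) > 0" for n using assms by simp
  have "bump (1 / real (Suc n)) (a + (b - a) / real (n + 3)) (b - (b - a) / real (n + 3)) x = 0" for n
    using False pos[of n] by (auto simp: bump_def flat_exp_def)
  then show ?thesis using False by simp
next
  case True
  have e: "(\<lambda>n. (b - a) / real (n + 3)) \<longlonglongrightarrow> 0"
    by (rule LIMSEQ_ignore_initial_segment[OF lim_const_over_n])
  have c: "(\<lambda>n. 1 / real (Suc n)) \<longlonglongrightarrow> 0"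
    by (rule LIMSEQ_Suc[OF lim_const_over_n])
  have l: "(\<lambda>n. x - (a + (b - a) / real (n + 3))) \<longlonglongrightarrow> x - (a + 0)"
    by (intro tendsto_intros e)
  have r: "(\<lambda>n. (b - (b - a) / real (n + 3)) - x) \<longlonglongrightarrow> (b - 0) - x"
    by (intro tendsto_intros e)
  have lim: "(\<lambda>n. exp (- (1 / real (Suc n)) / (x - (a + (b - a) / real (n + 3)))) *
             exp (- (1 / real (Suc n)) / ((b - (b - a) / real (n + 3)) - x)))
          \<longlonglongrightarrow> exp (- 0 / (x - (a + 0))) * exp (- 0 / ((b - 0) - x))"
    by (intro tendsto_intros c l r) (use True in auto)
  have lpos: "\<forall>\<^sub>F n in sequentially. x - (a + (b - a) / real (n + 3)) > 0"
    by (rule order_tendstoD(1)[OF l]) (use True in auto)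
  have "\<forall>\<^sub>F n in sequentially. (b - (b - a) / real (n + 3)) - x > 0"
    by (rule order_tendstoD(1)[OF r]) (use True in auto)
  then have "\<forall>\<^sub>F n in sequentially.
      exp (- (1 / real (Suc n)) / (x - (a + (b - a) / real (n + 3)))) *
      exp (- (1 / real (Suc n)) / ((b - (b - a) / real (n + 3)) - x)) =
      bump (1 / real (Suc n)) (a + (b - a) / real (n + 3)) (b - (b - a) / real (n + 3)) x"
    using lpos by eventually_elim (simp add: bump_def flat_exp_def)
  from Lim_transform_eventually[OF lim this] show ?thesis using True by simp
qed

lemma L2_integrable_mult:
  assumes "f \<in> L2_space" "g \<in> L2_space"
  shows "integrable Omega_measure (\<lambda>x. f x * g x)"
proof (rule Bochner_Integration.integrable_bound)
  show "integrable Omega_measure (\<lambda>x. (f x)\<^sup>2 + (g x)\<^sup>2)"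
    using assms by (simp add: L2_space_def)
  show "(\<lambda>x. f x * g x) \<in> borel_measurable Omega_measure"
    using assms by (auto simp: L2_space_def intro!: borel_measurable_times)
  show "AE x in Omega_measure. norm (f x * g x) \<le> norm ((f x)\<^sup>2 + (g x)\<^sup>2)"
  proof (rule AE_I2)
    fix x
    have "2 * (\<bar>f x\<bar> * \<bar>g x\<bar>) \<le> (f x)\<^sup>2 + (g x)\<^sup>2"
      using sum_squares_bound[of "\<bar>f x\<bar>" "\<bar>g x\<bar>"] by simp
    moreover have "0 \<le> \<bar>f x\<bar> * \<bar>g x\<bar>" by simp
    ultimately have "\<bar>f x\<bar> * \<bar>g x\<bar> \<le> (f x)\<^sup>2 + (g x)\<^sup>2" by linarith
    then show "norm (f x * g x) \<le> norm ((f x)\<^sup>2 + (g x)\<^sup>2)" by (simp add: abs_mult)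
  qed
qed

interpretation Omega_finite: finite_measure Omega_measure
  by (rule finite_measure_lebesgue_on) simp

lemma bounded_measurable_L2:
  assumes "g \<in> borel_measurable Omega_measure" "\<And>x. x \<in> Omega \<Longrightarrow> \<bar>g x\<bar> \<le> B"
  shows "g \<in> L2_space"
proof -
  have "integrable Omega_measure (\<lambda>x. (g x)\<^sup>2)"
  proof (rule Omega_finite.integrable_const_bound[of _ "B\<^sup>2"])
    show "AE x in Omega_measure. norm ((g x)\<^sup>2) \<le> B\<^sup>2"
    proof (rule AE_I2)
      fix x assume "x \<in> space Omega_measure"
      then have "\<bar>g x\<bar> \<le> B" using assms(2) by simp
      then have "\<bar>g x\<bar>\<^sup>2 \<le> B\<^sup>2" by (intro power_mono) auto
      then show "norm ((g x)\<^sup>2) \<le> B\<^sup>2" by simp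
    qed
    show "(\<lambda>x. (g x)\<^sup>2) \<in> borel_measurable Omega_measure" using assms(1) by simp
  qed
  then show ?thesis using assms(1) by (simp add: L2_space_def)
qed

lemma L2_space_const: "(\<lambda>x. c) \<in> L2_space"
  by (rule bounded_measurable_L2[of _ "\<bar>c\<bar>"]) auto

lemma L2_imp_integrable: "f \<in> L2_space \<Longrightarrow> integrable Omega_measure f"
  using L2_integrable_mult[OF _ L2_space_const[of 1], of f] by simp

lemma bump_measurable: "0 < c \<Longrightarrow> bump c a b \<in> borel_measurable borel"
  unfolding bump_def flat_exp_def poly_1 by measurable

lemma integral_interval_eq_0_of_weakly_zero:
  assumes h: "integrable Omega_measure h"
    and zero: "\<And>\<phi>. \<phi> \<in> test_functions \<Longrightarrow> (LINT x|Omega_measure. h x * \<phi> x) = 0"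
    and ab: "0 \<le> a" "a < b" "b \<le> 1"
  shows "(LINT x|Omega_measure. h x * indicator {a<..<b} x) = 0"
proof -
  define \<phi> where "\<phi> = (\<lambda>n. bump (1 / real (Suc n)) (a + (b - a) / real (n + 3)) (b - (b - a) / real (n + 3)))"
  have test: "\<phi> n \<in> test_functions" for n
  proof -
    define e where "e = (b - a) / real (n + 3)"
    have "e \<le> (b - a) / 3" "e > 0" unfolding e_def
      using ab frac_le[of "b - a" "b - a" 3 "real (n + 3)"] by (simp_all del: of_nat_add)
    then show ?thesis unfolding \<phi>_def e_def[symmetric]
      using ab by (intro bump_test_function) auto
  qed
  have meas [measurable]: "\<phi> n \<in> borel_measurable borel" for n
    unfolding \<phi>_def by (rule bump_measurable) simp
  have [measurable]: "\<phi> n \<in> borel_measurable Omega_measure" for n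
    by (intro measurable_restrict_space1 measurable_completion) simp
  have [measurable]: "h \<in> borel_measurable Omega_measure" using h by auto
  have "(\<lambda>n. LINT x|Omega_measure. h x * \<phi> n x) \<longlonglongrightarrow> (LINT x|Omega_measure. h x * indicator {a<..<b} x)"
  proof (rule integral_dominated_convergence[where w = "\<lambda>x. \<bar>h x\<bar>"])
    show "(\<lambda>x. h x * indicator {a<..<b} x) \<in> borel_measurable Omega_measure"
      by (intro borel_measurable_times measurable_restrict_space1[OF borel_measurable_indicator]) auto
    show "AE x in Omega_measure. (\<lambda>i. h x * \<phi> i x) \<longlonglongrightarrow> h x * indicator {a<..<b} x"
      using bump_tendsto_indicator[OF ab(2)] by (auto intro!: tendsto_intros simp: \<phi>_def)
    show "AE x in Omega_measure. norm (h x * \<phi> i x) \<le> \<bar>h x\<bar>" for i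
      by (auto simp: abs_mult \<phi>_def intro!: mult_left_le bump_bounds)
  qed (use h in auto)
  then show ?thesis using zero[OF test] by (simp add: LIMSEQ_const_iff)
qed

text \<open>
  The fundamental lemma of the calculus of variations: bumps approximate indicators of intervals,
  intervals generate the Borel sets, and an integrable function whose integral over every Borel
  set is zero vanishes almost everywhere.
\<close>

lemma weakly_zero_imp_AE_zero:
  assumes h: "integrable Omega_measure h"
    and zero: "\<And>\<phi>. \<phi> \<in> test_functions \<Longrightarrow> (LINT x|Omega_measure. h x * \<phi> x) = 0"
  shows "AE x in Omega_measure. h x = 0"
proof -
  define H where "H = (\<lambda>x. indicator Omega x * h x)"
  have H: "integrable lebesgue H"
    using h by (simp add: H_def integrable_restrict_space)
  obtain g where g: "g \<in> borel_measurable lborel" "AE x in lborel. H x = g x"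
    using completion_ex_borel_measurable_real[of H lborel] H by auto
  have gL: "g \<in> borel_measurable lebesgue" using g(1) by (rule measurable_completion)
  have gH: "AE x in lebesgue. H x = g x" using g(2) by (simp add: AE_completion_iff)
  have gint: "integrable lebesgue g" using H gH gL integrable_cong_AE by blast
  have gint': "integrable lborel g" using gint g(1) by (simp add: integrable_completion)
  have "(LINT x|lborel. indicator A x * g x) = 0" if "A \<in> sets borel" for A
  proof -
    have gen: "sets borel = sigma_sets UNIV (range (\<lambda>(a, b). {a<..<b::real}))"
      by (subst borel_eq_box) (simp add: box_real[abs_def])
    have base: "(LINT x|lborel. indicator {a<..<b} x * g x) = 0" for a b :: real
    proof -
      have "(LINT x|lborel. indicator {a<..<b} x * g x) = (LINT x|lebesgue. indicator {a<..<b} x * g x)"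
        using g(1) by (intro integral_completion[symmetric]) auto
      also have "\<dots> = (LINT x|lebesgue. indicator {a<..<b} x * H x)"
        using gH gL H by (intro integral_cong_AE borel_measurable_times borel_measurable_indicator) auto
      also have "\<dots> = (LINT x|lebesgue. indicator Omega x * (h x * indicator {max a 0<..<min b 1} x))"
        by (intro Bochner_Integration.integral_cong) (auto simp: H_def indicator_def)
      also have "\<dots> = (LINT x|Omega_measure. h x * indicator {max a 0<..<min b 1} x)"
        by (simp add: integral_restrict_space)
      also have "\<dots> = 0"
      proof (cases "max a 0 < min b 1")
        case True
        then show ?thesis by (intro integral_interval_eq_0_of_weakly_zero[OF h zero]) auto
      next
        case False
        then have "{max a 0<..<min b 1} = {}" by (intro greaterThanLessThan_empty) linarith
        then show ?thesis by simp
      qed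
      finally show ?thesis .
    qed
    \<comment> \<open>Open intervals are an intersection-stable generator, so the claim extends to all Borel sets.\<close>
    have UN: "Int_stable (range (\<lambda>(a, b). {a<..<b::real}))"
      by (auto simp: Int_stable_def)
    have subset_Pow: "range (\<lambda>(a, b). {a<..<b::real}) \<subseteq> Pow UNIV" by simp
    have ind: "integrable lborel (\<lambda>x. indicator B x * g x)" if "B \<in> sets borel" for B
      using integrable_mult_indicator[OF _ gint', of B] that by simp
    have "A \<in> sigma_sets UNIV (range (\<lambda>(a, b). {a<..<b::real}))" using that gen by simp
    then show ?thesis
    proof (induction rule: sigma_sets_induct_disjoint[OF UN subset_Pow, consumes 1, case_names basic empty compl union])
      case (basic A)
      then show ?case using base by auto
    next
      case (compl A)
      then have A: "A \<in> sets borel" using gen by simp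
      have "(LINT x|lborel. indicator {0<..<1} x * g x) = 0" by (rule base)
      have gz: "AE x in lborel. indicator (UNIV - A) x * g x = indicator {0<..<1} x * g x - indicator A x * g x"
        using g(2)
      proof eventually_elim
        case (elim x)
        then show ?case by (cases "x \<in> Omega"; cases "x \<in> A") (simp_all add: H_def)
      qed
      have "(LINT x|lborel. indicator (UNIV - A) x * g x) =
            (LINT x|lborel. indicator {0<..<1} x * g x - indicator A x * g x)"
        using g(1) A by (intro integral_cong_AE gz) auto
      also have "\<dots> = 0" using base compl A ind by (subst Bochner_Integration.integral_diff) auto
      finally show ?case .
    next
      case (union A)
      then have A: "\<And>i. A i \<in> sets borel" using gen by auto
      have "set_lebesgue_integral lborel (\<Union>i. A i) g = (\<Sum>i. set_lebesgue_integral lborel (A i) g)"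
        using union(1) A ind[of "\<Union>i. A i"]
        by (intro lebesgue_integral_countable_add) (auto simp: disjoint_family_on_def set_integrable_def)
      then show ?case using union(3) by (simp add: set_lebesgue_integral_def)
    qed auto
  qed
  then have "AE x in lborel. g x = 0"
    by (intro sigma_finite_measure.density_zero[OF lborel.sigma_finite_measure_axioms gint'])
       (auto simp: set_lebesgue_integral_def)
  with g(2) have "AE x in lborel. H x = 0" by eventually_elim simp
  then have "AE x in lebesgue. H x = 0" by (rule AE_completion)
  then show ?thesis
    by (subst AE_restrict_space_iff) (auto elim!: eventually_mono simp: H_def indicator_def)
qed

lemma test_functions_L2:
  assumes "\<phi> \<in> test_functions"
  shows "\<phi> \<in> L2_space"
proof -
  have "(deriv ^^ 0) \<phi> differentiable_on UNIV" using assms unfolding test_functions_def by blast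
  then have c: "continuous_on UNIV \<phi>" by (simp add: differentiable_imp_continuous_on)
  then obtain B where "\<And>x. x \<in> {0..1} \<Longrightarrow> \<bar>\<phi> x\<bar> \<le> B"
    using compact_continuous_image[OF continuous_on_subset[OF c subset_UNIV], of "{0..1}"]
    by (fastforce dest!: compact_imp_bounded simp: bounded_iff)
  then show ?thesis
    using c by (intro bounded_measurable_L2[of _ B] measurable_restrict_space1 measurable_completion)
      (auto intro: borel_measurable_continuous_onI)
qed

lemma weak_deriv_unique:
  assumes "has_weak_deriv k u g" "has_weak_deriv k u g'"
  shows "AE x in Omega_measure. g x = g' x"
proof -
  have L: "g \<in> L2_space" "g' \<in> L2_space" using assms by (auto simp: has_weak_deriv_def)
  have "AE x in Omega_measure. g x - g' x = 0"
  proof (rule weakly_zero_imp_AE_zero)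
    show "integrable Omega_measure (\<lambda>x. g x - g' x)" using L by (auto intro: L2_imp_integrable)
    fix \<phi> assume "\<phi> \<in> test_functions"
    then have "(-1) ^ k * L2_inner g \<phi> = (-1) ^ k * L2_inner g' \<phi>"
      using assms by (simp add: has_weak_deriv_def)
    then have "L2_inner g \<phi> = L2_inner g' \<phi>" by simp
    then show "(LINT x|Omega_measure. (g x - g' x) * \<phi> x) = 0"
      using L test_functions_L2[OF \<open>\<phi> \<in> test_functions\<close>]
      by (simp add: left_diff_distrib L2_inner_def L2_integrable_mult)
  qed
  then show ?thesis by eventually_elim simp
qed

section \<open>Piecewise twice differentiable functions and their weak derivatives\<close>

text \<open>
  Every integrand below is bounded and measurable, and this class is closed under all pointwise
  operations that occur; integrability becomes a syntactic matter.
\<close>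

definition bounded_measurable :: "(real \<Rightarrow> real) \<Rightarrow> bool" where
  "bounded_measurable g \<longleftrightarrow> g \<in> borel_measurable Omega_measure \<and> (\<exists>B. \<forall>x\<in>Omega. \<bar>g x\<bar> \<le> B)"

named_theorems bm_intros

lemma bm_const [bm_intros]: "bounded_measurable (\<lambda>x. c)"
  by (auto simp: bounded_measurable_def)

lemma bm_add [bm_intros]:
  assumes "bounded_measurable f" "bounded_measurable g"
  shows "bounded_measurable (\<lambda>x. f x + g x)"
proof -
  obtain B1 B2 where B: "\<And>x. x \<in> Omega \<Longrightarrow> \<bar>f x\<bar> \<le> B1" "\<And>x. x \<in> Omega \<Longrightarrow> \<bar>g x\<bar> \<le> B2"
    using assms unfolding bounded_measurable_def by metis
  have "\<forall>x\<in>Omega. \<bar>f x + g x\<bar> \<le> B1 + B2"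
    using B by (auto intro!: order_trans[OF abs_triangle_ineq add_mono])
  then show ?thesis using assms by (auto simp: bounded_measurable_def)
qed

lemma bm_mult [bm_intros]:
  assumes "bounded_measurable f" "bounded_measurable g"
  shows "bounded_measurable (\<lambda>x. f x * g x)"
proof -
  obtain B1 B2 where B: "\<And>x. x \<in> Omega \<Longrightarrow> \<bar>f x\<bar> \<le> B1" "\<And>x. x \<in> Omega \<Longrightarrow> \<bar>g x\<bar> \<le> B2"
    using assms unfolding bounded_measurable_def by metis
  have "\<forall>x\<in>Omega. \<bar>f x * g x\<bar> \<le> B1 * B2"
    unfolding abs_mult using B by (auto intro!: mult_mono')
  then show ?thesis using assms by (auto simp: bounded_measurable_def intro!: borel_measurable_times)
qed

lemma bm_uminus [bm_intros]: "bounded_measurable f \<Longrightarrow> bounded_measurable (\<lambda>x. - f x)"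
  using bm_mult[OF bm_const[of "-1"], of f] by simp

lemma bm_diff [bm_intros]:
  "bounded_measurable f \<Longrightarrow> bounded_measurable g \<Longrightarrow> bounded_measurable (\<lambda>x. f x - g x)"
  using bm_add[OF _ bm_uminus, of f g] by simp

lemma bm_power [bm_intros]: "bounded_measurable f \<Longrightarrow> bounded_measurable (\<lambda>x. f x ^ n)"
  by (induction n) (auto intro: bm_intros)

lemma bm_L2: "bounded_measurable f \<Longrightarrow> f \<in> L2_space"
  by (auto simp: bounded_measurable_def intro: bounded_measurable_L2)

lemma bm_integrable: "bounded_measurable f \<Longrightarrow> integrable Omega_measure f"
  by (intro L2_imp_integrable bm_L2)

lemma bm_continuous:
  assumes "continuous_on {0..1} f"
  shows "bounded_measurable f"
proof -
  obtain B where "\<And>x. x \<in> {0..1} \<Longrightarrow> \<bar>f x\<bar> \<le> B"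
    using compact_continuous_image[OF assms] by (fastforce dest!: compact_imp_bounded simp: bounded_iff)
  moreover have "f \<in> borel_measurable Omega_measure"
    by (intro continuous_imp_measurable_on_sets_lebesgue continuous_on_subset[OF assms]) auto
  ultimately show ?thesis by (auto simp: bounded_measurable_def intro!: exI[of _ B])
qed

lemma integral_Omega_eq:
  assumes "bounded_measurable f"
  shows "(LINT x|Omega_measure. f x) = integral {0..1} f"
  using lebesgue_integral_eq_integral[OF bm_integrable[OF assms]]
  by (simp add: integral_open_interval_real)

lemma integral_Omega_of_has_integral:
  assumes "bounded_measurable f" "(f has_integral I) {0..1}"
  shows "(LINT x|Omega_measure. f x) = I"
  using integral_Omega_eq[OF assms(1)] assms(2) by (simp add: integral_unique)

lemma Omega_integral_mono:
  assumes "bounded_measurable f" "bounded_measurable g" "\<And>x. x \<in> Omega \<Longrightarrow> f x \<le> g x"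
  shows "(LINT x|Omega_measure. f x) \<le> (LINT x|Omega_measure. g x)"
  using assms by (intro integral_mono bm_integrable) auto

text \<open>
  The function \<open>w\<close> is \<open>C\<^sup>1\<close> on the closed interval, while its
  slope \<open>w1\<close> may have finitely many kinks, as for splines. Values of
  \<open>w2\<close> at the kinks are arbitrary.
\<close>

definition piecewise_C2 :: "(real \<Rightarrow> real) \<Rightarrow> (real \<Rightarrow> real) \<Rightarrow> (real \<Rightarrow> real) \<Rightarrow> bool" where
  "piecewise_C2 w w1 w2 \<longleftrightarrow>
     (\<forall>x\<in>{0..1}. (w has_real_derivative w1 x) (at x within {0..1})) \<and>
     continuous_on {0..1} w1 \<and> bounded_measurable w2 \<and>
     (\<exists>S. finite S \<and> (\<forall>x\<in>Omega - S. (w1 has_real_derivative w2 x) (at x)))"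

lemma piecewise_C2_continuous:
  assumes "piecewise_C2 w w1 w2"
  shows "continuous_on {0..1} w" "continuous_on {0..1} w1"
  using assms by (auto simp: piecewise_C2_def intro: DERIV_continuous_on)

lemma piecewise_C2_bm:
  assumes "piecewise_C2 w w1 w2"
  shows "bounded_measurable w" "bounded_measurable w1" "bounded_measurable w2"
  using piecewise_C2_continuous[OF assms] assms by (auto simp: piecewise_C2_def intro: bm_continuous)

lemma piecewise_C2_at:
  assumes "piecewise_C2 w w1 w2" "x \<in> Omega"
  shows "(w has_real_derivative w1 x) (at x)"
proof -
  have "(w has_real_derivative w1 x) (at x within {0<..<1})"
    using assms by (auto simp: piecewise_C2_def intro: DERIV_subset[of _ _ _ "{0..1}"])
  then show ?thesis using assms(2) by (simp add: at_within_open[of _ Omega])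
qed

lemma piecewise_C2_add:
  assumes "piecewise_C2 w w1 w2" "piecewise_C2 z z1 z2"
  shows "piecewise_C2 (\<lambda>x. w x + z x) (\<lambda>x. w1 x + z1 x) (\<lambda>x. w2 x + z2 x)"
proof -
  obtain S T where "finite S" "\<forall>x\<in>Omega - S. (w1 has_real_derivative w2 x) (at x)"
    "finite T" "\<forall>x\<in>Omega - T. (z1 has_real_derivative z2 x) (at x)"
    using assms by (auto simp: piecewise_C2_def)
  then have "finite (S \<union> T) \<and>
      (\<forall>x\<in>Omega - (S \<union> T). ((\<lambda>x. w1 x + z1 x) has_real_derivative w2 x + z2 x) (at x))"
    by (auto intro!: derivative_intros)
  then show ?thesis using assms
    unfolding piecewise_C2_def
    by (intro conjI) (auto intro!: derivative_intros continuous_intros bm_intros)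
qed

lemma piecewise_C2_cmult:
  assumes "piecewise_C2 w w1 w2"
  shows "piecewise_C2 (\<lambda>x. c * w x) (\<lambda>x. c * w1 x) (\<lambda>x. c * w2 x)"
proof -
  obtain S where "finite S" "\<forall>x\<in>Omega - S. (w1 has_real_derivative w2 x) (at x)"
    using assms by (auto simp: piecewise_C2_def)
  then have "finite S \<and> (\<forall>x\<in>Omega - S. ((\<lambda>x. c * w1 x) has_real_derivative c * w2 x) (at x))"
    by (auto intro!: DERIV_cmult)
  then show ?thesis using assms
    unfolding piecewise_C2_def
    by (intro conjI) (auto intro!: DERIV_cmult continuous_intros bm_intros)
qed

lemma piecewise_C2_diff:
  assumes "piecewise_C2 w w1 w2" "piecewise_C2 z z1 z2"
  shows "piecewise_C2 (\<lambda>x. w x - z x) (\<lambda>x. w1 x - z1 x) (\<lambda>x. w2 x - z2 x)"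
  using piecewise_C2_add[OF assms(1) piecewise_C2_cmult[OF assms(2), of "-1"]] by simp

text \<open>
  The function \<open>w z1 - w1 z\<close> is continuous with derivative \<open>w z2 - w2 z\<close>
  off a finite set, and \<open>bd\<close> says that its values at the two ends agree.
\<close>

lemma green_formula:
  assumes w: "piecewise_C2 w w1 w2" and z: "piecewise_C2 z z1 z2"
    and bd: "w 1 * z1 1 - w1 1 * z 1 = w 0 * z1 0 - w1 0 * z 0"
  shows "L2_inner w z2 = L2_inner w2 z"
proof -
  obtain S T where ST: "finite S" "\<forall>x\<in>Omega - S. (w1 has_real_derivative w2 x) (at x)"
    "finite T" "\<forall>x\<in>Omega - T. (z1 has_real_derivative z2 x) (at x)"
    using assms by (auto simp: piecewise_C2_def)
  note c = piecewise_C2_continuous[OF w] piecewise_C2_continuous[OF z]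
  note b = piecewise_C2_bm[OF w] piecewise_C2_bm[OF z]
  have "((\<lambda>x. w x * z2 x - w2 x * z x) has_integral
        (w 1 * z1 1 - w1 1 * z 1) - (w 0 * z1 0 - w1 0 * z 0)) {0..1}"
  proof (rule fundamental_theorem_of_calculus_interior_strong[of "S \<union> T"])
    show "continuous_on {0..1} (\<lambda>x. w x * z1 x - w1 x * z x)" by (intro continuous_intros c)
    fix x assume x: "x \<in> {0<..<1} - (S \<union> T)"
    have "((\<lambda>x. w x * z1 x - w1 x * z x) has_real_derivative w x * z2 x - w2 x * z x) (at x)"
      using x ST piecewise_C2_at[OF w, of x] piecewise_C2_at[OF z, of x]
      by (auto intro!: derivative_eq_intros)
    then show "((\<lambda>x. w x * z1 x - w1 x * z x) has_vector_derivative w x * z2 x - w2 x * z x) (at x)"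
      by (simp add: has_real_derivative_iff_has_vector_derivative)
  qed (use ST in auto)
  then have "(LINT x|Omega_measure. w x * z2 x - w2 x * z x) = 0"
    using bd by (intro integral_Omega_of_has_integral bm_intros b) simp
  then show ?thesis unfolding L2_inner_def
    by (subst (asm) Bochner_Integration.integral_diff) (auto intro!: bm_integrable bm_intros b)
qed

lemma test_function_piecewise_C2:
  assumes "\<phi> \<in> test_functions"
  shows "piecewise_C2 \<phi> (deriv \<phi>) (deriv (deriv \<phi>))"
    and "\<phi> 0 = 0" "\<phi> 1 = 0" "deriv \<phi> 0 = 0" "deriv \<phi> 1 = 0"
proof -
  have diff: "((deriv ^^ k) \<phi> has_real_derivative deriv ((deriv ^^ k) \<phi>) x) (at x)" for k x
  proof -
    have "(deriv ^^ k) \<phi> differentiable_on UNIV" using assms by (simp add: test_functions_def)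
    then obtain D where "((deriv ^^ k) \<phi> has_real_derivative D) (at x)"
      by (auto simp: differentiable_on_def real_differentiable_def)
    then show ?thesis by (simp add: DERIV_imp_deriv)
  qed
  have d0: "(\<phi> has_real_derivative deriv \<phi> x) (at x)"
    and d1: "(deriv \<phi> has_real_derivative deriv (deriv \<phi>) x) (at x)"
    and d2: "(deriv (deriv \<phi>) has_real_derivative deriv (deriv (deriv \<phi>)) x) (at x)" for x
    using diff[of 0 x] diff[of 1 x] diff[of 2 x] by (simp_all add: numeral_2_eq_2)
  show "piecewise_C2 \<phi> (deriv \<phi>) (deriv (deriv \<phi>))"
    unfolding piecewise_C2_def
    by (auto intro!: has_field_derivative_at_within[OF d0] bm_continuous d1 exI[of _ "{}"]
        DERIV_continuous_on[OF has_field_derivative_at_within[OF d1]]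
        DERIV_continuous_on[OF has_field_derivative_at_within[OF d2]])
  have *: "\<phi> x = 0 \<and> deriv \<phi> x = 0" if "x \<notin> Omega" for x
  proof -
    define U where "U = - closure {x. \<phi> x \<noteq> 0}"
    have U: "open U" "x \<in> U" "\<And>y. y \<in> U \<Longrightarrow> \<phi> y = 0"
      using that assms closure_subset[of "{x. \<phi> x \<noteq> 0}"] by (auto simp: U_def test_functions_def)
    have "((\<lambda>_. 0) has_real_derivative 0) (at x)" by simp
    then have "(\<phi> has_real_derivative 0) (at x)"
      by (rule has_field_derivative_transform_within_open[OF _ U(1,2)]) (use U in simp)
    then show ?thesis using U by (auto intro: DERIV_imp_deriv)
  qed
  show "\<phi> 0 = 0" "\<phi> 1 = 0" "deriv \<phi> 0 = 0" "deriv \<phi> 1 = 0" using *[of 0] *[of 1] by auto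
qed

lemma piecewise_C2_weak_deriv_2:
  assumes "piecewise_C2 w w1 w2"
  shows "has_weak_deriv 2 w w2"
proof -
  have "L2_inner w ((deriv ^^ 2) \<phi>) = (- 1) ^ 2 * L2_inner w2 \<phi>" if "\<phi> \<in> test_functions" for \<phi>
    using green_formula[OF assms test_function_piecewise_C2(1)[OF that]]
      test_function_piecewise_C2(2-)[OF that] by (simp add: numeral_2_eq_2)
  then show ?thesis
    using piecewise_C2_bm[OF assms] by (auto simp: has_weak_deriv_def bm_L2)
qed

lemma piecewise_C2_weak_deriv_1:
  assumes "piecewise_C2 w w1 w2"
  shows "has_weak_deriv 1 w w1"
proof -
  have "L2_inner w ((deriv ^^ 1) \<phi>) = (- 1) ^ 1 * L2_inner w1 \<phi>" if \<phi>: "\<phi> \<in> test_functions" for \<phi>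
  proof -
    note t = test_function_piecewise_C2[OF \<phi>]
    note b = piecewise_C2_bm[OF assms] piecewise_C2_bm[OF t(1)]
    have "((\<lambda>x. w x * deriv \<phi> x + w1 x * \<phi> x) has_integral w 1 * \<phi> 1 - w 0 * \<phi> 0) {0..1}"
    proof (rule fundamental_theorem_of_calculus_interior)
      show "continuous_on {0..1} (\<lambda>x. w x * \<phi> x)"
        by (intro continuous_intros piecewise_C2_continuous[OF assms] piecewise_C2_continuous[OF t(1)])
      fix x :: real assume x: "x \<in> {0<..<1}"
      have "((\<lambda>x. w x * \<phi> x) has_real_derivative w x * deriv \<phi> x + w1 x * \<phi> x) (at x)"
        using piecewise_C2_at[OF assms x] piecewise_C2_at[OF t(1) x]
        by (auto intro!: derivative_eq_intros)
      then show "((\<lambda>x. w x * \<phi> x) has_vector_derivative w x * deriv \<phi> x + w1 x * \<phi> x) (at x)"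
        by (simp add: has_real_derivative_iff_has_vector_derivative)
    qed auto
    then have "(LINT x|Omega_measure. w x * deriv \<phi> x + w1 x * \<phi> x) = 0"
      using t by (intro integral_Omega_of_has_integral bm_intros b) simp
    then show ?thesis unfolding L2_inner_def
      by (subst (asm) Bochner_Integration.integral_add) (auto intro!: bm_integrable bm_intros b)
  qed
  then show ?thesis
    using piecewise_C2_bm[OF assms] by (auto simp: has_weak_deriv_def bm_L2)
qed

lemma piecewise_C2_H2: "piecewise_C2 w w1 w2 \<Longrightarrow> w \<in> H_space 2"
proof -
  assume w: "piecewise_C2 w w1 w2"
  have "j \<in> {1..2} \<Longrightarrow> \<exists>g. has_weak_deriv j w g" for j :: nat
  proof -
    assume "j \<in> {1..2}"
    then have "j = 1 \<or> j = 2" by auto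
    then show ?thesis using piecewise_C2_weak_deriv_1[OF w] piecewise_C2_weak_deriv_2[OF w] by auto
  qed
  then show ?thesis using piecewise_C2_bm(1)[OF w] bm_L2 by (auto simp: H_space_def)
qed

lemma L2_inner_cong_AE:
  assumes "f \<in> borel_measurable Omega_measure" "f' \<in> borel_measurable Omega_measure"
    "g \<in> borel_measurable Omega_measure" "g' \<in> borel_measurable Omega_measure"
    "AE x in Omega_measure. f x = f' x" "AE x in Omega_measure. g x = g' x"
  shows "L2_inner f g = L2_inner f' g'"
proof -
  have "AE x in Omega_measure. f x * g x = f' x * g' x"
    using assms(5,6) by eventually_elim simp
  then show ?thesis
    unfolding L2_inner_def by (intro integral_cong_AE borel_measurable_times assms(1-4))
qed

lemma L2_space_cong_AE:
  assumes "f \<in> L2_space" "g \<in> borel_measurable Omega_measure" "AE x in Omega_measure. f x = g x"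
  shows "g \<in> L2_space"
proof -
  have "AE x in Omega_measure. (f x)\<^sup>2 = (g x)\<^sup>2"
    using assms(3) by eventually_elim simp
  moreover have "integrable Omega_measure (\<lambda>x. (f x)\<^sup>2)" using assms(1) by (simp add: L2_space_def)
  moreover have "(\<lambda>x. (g x)\<^sup>2) \<in> borel_measurable Omega_measure" using assms(2) by (rule borel_measurable_power)
  ultimately have "integrable Omega_measure (\<lambda>x. (g x)\<^sup>2)"
    by (intro integrable_cong_AE_imp[where g = "\<lambda>x. (f x)\<^sup>2" and f = "\<lambda>x. (g x)\<^sup>2"])
  then show ?thesis using assms(2) by (simp add: L2_space_def)
qed

lemma has_weak_deriv_cong_AE:
  assumes "has_weak_deriv k u g" "u' \<in> borel_measurable Omega_measure" "AE x in Omega_measure. u x = u' x"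
  shows "has_weak_deriv k u' g"
proof -
  have u: "u \<in> L2_space" using assms by (simp add: has_weak_deriv_def)
  have "L2_inner u' ((deriv ^^ k) \<phi>) = L2_inner u ((deriv ^^ k) \<phi>)" if "\<phi> \<in> test_functions" for \<phi>
  proof -
    have "(deriv ^^ k) \<phi> differentiable_on UNIV" using that by (simp add: test_functions_def)
    then have "(deriv ^^ k) \<phi> \<in> borel_measurable Omega_measure"
      by (intro continuous_imp_measurable_on_sets_lebesgue)
         (auto intro: continuous_on_subset differentiable_imp_continuous_on)
    moreover have "AE x in Omega_measure. u' x = u x" using assms(3) by eventually_elim simp
    ultimately show ?thesis using u assms(2) by (intro L2_inner_cong_AE) (simp_all add: L2_space_def)
  qed
  moreover have "u' \<in> L2_space" by (rule L2_space_cong_AE[OF u assms(2,3)])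
  ultimately show ?thesis using assms(1) by (simp add: has_weak_deriv_def)
qed

text \<open>
  Stated for a representative \<open>w'\<close> that agrees with \<open>w\<close> only almost
  everywhere, since \<open>\<epsilon>\<^sup>3\<^sup>/\<^sup>2 u''\<close> is given through a weak
  derivative of \<open>u\<close>.
\<close>

lemma weak_deriv_2_AE:
  assumes w: "piecewise_C2 w w1 w2" and "w' \<in> borel_measurable Omega_measure" "AE x in Omega_measure. w x = w' x"
  shows "weak_deriv 2 w' \<in> borel_measurable Omega_measure" "AE x in Omega_measure. weak_deriv 2 w' x = w2 x"
proof -
  have h: "has_weak_deriv 2 w' w2"
    by (rule has_weak_deriv_cong_AE[OF piecewise_C2_weak_deriv_2[OF w] assms(2,3)])
  then have h': "has_weak_deriv 2 w' (weak_deriv 2 w')"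
    unfolding weak_deriv_def by (rule someI[of "has_weak_deriv 2 w'"])
  show "weak_deriv 2 w' \<in> borel_measurable Omega_measure"
    using h' by (simp add: has_weak_deriv_def L2_space_def)
  show "AE x in Omega_measure. weak_deriv 2 w' x = w2 x" by (rule weak_deriv_unique[OF h' h])
qed

lemma bm_measurable: "bounded_measurable f \<Longrightarrow> f \<in> borel_measurable Omega_measure"
  by (simp add: bounded_measurable_def)

lemma piecewise_C2_weak_deriv_eq:
  assumes w: "piecewise_C2 w w1 w2"
  shows "weak_deriv 2 w \<in> borel_measurable Omega_measure" "AE x in Omega_measure. weak_deriv 2 w x = w2 x"
  using weak_deriv_2_AE[OF w bm_measurable[OF piecewise_C2_bm(1)[OF w]]] by auto

lemma deriv01_eq:
  assumes "(w has_real_derivative d) (at x within {0..1})" "x \<in> {0..1}"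
  shows "deriv01 w x = d"
  using assms unfolding deriv01_def
  by (intro vector_derivative_within_closed_interval)
     (auto simp: has_real_derivative_iff_has_vector_derivative)

lemma C_space_1_iff:
  "w \<in> C_space 1 \<longleftrightarrow> (\<forall>x\<in>{0..1}. (w has_real_derivative deriv01 w x) (at x within {0..1})) \<and>
     continuous_on {0..1} (deriv01 w)"
proof -
  have "w differentiable (at x within {0..1}) \<longleftrightarrow> (w has_real_derivative deriv01 w x) (at x within {0..1})" for x
    unfolding deriv01_def has_real_derivative_iff_has_vector_derivative by (rule vector_derivative_works)
  then show ?thesis by (simp add: C_space_def differentiable_on_def)
qed

lemma piecewise_C2_C1:
  assumes "piecewise_C2 w w1 w2"
  shows "w \<in> C_space 1" "\<And>x. x \<in> {0..1} \<Longrightarrow> deriv01 w x = w1 x"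
proof -
  show *: "\<And>x. x \<in> {0..1} \<Longrightarrow> deriv01 w x = w1 x"
    using assms by (auto simp: piecewise_C2_def intro: deriv01_eq)
  have "continuous_on {0..1} (deriv01 w)"
    by (rule continuous_on_eq[OF piecewise_C2_continuous(2)[OF assms]]) (simp add: *)
  then show "w \<in> C_space 1"
    using assms * unfolding C_space_1_iff by (auto simp: piecewise_C2_def)
qed

text \<open>
  Boundary values are prescribed for some continuous representative; this identifies it with the
  function itself up to and including the end points.
\<close>

lemma continuous_AE_eq_imp_eq:
  fixes f g :: "real \<Rightarrow> real"
  assumes "continuous_on {0..1} f" "continuous_on {0..1} g"
    and ae: "AE x in Omega_measure. f x = g x" and x: "x \<in> {0..1::real}"
  shows "f x = g x"
proof -
  have "AE x in lebesgue. x \<in> Omega \<longrightarrow> f x = g x"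
    using ae by (subst (asm) AE_restrict_space_iff) auto
  then obtain N where N: "N \<in> null_sets lebesgue" "{x\<in>space lebesgue. \<not> (x \<in> Omega \<longrightarrow> f x = g x)} \<subseteq> N"
    unfolding eventually_ae_filter by blast
  have "negligible N" using N(1) by (simp only: negligible_iff_null_sets)
  moreover have "{x\<in>Omega. f x \<noteq> g x} \<subseteq> N" using N(2) by force
  ultimately have neg: "negligible {x\<in>Omega. f x \<noteq> g x}" by (rule negligible_subset)
  have dense: "\<exists>y\<in>{a<..<b}. f y = g y" if "0 \<le> a" "a < b" "b \<le> 1" for a b
  proof (rule ccontr)
    assume no: "\<not> ?thesis"
    have "{a<..<b} \<subseteq> {x\<in>Omega. f x \<noteq> g x}"
    proof
      fix y assume "y \<in> {a<..<b}"
      with no that show "y \<in> {x\<in>Omega. f x \<noteq> g x}" by force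
    qed
    then have "negligible {a<..<b}" by (rule negligible_subset[OF neg])
    moreover have "\<not> negligible {a<..<b}" using that by (intro open_not_negligible) simp_all
    ultimately show False by blast
  qed
  have cl: "closed {x\<in>{0..1}. f x - g x = 0}"
    using assms(1,2) by (intro continuous_closed_preimage_constant continuous_on_diff) simp_all
  have "x \<in> closure {x\<in>{0..1}. f x - g x = 0}"
    unfolding closure_approachable
  proof (intro allI impI)
    fix e :: real assume e: "e > 0"
    have "max 0 (x - e) < min 1 (x + e)" using x e by (simp add: max_def min_def)
    then obtain z where z: "z \<in> {max 0 (x - e)<..<min 1 (x + e)}" "f z = g z"
      using dense[of "max 0 (x - e)" "min 1 (x + e)"] by (meson max.cobounded1 min.cobounded1)
    then have "z \<in> {0..1}" "\<bar>z - x\<bar> < e" by (simp_all add: abs_less_iff)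
    with z(2) show "\<exists>z\<in>{x\<in>{0..1}. f x - g x = 0}. dist z x < e"
      by (intro bexI[of _ z]) (simp_all add: dist_real_def)
  qed
  then have "x \<in> {x\<in>{0..1}. f x - g x = 0}" using cl by (simp only: closure_closed)
  then show ?thesis by simp
qed

lemma piecewise_C2_H20_iff:
  assumes w: "piecewise_C2 w w1 w2"
  shows "w \<in> H20_space \<longleftrightarrow> w 0 = 0 \<and> w1 0 = 0 \<and> w 1 = 0 \<and> w1 1 = 0"
proof
  assume "w \<in> H20_space"
  then obtain z where z: "z \<in> C_space 1" "AE x in Omega_measure. w x = z x"
    "\<And>\<xi>. \<xi> \<in> {0, 1} \<Longrightarrow> z \<xi> = 0 \<and> deriv01 z \<xi> = 0"
    by (auto simp: H20_space_def)
  have "continuous_on {0..1} z" using z(1)[unfolded C_space_1_iff] by (auto intro: DERIV_continuous_on)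
  then have eq: "w x = z x" if "x \<in> {0..1}" for x
    using continuous_AE_eq_imp_eq[OF piecewise_C2_continuous(1)[OF w] _ z(2) that] by blast
  have "w1 x = deriv01 z x" if x: "x \<in> {0..1}" for x
  proof -
    have "(w has_real_derivative w1 x) (at x within {0..1})" using w x by (simp add: piecewise_C2_def)
    then have "(z has_real_derivative w1 x) (at x within {0..1})"
      by (rule has_field_derivative_transform_within[of _ _ _ _ 1]) (use eq x in auto)
    then show ?thesis using deriv01_eq x by simp
  qed
  then show "w 0 = 0 \<and> w1 0 = 0 \<and> w 1 = 0 \<and> w1 1 = 0" using eq z(3) by simp
next
  assume "w 0 = 0 \<and> w1 0 = 0 \<and> w 1 = 0 \<and> w1 1 = 0"
  then show "w \<in> H20_space"
    using piecewise_C2_H2[OF w] piecewise_C2_C1[OF w] by (auto simp: H20_space_def intro!: bexI[of _ w])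
qed

section \<open>Quasi-optimality in the balanced norm\<close>

lemma piecewise_C2_L2_inner_eq:
  assumes "piecewise_C2 u u1 u2" "piecewise_C2 us us1 us2"
    and "piecewise_C2 v v1 v2" "piecewise_C2 vs vs1 vs2"
  shows "L2_inner (\<lambda>x. a * v x + b * weak_deriv 2 u x) (\<lambda>x. c * vs x + d * weak_deriv 2 us x) =
    (LINT x|Omega_measure. (a * v x + b * u2 x) * (c * vs x + d * us2 x))"
proof -
  note m = bm_measurable[OF piecewise_C2_bm(1)] bm_measurable[OF piecewise_C2_bm(3)]
    piecewise_C2_weak_deriv_eq(1)
  have "AE x in Omega_measure. a * v x + b * weak_deriv 2 u x = a * v x + b * u2 x"
    using piecewise_C2_weak_deriv_eq(2)[OF assms(1)] by eventually_elim simp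
  moreover have "AE x in Omega_measure. c * vs x + d * weak_deriv 2 us x = c * vs x + d * us2 x"
    using piecewise_C2_weak_deriv_eq(2)[OF assms(2)] by eventually_elim simp
  ultimately have "L2_inner (\<lambda>x. a * v x + b * weak_deriv 2 u x) (\<lambda>x. c * vs x + d * weak_deriv 2 us x) =
     L2_inner (\<lambda>x. a * v x + b * u2 x) (\<lambda>x. c * vs x + d * us2 x)"
    by (intro L2_inner_cong_AE borel_measurable_add borel_measurable_times borel_measurable_const
        m[OF assms(1)] m[OF assms(2)] m[OF assms(3)] m[OF assms(4)])
  then show ?thesis by (simp add: L2_inner_def)
qed

lemma bilinear_B_piecewise_C2:
  assumes "piecewise_C2 u u1 u2" "piecewise_C2 v v1 v2"
    and "piecewise_C2 us us1 us2" "piecewise_C2 vs vs1 vs2"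
  shows "bilinear_B lam \<epsilon> (u, v) (us, vs) = (LINT x|Omega_measure.
     lam * ((v x - \<epsilon> powr (3/2) * u2 x) * (vs x - \<epsilon> powr (3/2) * us2 x)) +
     (\<epsilon> powr (5/2) * v2 x + 4 * u x) * (\<epsilon> powr (3/2) * vs2 x + 4 * us x))"
proof -
  note b = piecewise_C2_bm[OF assms(1)] piecewise_C2_bm[OF assms(2)]
    piecewise_C2_bm[OF assms(3)] piecewise_C2_bm[OF assms(4)]
  show ?thesis
    using piecewise_C2_L2_inner_eq[OF assms(1,3,2,4), of 1 "- (\<epsilon> powr (3/2))" 1 "- (\<epsilon> powr (3/2))"]
      piecewise_C2_L2_inner_eq[OF assms(2,4,1,3), of 4 "\<epsilon> powr (5/2)" 4 "\<epsilon> powr (3/2)"]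
    by (simp add: add.commute)
       (subst Bochner_Integration.integral_add; (intro bm_integrable bm_intros b)?; simp)
qed

lemma functional_F_piecewise_C2:
  assumes "piecewise_C2 us us1 us2" "piecewise_C2 vs vs1 vs2"
    and "f \<in> borel_measurable Omega_measure" "bounded_measurable g" "AE x in Omega_measure. f x = g x"
  shows "functional_F \<epsilon> f (us, vs) =
    (LINT x|Omega_measure. g x * (\<epsilon> powr (3/2) * vs2 x + 4 * us x))"
proof -
  have ae: "AE x in Omega_measure. \<epsilon> powr (3/2) * weak_deriv 2 vs x + 4 * us x = \<epsilon> powr (3/2) * vs2 x + 4 * us x"
    using piecewise_C2_weak_deriv_eq(2)[OF assms(2)] by eventually_elim simp
  show ?thesis
    unfolding functional_F.simps L2_inner_def[symmetric]
    using assms(5) ae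
    by (intro L2_inner_cong_AE borel_measurable_add borel_measurable_times borel_measurable_const
        piecewise_C2_weak_deriv_eq(1)[OF assms(2)] bm_measurable piecewise_C2_bm[OF assms(1)]
        piecewise_C2_bm[OF assms(2)] assms(3,4))
qed

text \<open>
  The diagonal part \<open>lam (a - b)\<^sup>2 + 4 (1 + e) a b\<close> dominates \<open>2
  (a\<^sup>2 + b\<^sup>2)\<close>: it is affine in \<open>e\<close>, and for \<open>lam =
  3\<close> the difference is \<open>(1 - e) (a - b)\<^sup>2 + e (a + b)\<^sup>2\<close>. All
  products of a small and a capital letter are absorbed by Young's inequality.
\<close>

lemma weighted_form_lower_bound:
  fixes a b c d A B C D e lam :: real
  assumes "3 \<le> lam" "0 \<le> e" "e \<le> 1"
  shows "(a\<^sup>2 + b\<^sup>2 + c\<^sup>2 + d\<^sup>2) / 2 - (2 * lam\<^sup>2 + 16) * (A\<^sup>2 + B\<^sup>2 + C\<^sup>2 + D\<^sup>2)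
    \<le> lam * ((A + a - (B + b)) * (a - b)) + (C + c) * c + 4 * e * ((A + a) * b)
       + 4 * ((B + b) * a) + 16 * ((D + d) * d)"
proof -
  have diag: "2 * a\<^sup>2 + 2 * b\<^sup>2 \<le> lam * (a - b)\<^sup>2 + 4 * (1 + e) * (a * b)"
  proof -
    have "0 \<le> (lam - 3) * (a - b)\<^sup>2" using assms by simp
    moreover have "0 \<le> (1 - e) * (a - b)\<^sup>2" "0 \<le> e * (a + b)\<^sup>2" using assms by simp_all
    ultimately show ?thesis by (simp add: power2_eq_square algebra_simps)
  qed
  have sq: "0 \<le> ((a - b) / 2 + lam * (A - B))\<^sup>2" "0 \<le> (a + b)\<^sup>2" "0 \<le> lam\<^sup>2 * (A + B)\<^sup>2" by simp_all
  have 1: "- (a\<^sup>2 / 2) - b\<^sup>2 / 2 - 2 * lam\<^sup>2 * (A\<^sup>2 + B\<^sup>2) \<le> lam * ((A - B) * (a - b))"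
    using sq by (simp add: power2_eq_square algebra_simps add_divide_distrib diff_divide_distrib)
  have 2: "- (b\<^sup>2 / 4) - 16 * A\<^sup>2 \<le> 4 * e * (A * b)"
  proof -
    have "0 \<le> (b / 2 + 4 * e * A)\<^sup>2" by simp
    moreover have "e\<^sup>2 * A\<^sup>2 \<le> 1 * A\<^sup>2" using assms by (intro mult_right_mono) (auto simp: power_le_one)
    ultimately show ?thesis by (simp add: power2_eq_square algebra_simps)
  qed
  have 3: "- (a\<^sup>2 / 4) - 16 * B\<^sup>2 \<le> 4 * (B * a)"
    using zero_le_power2[of "a / 2 + 4 * B"] by (simp add: power2_eq_square algebra_simps)
  have 4: "- (c\<^sup>2 / 2) - C\<^sup>2 / 2 \<le> C * c"
    using zero_le_power2[of "C + c"] by (simp add: power2_eq_square algebra_simps)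
  have 5: "- 8 * d\<^sup>2 - 8 * D\<^sup>2 \<le> 16 * (D * d)"
    using zero_le_power2[of "D + d"] by (simp add: power2_eq_square algebra_simps)
  have pos: "0 \<le> a\<^sup>2" "0 \<le> b\<^sup>2" "0 \<le> c\<^sup>2" "0 \<le> d\<^sup>2" "0 \<le> A\<^sup>2" "0 \<le> B\<^sup>2" "0 \<le> C\<^sup>2" "0 \<le> D\<^sup>2"
    "0 \<le> lam\<^sup>2 * C\<^sup>2" "0 \<le> lam\<^sup>2 * D\<^sup>2" by simp_all
  have split: "lam * ((A + a - (B + b)) * (a - b)) + (C + c) * c + 4 * e * ((A + a) * b)
       + 4 * ((B + b) * a) + 16 * ((D + d) * d) =
     (lam * (a - b)\<^sup>2 + 4 * (1 + e) * (a * b)) + c\<^sup>2 + 16 * d\<^sup>2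
     + lam * ((A - B) * (a - b)) + 4 * e * (A * b) + 4 * (B * a) + C * c + 16 * (D * d)"
    by (simp add: power2_eq_square algebra_simps)
  have rhs: "(2 * lam\<^sup>2 + 16) * (A\<^sup>2 + B\<^sup>2 + C\<^sup>2 + D\<^sup>2) =
    2 * lam\<^sup>2 * (A\<^sup>2 + B\<^sup>2) + 16 * A\<^sup>2 + 16 * B\<^sup>2 + 16 * C\<^sup>2 + 16 * D\<^sup>2
     + 2 * (lam\<^sup>2 * C\<^sup>2) + 2 * (lam\<^sup>2 * D\<^sup>2)"
    by (simp add: algebra_simps)
  define X where "X = lam * (a - b)\<^sup>2 + 4 * (1 + e) * (a * b)"
  define Y where "Y = lam * ((A - B) * (a - b))"
  define Z where "Z = 2 * lam\<^sup>2 * (A\<^sup>2 + B\<^sup>2)"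
  define W where "W = 4 * e * (A * b)"
  note folded = X_def[symmetric] Y_def[symmetric] Z_def[symmetric] W_def[symmetric]
  have "a\<^sup>2 / 2 + b\<^sup>2 / 2 - Z - 16 * A\<^sup>2 - 16 * B\<^sup>2 \<le> X + Y + W + 4 * (B * a)"
    using diag 1 2 3 pos(1,2) unfolding folded by linarith
  moreover have "c\<^sup>2 / 2 - 16 * C\<^sup>2 \<le> c\<^sup>2 + C * c" using 4 pos(7) by linarith
  moreover have "d\<^sup>2 / 2 - 16 * D\<^sup>2 \<le> 16 * d\<^sup>2 + 16 * (D * d)" using 5 pos(4,8) by linarith
  ultimately show ?thesis
    using pos(9,10) unfolding split rhs folded add_divide_distrib by linarith
qed

lemma powr_identities:
  assumes "0 < (\<epsilon>::real)"
  shows "\<epsilon> powr (5/2) = \<epsilon> * \<epsilon> powr (3/2)" "(\<epsilon> powr (3/2))\<^sup>2 = \<epsilon> ^ 3"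
    "\<epsilon> powr (3/2) * \<epsilon> powr (3/2) = \<epsilon> ^ 3"
proof -
  have "\<epsilon> powr (5/2) = \<epsilon> powr (1 + 3/2)" by simp
  also have "\<dots> = \<epsilon> * \<epsilon> powr (3/2)" using assms by (subst powr_add) simp
  finally show "\<epsilon> powr (5/2) = \<epsilon> * \<epsilon> powr (3/2)" .
  have "\<epsilon> powr (3/2) * \<epsilon> powr (3/2) = \<epsilon> powr (real 3)" by (simp flip: powr_add)
  also have "\<dots> = \<epsilon> ^ 3" using assms by (rule powr_realpow)
  finally show "\<epsilon> powr (3/2) * \<epsilon> powr (3/2) = \<epsilon> ^ 3" .
  then show "(\<epsilon> powr (3/2))\<^sup>2 = \<epsilon> ^ 3" by (simp add: power2_eq_square)
qed

text \<open>
  The square of the balanced norm in terms of classical second derivatives \<open>u2\<close>,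
  \<open>v2\<close>.
\<close>

definition balanced_sq ::
  "real \<Rightarrow> (real \<Rightarrow> real) \<Rightarrow> (real \<Rightarrow> real) \<Rightarrow> (real \<Rightarrow> real) \<Rightarrow> (real \<Rightarrow> real) \<Rightarrow> real" where
  "balanced_sq \<epsilon> u u2 v v2 = (LINT x|Omega_measure.
     (u x)\<^sup>2 + \<epsilon> ^ 3 * (u2 x)\<^sup>2 + (v x)\<^sup>2 + \<epsilon> ^ 4 * (v2 x)\<^sup>2)"

lemma balanced_norm_eq:
  assumes u: "piecewise_C2 u u1 u2" and v: "piecewise_C2 v v1 v2"
    and v': "v' \<in> borel_measurable Omega_measure" "AE x in Omega_measure. v x = v' x"
    and "0 < \<epsilon>"
  shows "(balanced_norm \<epsilon> (u, v'))\<^sup>2 = balanced_sq \<epsilon> u u2 v v2"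
proof -
  note b = piecewise_C2_bm[OF u] piecewise_C2_bm[OF v]
  have nn: "0 \<le> L2_inner f f" for f by (simp add: L2_inner_def)
  have sq: "(L2_norm f)\<^sup>2 = L2_inner f f" for f using nn by (simp add: L2_norm_def)
  have ae: "AE x in Omega_measure. v' x = v x" using v'(2) by eventually_elim simp
  have "L2_inner (weak_deriv 2 u) (weak_deriv 2 u) = L2_inner u2 u2"
    by (intro L2_inner_cong_AE piecewise_C2_weak_deriv_eq[OF u] bm_measurable b)
  moreover have "L2_inner (weak_deriv 2 v') (weak_deriv 2 v') = L2_inner v2 v2"
    by (intro L2_inner_cong_AE weak_deriv_2_AE[OF v v'] bm_measurable b)
  moreover have "L2_inner v' v' = L2_inner v v"
    by (intro L2_inner_cong_AE v'(1) ae bm_measurable b)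
  ultimately have "(balanced_norm \<epsilon> (u, v'))\<^sup>2 =
      L2_inner u u + \<epsilon> ^ 3 * L2_inner u2 u2 + L2_inner v v + \<epsilon> ^ 4 * L2_inner v2 v2"
    using nn[of u] nn[of u2] nn[of v] nn[of v2] assms(5) by (simp add: sq)
  also have "\<dots> = balanced_sq \<epsilon> u u2 v v2"
    unfolding balanced_sq_def L2_inner_def
    by (subst Bochner_Integration.integral_add; (intro bm_integrable bm_intros b)?)+
       (simp add: power2_eq_square)
  finally show ?thesis .
qed

text \<open>
  The left-hand side is the form bounded in \<open>weighted_form_lower_bound\<close>, the first
  two terms on the right are the integrand of the Galerkin equation, and the brackets in the other
  two terms integrate to zero by Green's formula.
\<close>

lemma galerkin_form_rearrangement:
  fixes \<epsilon> k :: real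
  assumes "k * k = \<epsilon> ^ 3"
  shows "lam * ((ev - k * eu2) * (a - b)) + (\<epsilon>\<^sup>2 * p) * (\<epsilon>\<^sup>2 * q) + 4 * \<epsilon> * (ev * (k * g))
      + 4 * ((k * eu2) * a) + 16 * (eu * d) =
    lam * ((ev - k * eu2) * (a - b)) + (\<epsilon> * k * p + 4 * eu) * (k * q + 4 * d)
      + 4 * \<epsilon> * k * (g * ev - d * p) + 4 * k * (eu2 * a - eu * q)"
proof -
  have "(\<epsilon> * k * p) * (k * q) = \<epsilon> * (k * k) * p * q" by (simp add: mult_ac)
  also have "\<dots> = (\<epsilon>\<^sup>2 * p) * (\<epsilon>\<^sup>2 * q)" unfolding assms by (simp add: power_numeral_reduce mult_ac)
  finally have "(\<epsilon>\<^sup>2 * p) * (\<epsilon>\<^sup>2 * q) = (\<epsilon> * k * p) * (k * q)" ..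
  then show ?thesis by (simp only:) (simp add: algebra_simps)
qed

lemma bm_divide [bm_intros]: "bounded_measurable f \<Longrightarrow> bounded_measurable (\<lambda>x. f x / c)"
  using bm_mult[OF _ bm_const[of "1 / c"], of f] by simp

lemma Omega_integral_add:
  "bounded_measurable f \<Longrightarrow> bounded_measurable g \<Longrightarrow>
   (LINT x|Omega_measure. f x + g x) = (LINT x|Omega_measure. f x) + (LINT x|Omega_measure. g x)"
  by (intro Bochner_Integration.integral_add bm_integrable)

lemma Omega_integral_diff:
  "bounded_measurable f \<Longrightarrow> bounded_measurable g \<Longrightarrow>
   (LINT x|Omega_measure. f x - g x) = (LINT x|Omega_measure. f x) - (LINT x|Omega_measure. g x)"
  by (intro Bochner_Integration.integral_diff bm_integrable)

text \<open>
  Small letters are the scaled components of \<open>\<xi>\<close>, the difference of the spline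
  pair \<open>(uI, vI)\<close> and the Galerkin solution, capital letters those of
  \<open>\<eta>\<close>, the error of \<open>(uI, vI)\<close>. The scaling is chosen so that the
  balanced norm is the plain sum of squares.
\<close>

lemma quasi_optimality:
  assumes lam: "3 \<le> lam" and eps: "0 < \<epsilon>" "\<epsilon> \<le> 1"
    and u: "piecewise_C2 u u1 u2" and v: "piecewise_C2 v v1 v2"
    and uh: "piecewise_C2 uh uh1 uh2" and vh: "piecewise_C2 vh vh1 vh2"
    and uI: "piecewise_C2 uI uI1 uI2" and vI: "piecewise_C2 vI vI1 vI2"
    and bc: "\<And>\<xi>. \<xi> \<in> {0, 1} \<Longrightarrow> u \<xi> = uh \<xi> \<and> u1 \<xi> = uh1 \<xi> \<and> u \<xi> = uI \<xi> \<and> u1 \<xi> = uI1 \<xi>"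
    and v_def: "\<And>x. x \<in> Omega \<Longrightarrow> v x = \<epsilon> powr (3/2) * u2 x"
    and f: "f \<in> borel_measurable Omega_measure"
      "AE x in Omega_measure. f x = \<epsilon> powr (5/2) * v2 x + 4 * u x"
    and galerkin: "bilinear_B lam \<epsilon> (uh, vh) (\<lambda>x. uI x - uh x, \<lambda>x. vI x - vh x) =
      functional_F \<epsilon> f (\<lambda>x. uI x - uh x, \<lambda>x. vI x - vh x)"
  shows "balanced_sq \<epsilon> (\<lambda>x. u x - uh x) (\<lambda>x. u2 x - uh2 x) (\<lambda>x. v x - vh x) (\<lambda>x. v2 x - vh2 x)
    \<le> (8 * lam\<^sup>2 + 66) *
      balanced_sq \<epsilon> (\<lambda>x. u x - uI x) (\<lambda>x. u2 x - uI2 x) (\<lambda>x. v x - vI x) (\<lambda>x. v2 x - vI2 x)"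
proof -
  define k where "k = \<epsilon> powr (3/2)"
  have k2: "k * k = \<epsilon> ^ 3" "\<epsilon> powr (5/2) = \<epsilon> * k" "k\<^sup>2 = \<epsilon> ^ 3"
    using powr_identities[OF eps(1)] by (simp_all add: k_def)
  define a b c d where "a x = vI x - vh x" and "b x = k * (uI2 x - uh2 x)"
    and "c x = \<epsilon>\<^sup>2 * (vI2 x - vh2 x)" and "d x = uI x - uh x" for x
  define A B C D where "A x = v x - vI x" and "B x = k * (u2 x - uI2 x)"
    and "C x = \<epsilon>\<^sup>2 * (v2 x - vI2 x)" and "D x = u x - uI x" for x
  note defs = a_def b_def c_def d_def A_def B_def C_def D_def
  note bm0 = piecewise_C2_bm[OF u] piecewise_C2_bm[OF v] piecewise_C2_bm[OF uh]
    piecewise_C2_bm[OF vh] piecewise_C2_bm[OF uI] piecewise_C2_bm[OF vI]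
  have bm: "bounded_measurable a" "bounded_measurable b" "bounded_measurable c" "bounded_measurable d"
    "bounded_measurable A" "bounded_measurable B" "bounded_measurable C" "bounded_measurable D"
    unfolding defs by (intro bm_intros bm0)+
  note xu = piecewise_C2_diff[OF uI uh] and xv = piecewise_C2_diff[OF vI vh]
  have ev: "piecewise_C2 (\<lambda>x. v x - vh x) (\<lambda>x. v1 x - vh1 x) (\<lambda>x. v2 x - vh2 x)"
    by (rule piecewise_C2_diff[OF v vh])
  have eu: "piecewise_C2 (\<lambda>x. u x - uh x) (\<lambda>x. u1 x - uh1 x) (\<lambda>x. u2 x - uh2 x)"
    by (rule piecewise_C2_diff[OF u uh])
  \<comment> \<open>The boundary terms vanish because \<open>u\<close>, \<open>uh\<close> and \<open>uI\<close> share value and slope at both ends.\<close>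
  have g1: "(LINT x|Omega_measure. (u x - uh x) * (vI2 x - vh2 x)) =
            (LINT x|Omega_measure. (u2 x - uh2 x) * (vI x - vh x))"
    using green_formula[OF eu xv] bc[of 0] bc[of 1] by (simp add: L2_inner_def)
  have g2: "(LINT x|Omega_measure. (uI x - uh x) * (v2 x - vh2 x)) =
            (LINT x|Omega_measure. (uI2 x - uh2 x) * (v x - vh x))"
  proof -
    have "uI 0 - uh 0 = 0" "uI 1 - uh 1 = 0" "uI1 0 - uh1 0 = 0" "uI1 1 - uh1 1 = 0"
      using bc[of 0] bc[of 1] by simp_all
    then show ?thesis using green_formula[OF xu ev] by (simp only: L2_inner_def mult_zero_left)
  qed
  let ?G = "\<lambda>x. lam * ((v x - vh x - k * (u2 x - uh2 x)) * (a x - b x)) +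
       (\<epsilon> * k * (v2 x - vh2 x) + 4 * (u x - uh x)) * (k * (vI2 x - vh2 x) + 4 * d x)"
  have G0: "(LINT x|Omega_measure. ?G x) = 0"
  proof -
    have "(LINT x|Omega_measure. lam * ((vh x - k * uh2 x) * (vI x - vh x - k * (uI2 x - uh2 x))) +
        (\<epsilon> * k * vh2 x + 4 * uh x) * (k * (vI2 x - vh2 x) + 4 * (uI x - uh x))) =
      (LINT x|Omega_measure. (\<epsilon> * k * v2 x + 4 * u x) * (k * (vI2 x - vh2 x) + 4 * (uI x - uh x)))"
      (is "?l = ?r")
    proof -
      have "bounded_measurable (\<lambda>x. \<epsilon> powr (5/2) * v2 x + 4 * u x)" by (intro bm_intros bm0)
      from functional_F_piecewise_C2[OF xu xv f(1) this f(2)] galerkin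
        bilinear_B_piecewise_C2[OF uh vh xu xv, of lam \<epsilon>]
      show ?thesis by (simp only: k_def[symmetric] k2(2))
    qed
    moreover have "?r - ?l = (LINT x|Omega_measure. (\<epsilon> * k * v2 x + 4 * u x) * (k * (vI2 x - vh2 x) + 4 * (uI x - uh x)) -
       (lam * ((vh x - k * uh2 x) * (vI x - vh x - k * (uI2 x - uh2 x))) +
        (\<epsilon> * k * vh2 x + 4 * uh x) * (k * (vI2 x - vh2 x) + 4 * (uI x - uh x))))"
      by (intro Bochner_Integration.integral_diff[symmetric] bm_integrable bm_intros bm0)
    moreover have "\<dots> = (LINT x|Omega_measure. ?G x)"
    proof (intro Bochner_Integration.integral_cong refl)
      fix x assume "x \<in> space Omega_measure"
      then have "v x = k * u2 x" by (simp add: v_def k_def)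
      then show "(\<epsilon> * k * v2 x + 4 * u x) * (k * (vI2 x - vh2 x) + 4 * (uI x - uh x)) -
        (lam * ((vh x - k * uh2 x) * (vI x - vh x - k * (uI2 x - uh2 x))) +
         (\<epsilon> * k * vh2 x + 4 * uh x) * (k * (vI2 x - vh2 x) + 4 * (uI x - uh x))) = ?G x"
        unfolding a_def b_def d_def by (simp only:) (simp add: algebra_simps)
    qed
    ultimately show ?thesis by simp
  qed
  let ?Q = "\<lambda>x. lam * ((A x + a x - (B x + b x)) * (a x - b x)) + (C x + c x) * c x
       + 4 * \<epsilon> * ((A x + a x) * b x) + 4 * ((B x + b x) * a x) + 16 * ((D x + d x) * d x)"
  have Q0: "(LINT x|Omega_measure. ?Q x) = 0"
  proof -
    have "(LINT x|Omega_measure. ?Q x) = (LINT x|Omega_measure. ?G x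
       + 4 * \<epsilon> * k * ((uI2 x - uh2 x) * (v x - vh x) - (uI x - uh x) * (v2 x - vh2 x))
       + 4 * k * ((u2 x - uh2 x) * (vI x - vh x) - (u x - uh x) * (vI2 x - vh2 x)))"
    proof (intro Bochner_Integration.integral_cong refl)
      fix x
      have "B x + b x = k * (u2 x - uh2 x)" "C x + c x = \<epsilon>\<^sup>2 * (v2 x - vh2 x)"
        "A x + a x = v x - vh x" "D x + d x = u x - uh x"
        unfolding defs by (simp_all add: right_diff_distrib)
      then show "?Q x = ?G x
         + 4 * \<epsilon> * k * ((uI2 x - uh2 x) * (v x - vh x) - (uI x - uh x) * (v2 x - vh2 x))
         + 4 * k * ((u2 x - uh2 x) * (vI x - vh x) - (u x - uh x) * (vI2 x - vh2 x))"
        using galerkin_form_rearrangement[OF k2(1), where ev = "v x - vh x" and g = "uI2 x - uh2 x"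
          and eu = "u x - uh x" and p = "v2 x - vh2 x" and q = "vI2 x - vh2 x" and d = "d x"
          and a = "a x" and b = "b x" and lam = lam and ?eu2.0 = "u2 x - uh2 x"]
        by (simp only: b_def c_def a_def d_def)
    qed
    also have "\<dots> = (LINT x|Omega_measure. ?G x)
       + (LINT x|Omega_measure. 4 * \<epsilon> * k * ((uI2 x - uh2 x) * (v x - vh x) - (uI x - uh x) * (v2 x - vh2 x)))
       + (LINT x|Omega_measure. 4 * k * ((u2 x - uh2 x) * (vI x - vh x) - (u x - uh x) * (vI2 x - vh2 x)))"
      by (subst Omega_integral_add, (intro bm_intros bm bm0)+)
         (subst Omega_integral_add, (intro bm_intros bm bm0)+, rule refl)
    also have "(LINT x|Omega_measure. 4 * \<epsilon> * k * ((uI2 x - uh2 x) * (v x - vh x) - (uI x - uh x) * (v2 x - vh2 x))) = 0"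
      by (subst Bochner_Integration.integral_mult_right_zero, subst Omega_integral_diff, (intro bm_intros bm0)+)
         (simp only: g2 diff_self mult_zero_right)
    also have "(LINT x|Omega_measure. 4 * k * ((u2 x - uh2 x) * (vI x - vh x) - (u x - uh x) * (vI2 x - vh2 x))) = 0"
      by (subst Bochner_Integration.integral_mult_right_zero, subst Omega_integral_diff, (intro bm_intros bm0)+)
         (simp only: g1 diff_self mult_zero_right)
    finally show ?thesis using G0 by simp
  qed
  let ?s = "LINT x|Omega_measure. (a x)\<^sup>2 + (b x)\<^sup>2 + (c x)\<^sup>2 + (d x)\<^sup>2"
  let ?S = "LINT x|Omega_measure. (A x)\<^sup>2 + (B x)\<^sup>2 + (C x)\<^sup>2 + (D x)\<^sup>2"
  have "(LINT x|Omega_measure. ((a x)\<^sup>2 + (b x)\<^sup>2 + (c x)\<^sup>2 + (d x)\<^sup>2) / 2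
      - (2 * lam\<^sup>2 + 16) * ((A x)\<^sup>2 + (B x)\<^sup>2 + (C x)\<^sup>2 + (D x)\<^sup>2)) \<le> (LINT x|Omega_measure. ?Q x)"
    using eps by (intro Omega_integral_mono bm_intros bm weighted_form_lower_bound lam) simp_all
  moreover have "(LINT x|Omega_measure. ((a x)\<^sup>2 + (b x)\<^sup>2 + (c x)\<^sup>2 + (d x)\<^sup>2) / 2
      - (2 * lam\<^sup>2 + 16) * ((A x)\<^sup>2 + (B x)\<^sup>2 + (C x)\<^sup>2 + (D x)\<^sup>2)) = ?s / 2 - (2 * lam\<^sup>2 + 16) * ?S"
    by (subst Omega_integral_diff, (intro bm_intros bm)+) simp
  ultimately have s: "?s \<le> (4 * lam\<^sup>2 + 32) * ?S" using Q0 by (simp add: algebra_simps)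
  have bal: "balanced_sq \<epsilon> (\<lambda>x. u x - uI x) (\<lambda>x. u2 x - uI2 x) (\<lambda>x. v x - vI x) (\<lambda>x. v2 x - vI2 x) = ?S"
    unfolding balanced_sq_def defs
    by (intro Bochner_Integration.integral_cong) (simp_all add: power_mult_distrib k2 flip: power_mult)
  have "balanced_sq \<epsilon> (\<lambda>x. u x - uh x) (\<lambda>x. u2 x - uh2 x) (\<lambda>x. v x - vh x) (\<lambda>x. v2 x - vh2 x)
    \<le> (LINT x|Omega_measure. 2 * ((A x)\<^sup>2 + (B x)\<^sup>2 + (C x)\<^sup>2 + (D x)\<^sup>2)
        + 2 * ((a x)\<^sup>2 + (b x)\<^sup>2 + (c x)\<^sup>2 + (d x)\<^sup>2))"
    unfolding balanced_sq_def
  proof (intro Omega_integral_mono bm_intros bm bm0)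
    fix x
    have two: "(y + z)\<^sup>2 \<le> 2 * y\<^sup>2 + 2 * z\<^sup>2" for y z :: real
      using zero_le_power2[of "y - z"] by (simp add: power2_eq_square algebra_simps)
    have "(u x - uh x)\<^sup>2 + \<epsilon> ^ 3 * (u2 x - uh2 x)\<^sup>2 + (v x - vh x)\<^sup>2 + \<epsilon> ^ 4 * (v2 x - vh2 x)\<^sup>2 =
      (D x + d x)\<^sup>2 + (B x + b x)\<^sup>2 + (A x + a x)\<^sup>2 + (C x + c x)\<^sup>2"
    proof -
      have "B x + b x = k * (u2 x - uh2 x)" "C x + c x = \<epsilon>\<^sup>2 * (v2 x - vh2 x)"
        "A x + a x = v x - vh x" "D x + d x = u x - uh x"
        unfolding defs by (simp_all add: right_diff_distrib)
      then show ?thesis by (simp add: power_mult_distrib k2(3))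
    qed
    then show "(u x - uh x)\<^sup>2 + \<epsilon> ^ 3 * (u2 x - uh2 x)\<^sup>2 + (v x - vh x)\<^sup>2 + \<epsilon> ^ 4 * (v2 x - vh2 x)\<^sup>2
      \<le> 2 * ((A x)\<^sup>2 + (B x)\<^sup>2 + (C x)\<^sup>2 + (D x)\<^sup>2) + 2 * ((a x)\<^sup>2 + (b x)\<^sup>2 + (c x)\<^sup>2 + (d x)\<^sup>2)"
      using two[of "A x" "a x"] two[of "B x" "b x"] two[of "C x" "c x"] two[of "D x" "d x"] by simp
  qed
  also have "\<dots> = 2 * ?S + 2 * ?s"
    by (subst Omega_integral_add, (intro bm_intros bm)+) (simp only: integral_mult_right_zero)
  also have "\<dots> \<le> (8 * lam\<^sup>2 + 66) * ?S" using s by (simp add: algebra_simps)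
  finally show ?thesis unfolding bal .
qed

section \<open>Continuously differentiable splines\<close>

lemma bm_sum [bm_intros]:
  "(\<And>i. i \<in> I \<Longrightarrow> bounded_measurable (f i)) \<Longrightarrow> bounded_measurable (\<lambda>x. \<Sum>i\<in>I. f i x)"
  by (induction I rule: infinite_finite_induct) (auto intro: bm_intros)

lemma bm_indicator_Ioo [bm_intros]: "bounded_measurable (indicator {a<..<b})"
  unfolding bounded_measurable_def
  by (intro conjI measurable_restrict_space1[OF borel_measurable_indicator] exI[of _ 1])
     (auto simp: indicator_def)

lemma bm_poly [bm_intros]: "bounded_measurable (poly q)"
  by (intro bm_continuous continuous_intros)

definition is_mesh :: "nat \<Rightarrow> (nat \<Rightarrow> real) \<Rightarrow> bool" where
  "is_mesh N x \<longleftrightarrow> x 0 = 0 \<and> x N = 1 \<and> (\<forall>i<N. x i < x (Suc i))"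

lemma is_mesh_pos: "is_mesh N x \<Longrightarrow> 0 < N"
  by (auto simp: is_mesh_def intro: Nat.gr0I)

lemma is_mesh_strict:
  assumes "is_mesh N x" "i < j" "j \<le> N"
  shows "x i < x j"
proof -
  have "x i < x (i + Suc k)" if "i + Suc k \<le> N" for k
    using that
  proof (induction k)
    case (Suc k)
    then have "x i < x (i + Suc k)" by simp
    also have "\<dots> < x (Suc (i + Suc k))" using assms(1) Suc.prems by (simp add: is_mesh_def)
    finally show ?case by simp
  qed (use assms(1) in \<open>auto simp: is_mesh_def\<close>)
  from this[of "j - i - 1"] show ?thesis using assms by simp
qed

lemma is_mesh_le:
  assumes "is_mesh N x" "i \<le> j" "j \<le> N"
  shows "x i \<le> x j"
  using is_mesh_strict[OF assms(1)] assms by (cases "i = j") (auto simp: less_imp_le)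

lemma is_mesh_range:
  assumes "is_mesh N x" "i \<le> N"
  shows "x i \<in> {0..1}"
  using is_mesh_le[OF assms(1), of 0 i] is_mesh_le[OF assms(1), of i N] assms
  by (auto simp: is_mesh_def)

lemma is_mesh_cover:
  assumes "is_mesh N x" "t \<in> {0..1}"
  obtains i where "i < N" "t \<in> {x i..x (Suc i)}"
proof -
  have "t \<le> x k \<Longrightarrow> 0 < k \<Longrightarrow> k \<le> N \<Longrightarrow> \<exists>i<k. t \<in> {x i..x (Suc i)}" for k
  proof (induction k)
    case (Suc k)
    show ?case
    proof (cases "k = 0 \<or> x k \<le> t")
      case True
      then have "x k \<le> t" using assms by (auto simp: is_mesh_def)
      then show ?thesis using Suc.prems by auto
    next
      case False
      then show ?thesis using Suc less_Suc_eq by force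
    qed
  qed simp
  from this[of N] show ?thesis
    using that assms is_mesh_pos[OF assms(1)] by (auto simp: is_mesh_def)
qed

lemma is_mesh_cells_overlap:
  assumes "is_mesh N x" "i < j" "j < N" "t \<in> {x i..x (Suc i)}" "t \<in> {x j..x (Suc j)}"
  shows "j = Suc i" "t = x (Suc i)"
proof -
  have "x (Suc i) \<le> x j" by (rule is_mesh_le[OF assms(1)]) (use assms in auto)
  then have t: "t = x (Suc i)" "x (Suc i) = x j" using assms(4,5) by auto
  show "j = Suc i"
  proof (rule ccontr)
    assume "j \<noteq> Suc i"
    then have "x (Suc i) < x j" by (intro is_mesh_strict[OF assms(1)]) (use assms in auto)
    then show False using t by simp
  qed
  show "t = x (Suc i)" by (rule t)
qed

text \<open>
  Zero at the nodes; only the values inside the cells matter for second derivatives of splines.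
\<close>

definition piecewise_poly :: "nat \<Rightarrow> (nat \<Rightarrow> real) \<Rightarrow> (nat \<Rightarrow> real poly) \<Rightarrow> real \<Rightarrow> real" where
  "piecewise_poly N x Q t = (\<Sum>i<N. indicator {x i<..<x (Suc i)} t * poly (Q i) t)"

lemma bm_piecewise_poly: "bounded_measurable (piecewise_poly N x Q)"
  unfolding piecewise_poly_def by (intro bm_intros)

lemma piecewise_poly_cell:
  assumes "is_mesh N x" "i < N" "t \<in> {x i<..<x (Suc i)}"
  shows "piecewise_poly N x Q t = poly (Q i) t"
proof -
  have "indicator {x j<..<x (Suc j)} t * poly (Q j) t = 0" if "j < N" "j \<noteq> i" for j
  proof -
    have "t \<notin> {x j<..<x (Suc j)}"
      using is_mesh_cells_overlap[OF assms(1), of i j t] is_mesh_cells_overlap[OF assms(1), of j i t]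
        assms that by (cases i j rule: linorder_cases) force+
    then show ?thesis by simp
  qed
  then have "piecewise_poly N x Q t = (\<Sum>j\<in>{i}. indicator {x j<..<x (Suc j)} t * poly (Q j) t)"
    unfolding piecewise_poly_def using assms(2) by (intro sum.mono_neutral_right) auto
  also have "\<dots> = indicator {x i<..<x (Suc i)} t * poly (Q i) t"
    by (subst sum.insert; simp only: finite.emptyI empty_iff not_False_eq_True sum.empty add_0_right)
  finally show ?thesis using assms(3) by simp
qed

lemma off_nodes_in_cell:
  assumes "is_mesh N x" "t \<in> Omega - x ` {..N}"
  obtains i where "i < N" "t \<in> {x i<..<x (Suc i)}"
proof -
  obtain i where i: "i < N" "t \<in> {x i..x (Suc i)}"
    using is_mesh_cover[OF assms(1), of t] assms(2) by auto
  then have "x i \<in> x ` {..N}" "x (Suc i) \<in> x ` {..N}" by auto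
  then have "t \<noteq> x i" "t \<noteq> x (Suc i)" using assms(2) by auto
  then show ?thesis using i that by auto
qed

lemma C1_spline_piecewise_C2:
  assumes mesh: "is_mesh N x"
    and s: "\<And>t. t \<in> {0..1} \<Longrightarrow> (s has_real_derivative s1 t) (at t within {0..1})"
    and c: "continuous_on {0..1} s1"
    and q: "\<And>i t. i < N \<Longrightarrow> t \<in> {x i<..<x (Suc i)} \<Longrightarrow> s t = poly (Q i) t"
  shows "piecewise_C2 s s1 (piecewise_poly N x (\<lambda>i. pderiv (pderiv (Q i))))"
proof -
  have "(s1 has_real_derivative piecewise_poly N x (\<lambda>i. pderiv (pderiv (Q i))) t) (at t)"
    if t: "t \<in> Omega - x ` {..N}" for t
  proof -
    obtain i where i: "i < N" "t \<in> {x i<..<x (Suc i)}" by (rule off_nodes_in_cell[OF mesh t])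
    have s1: "poly (pderiv (Q i)) y = s1 y" if y: "y \<in> {x i<..<x (Suc i)}" for y
    proof -
      have "y \<in> Omega" using y is_mesh_range[OF mesh, of i] is_mesh_range[OF mesh, of "Suc i"] i by auto
      then have "(s has_real_derivative s1 y) (at y)"
        using DERIV_subset[OF s, of y Omega] at_within_open[of y Omega] by force
      moreover have "(s has_real_derivative poly (pderiv (Q i)) y) (at y)"
        by (rule has_field_derivative_transform_within_open[OF poly_DERIV open_greaterThanLessThan y])
           (use q i in auto)
      ultimately show ?thesis by (rule DERIV_unique[symmetric])
    qed
    have "(s1 has_real_derivative poly (pderiv (pderiv (Q i))) t) (at t)"
      by (rule has_field_derivative_transform_within_open[OF poly_DERIV open_greaterThanLessThan i(2)])
         (rule s1)
    then show ?thesis by (simp add: piecewise_poly_cell[OF mesh i])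
  qed
  then show ?thesis
    unfolding piecewise_C2_def using s c bm_piecewise_poly
    by (intro conjI ballI exI[of _ "x ` {..N}"]) auto
qed

lemma spline_space_piecewise_C2:
  assumes mesh: "is_mesh N x" and s: "s \<in> spline_space p N x"
  obtains s2 where "piecewise_C2 s (deriv01 s) s2"
proof -
  have cell: "\<exists>q. \<forall>t\<in>{x i<..<x (Suc i)}. s t = poly q t" if "i < N" for i
  proof -
    have "Suc i \<in> {1..N}" using that by auto
    then have "\<exists>q. degree q \<le> p \<and> (\<forall>t\<in>{x (Suc i - 1)<..<x (Suc i)}. s t = poly q t)"
      using s unfolding spline_space_def by blast
    then show ?thesis by auto
  qed
  obtain Q where "\<And>i. i < N \<Longrightarrow> \<forall>t\<in>{x i<..<x (Suc i)}. s t = poly (Q i) t"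
    using cell by metis
  moreover have "s \<in> C_space 1" using s by (simp add: spline_space_def)
  ultimately have "piecewise_C2 s (deriv01 s) (piecewise_poly N x (\<lambda>i. pderiv (pderiv (Q i))))"
    unfolding C_space_1_iff by (intro C1_spline_piecewise_C2[OF mesh]) auto
  then show ?thesis by (rule that)
qed

lemma spline_space_diff:
  assumes mesh: "is_mesh N x" and s: "s \<in> spline_space p N x" and z: "z \<in> spline_space p N x"
  shows "(\<lambda>t. s t - z t) \<in> spline_space p N x"
proof -
  obtain s2 z2 where "piecewise_C2 s (deriv01 s) s2" "piecewise_C2 z (deriv01 z) z2"
    using spline_space_piecewise_C2[OF mesh s] spline_space_piecewise_C2[OF mesh z] by metis
  then have "(\<lambda>t. s t - z t) \<in> C_space 1" by (intro piecewise_C2_C1(1)[OF piecewise_C2_diff])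
  moreover have "\<exists>q. degree q \<le> p \<and> (\<forall>t\<in>{x (i - 1)<..<x i}. s t - z t = poly q t)"
    if "i \<in> {1..N}" for i
  proof -
    obtain q r where "degree q \<le> p" "\<forall>t\<in>{x (i - 1)<..<x i}. s t = poly q t"
      "degree r \<le> p" "\<forall>t\<in>{x (i - 1)<..<x i}. z t = poly r t"
      using s z \<open>i \<in> {1..N}\<close> unfolding spline_space_def by blast
    then show ?thesis by (intro exI[of _ "q - r"]) (auto intro: degree_diff_le)
  qed
  ultimately show ?thesis by (simp add: spline_space_def)
qed

text \<open>
  Splines are built as families of polynomials, one for each cell \<open>[x i, x (Suc i)]\<close>,
  and are turned into functions only at the end. Sums and reflections are easier to form for such
  families.
\<close>

definition C1_pieces :: "nat \<Rightarrow> nat \<Rightarrow> (nat \<Rightarrow> real) \<Rightarrow> (nat \<Rightarrow> real poly) \<Rightarrow> bool" where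
  "C1_pieces p N x Q \<longleftrightarrow> (\<forall>i<N. degree (Q i) \<le> p) \<and>
     (\<forall>i. Suc i < N \<longrightarrow> poly (Q i) (x (Suc i)) = poly (Q (Suc i)) (x (Suc i)) \<and>
        poly (pderiv (Q i)) (x (Suc i)) = poly (pderiv (Q (Suc i))) (x (Suc i)))"

lemma has_real_derivative_finite_closed_Union:
  assumes "finite I" "\<And>i. i \<in> I \<Longrightarrow> closed (A i)"
    and "\<And>i. i \<in> I \<Longrightarrow> t \<in> A i \<Longrightarrow> (f has_real_derivative d) (at t within A i)"
  shows "(f has_real_derivative d) (at t within (\<Union>i\<in>I. A i))"
  using assms
proof (induction I rule: finite_induct)
  case empty
  then show ?case by simp
next
  case (insert i I)
  have "(f has_real_derivative d) (at t within A i)"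
  proof (cases "t \<in> A i")
    case False
    then have "at t within A i = bot"
      using insert.prems(1)[of i] by (auto simp: trivial_limit_within closed_limpt)
    then show ?thesis by simp
  qed (use insert.prems in auto)
  moreover have "(f has_real_derivative d) (at t within (\<Union>i\<in>I. A i))" using insert by auto
  ultimately show ?case
    by (simp add: has_field_derivative_iff Lim_within_Un)
qed

text \<open>
  A node belongs to two cells; the matching conditions make the choice of the cell irrelevant for
  values and slopes, so that one-sided derivatives on the closed cells combine to a derivative on
  \<open>[0,1]\<close>.
\<close>

lemma glue_C1_pieces:
  assumes mesh: "is_mesh N x" and Q: "C1_pieces p N x Q"
  obtains s s1 where "s \<in> spline_space p N x"
    "piecewise_C2 s s1 (piecewise_poly N x (\<lambda>i. pderiv (pderiv (Q i))))"
    "\<And>i t. i < N \<Longrightarrow> t \<in> {x i..x (Suc i)} \<Longrightarrow> s t = poly (Q i) t \<and> s1 t = poly (pderiv (Q i)) t"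
proof -
  define idx where "idx t = (SOME i. i < N \<and> t \<in> {x i..x (Suc i)})" for t
  define s where "s t = poly (Q (idx t)) t" for t
  define s1 where "s1 t = poly (pderiv (Q (idx t))) t" for t
  have eq: "s t = poly (Q i) t \<and> s1 t = poly (pderiv (Q i)) t"
    if i: "i < N" "t \<in> {x i..x (Suc i)}" for i t
  proof -
    have j: "idx t < N \<and> t \<in> {x (idx t)..x (Suc (idx t))}"
      unfolding idx_def by (rule someI[of _ i]) (use i in auto)
    consider "idx t = i" | "idx t < i" | "i < idx t" by linarith
    then show ?thesis
    proof cases
      case 2
      then have "i = Suc (idx t)" "t = x (Suc (idx t))"
        using is_mesh_cells_overlap[OF mesh 2 i(1) _ i(2)] j by auto
      then show ?thesis using Q i unfolding C1_pieces_def s_def s1_def by metis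
    next
      case 3
      then have "idx t = Suc i" "t = x (Suc i)"
        using is_mesh_cells_overlap[OF mesh 3 _ i(2)] j by auto
      then show ?thesis using Q j unfolding C1_pieces_def s_def s1_def by metis
    qed (simp add: s_def s1_def)
  qed
  have U: "(\<Union>i\<in>{..<N}. {x i..x (Suc i)}) = {0..1}"
  proof
    show "(\<Union>i\<in>{..<N}. {x i..x (Suc i)}) \<subseteq> {0..1}"
    proof
      fix t assume "t \<in> (\<Union>i\<in>{..<N}. {x i..x (Suc i)})"
      then obtain i where "i < N" "t \<in> {x i..x (Suc i)}" by auto
      then show "t \<in> {0..1}" using is_mesh_range[OF mesh, of i] is_mesh_range[OF mesh, of "Suc i"] by auto
    qed
    show "{0..1} \<subseteq> (\<Union>i\<in>{..<N}. {x i..x (Suc i)})"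
    proof
      fix t :: real assume "t \<in> {0..1}"
      then obtain i where "i < N" "t \<in> {x i..x (Suc i)}" by (rule is_mesh_cover[OF mesh])
      then show "t \<in> (\<Union>i\<in>{..<N}. {x i..x (Suc i)})" by blast
    qed
  qed
  have glue: "(g has_real_derivative d) (at t within {0..1})"
    if "\<And>i. i < N \<Longrightarrow> t \<in> {x i..x (Suc i)} \<Longrightarrow> (g has_real_derivative d) (at t within {x i..x (Suc i)})"
    for g d t
    using has_real_derivative_finite_closed_Union[of "{..<N}" "\<lambda>i. {x i..x (Suc i)}" t g d] that
    by (simp add: U)
  have ds: "(s has_real_derivative s1 t) (at t within {0..1})" for t
  proof (rule glue)
    fix i assume i: "i < N" "t \<in> {x i..x (Suc i)}"
    have "(poly (Q i) has_real_derivative poly (pderiv (Q i)) t) (at t within {x i..x (Suc i)})"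
      by (rule has_field_derivative_at_within[OF poly_DERIV])
    then have "(s has_real_derivative poly (pderiv (Q i)) t) (at t within {x i..x (Suc i)})"
      by (rule has_field_derivative_transform_within[of _ _ _ _ 1]) (use eq i in auto)
    then show "(s has_real_derivative s1 t) (at t within {x i..x (Suc i)})" using eq i by simp
  qed
  have "continuous_on (\<Union>i\<in>{..<N}. {x i..x (Suc i)}) s1"
  proof (rule continuous_on_closed_Union)
    fix i assume "i \<in> {..<N}"
    then show "continuous_on {x i..x (Suc i)} s1"
      by (intro continuous_on_eq[OF continuous_on_poly[OF continuous_on_id], of _ "pderiv (Q i)"])
         (use eq in auto)
  qed auto
  then have c: "continuous_on {0..1} s1" by (simp add: U)
  have pw: "piecewise_C2 s s1 (piecewise_poly N x (\<lambda>i. pderiv (pderiv (Q i))))"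
    by (rule C1_spline_piecewise_C2[OF mesh ds c]) (use eq in auto)
  have "\<exists>q. degree q \<le> p \<and> (\<forall>t\<in>{x (i - 1)<..<x i}. s t = poly q t)" if "i \<in> {1..N}" for i
  proof -
    have "i - 1 < N" "Suc (i - 1) = i" using that by auto
    then show ?thesis using eq[of "i - 1"] Q unfolding C1_pieces_def by (intro exI[of _ "Q (i - 1)"]) auto
  qed
  then have "s \<in> spline_space p N x"
    using piecewise_C2_C1(1)[OF pw] by (simp add: spline_space_def)
  then show ?thesis using that pw eq by blast
qed

section \<open>Hermite interpolation and the approximation of layers\<close>

lemma higher_pderiv_shift:
  "(pderiv ^^ k) (pcompose P [:c, 1:]) = pcompose ((pderiv ^^ k) P) [:c, 1::real:]"
  by (induction k) (simp_all add: pderiv_pcompose pderiv_pCons)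

lemma taylor_poly_exists:
  fixes a :: real
  shows "\<exists>T. degree T \<le> p \<and> (\<forall>k\<le>p. poly ((pderiv ^^ k) T) a = d k)"
proof -
  define P where "P = (\<Sum>j\<le>p. monom (d j / fact j) j)"
  have c: "coeff P k = d k / fact k" if "k \<le> p" for k
    using that by (simp add: P_def coeff_sum coeff_monom)
  have "degree P \<le> p" unfolding P_def
    by (intro degree_sum_le) (auto intro: order_trans[OF degree_monom_le])
  then have "degree (pcompose P [:- a, 1:]) \<le> p" by (simp add: degree_pcompose)
  moreover have "poly ((pderiv ^^ k) (pcompose P [:- a, 1:])) a = d k" if "k \<le> p" for k
  proof -
    have "poly ((pderiv ^^ k) (pcompose P [:- a, 1:])) a = coeff ((pderiv ^^ k) P) 0"
      by (simp add: higher_pderiv_shift poly_pcompose poly_0_coeff_0)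
    also have "\<dots> = d k"
      using c[OF that] by (simp add: coeff_higher_pderiv pochhammer_fact[symmetric])
    finally show ?thesis .
  qed
  ultimately show ?thesis by blast
qed

text \<open>
  Induction on the number of integrations: the remainder of order \<open>k\<close> vanishes at
  \<open>a\<close> and its derivative is the remainder of order \<open>k + 1\<close>.
\<close>

lemma taylor_remainder_bound:
  fixes a b M :: real
  assumes D: "\<And>k t. k \<le> p \<Longrightarrow> t \<in> {a..b} \<Longrightarrow> (D k has_real_derivative D (Suc k) t) (at t within {a..b})"
    and M: "\<And>t. t \<in> {a..b} \<Longrightarrow> \<bar>D (Suc p) t\<bar> \<le> M"
    and T: "degree T \<le> p" "\<And>k. k \<le> p \<Longrightarrow> poly ((pderiv ^^ k) T) a = D k a"
    and "j \<le> Suc p" "t \<in> {a..b}"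
  shows "\<bar>D (Suc p - j) t - poly ((pderiv ^^ (Suc p - j)) T) t\<bar> \<le> M * (b - a) ^ j"
  using \<open>j \<le> Suc p\<close> \<open>t \<in> {a..b}\<close>
proof (induction j arbitrary: t)
  case 0
  have "(pderiv ^^ Suc p) T = 0"
  proof (rule poly_eqI)
    fix n show "coeff ((pderiv ^^ Suc p) T) n = coeff 0 n"
      using T(1) by (simp add: coeff_higher_pderiv coeff_eq_0 del: funpow.simps)
  qed
  then show ?case using M[OF 0(2)] by simp
next
  case (Suc j)
  define k where "k = Suc p - Suc j"
  have k: "Suc p - j = Suc k" "k \<le> p" using Suc.prems by (auto simp: k_def)
  let ?R = "\<lambda>t. D k t - poly ((pderiv ^^ k) T) t"
  have a: "a \<in> {a..b}" using Suc.prems by auto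
  have der: "(?R has_real_derivative D (Suc k) s - poly ((pderiv ^^ Suc k) T) s) (at s within {a..b})"
    if "s \<in> {a..b}" for s
    using D[OF k(2) that] by (auto intro!: DERIV_diff has_field_derivative_at_within[OF poly_DERIV])
  have "norm (?R t - ?R a) \<le> (M * (b - a) ^ j) * norm (t - a)"
    by (rule field_differentiable_bound[OF _ der _ Suc.prems(2) a])
       (use Suc.IH[unfolded k(1)] Suc.prems in auto)
  also have "\<dots> \<le> (M * (b - a) ^ j) * (b - a)"
  proof (rule mult_left_mono)
    have "0 \<le> M" using M[OF a] by linarith
    then show "0 \<le> M * (b - a) ^ j" using a by simp
  qed (use Suc.prems in auto)
  finally show ?case unfolding k_def[symmetric] using T(2)[OF k(2)] by (simp add: mult_ac)
qed

text \<open>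
  In the variable \<open>y = (t - a) / (b - a)\<close> this is the cubic Hermite basis \<open>e (3
  y\<^sup>2 - 2 y\<^sup>3) + (b - a) e' (y\<^sup>3 - y\<^sup>2)\<close>. It serves three purposes:
  repairing a Taylor polynomial at the right end of a cell, cutting off a layer at the transition
  point, and restoring boundary data.
\<close>

lemma cubic_correction:
  fixes a b e e' :: real
  assumes "a < b"
  obtains c where "degree c \<le> 3" "poly c a = 0" "poly (pderiv c) a = 0" "poly c b = e"
    "poly (pderiv c) b = e'"
    "\<forall>t\<in>{a..b}. \<bar>poly c t\<bar> \<le> \<bar>e\<bar> + (b - a) * \<bar>e'\<bar>"
    "\<forall>t\<in>{a..b}. \<bar>poly (pderiv (pderiv c)) t\<bar> \<le> 6 * (\<bar>e\<bar> + (b - a) * \<bar>e'\<bar>) / (b - a)\<^sup>2"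
proof -
  define h where "h = b - a"
  have h: "h > 0" using assms by (simp add: h_def)
  define c where "c = pcompose [:0, 0, 3 * e - h * e', h * e' - 2 * e:] [:- a / h, 1 / h:]"
  have lin: "poly [:- a / h, 1 / h:] t = (t - a) / h" for t
    by (simp add: field_simps diff_divide_distrib)
  have cubic: "poly [:0, 0, A, B:] y = y\<^sup>2 * A + y ^ 3 * B"
    "poly (pderiv [:0, 0, A, B:]) y = 2 * y * A + 3 * y\<^sup>2 * B"
    "poly (pderiv (pderiv [:0, 0, A, B:])) y = 2 * A + 6 * y * B" for A B y :: real
    by (simp_all add: pderiv_pCons power2_eq_square power3_eq_cube algebra_simps)
  have lin': "pderiv [:- a / h, 1 / h:] = [:1 / h:]" by (simp add: pderiv_pCons)
  have c0: "poly c t = ((t - a) / h)\<^sup>2 * (3 * e - h * e') + ((t - a) / h) ^ 3 * (h * e' - 2 * e)" for t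
    unfolding c_def poly_pcompose lin cubic ..
  have "pderiv c = smult (1 / h) (pcompose (pderiv [:0, 0, 3 * e - h * e', h * e' - 2 * e:]) [:- a / h, 1 / h:])"
    unfolding c_def pderiv_pcompose lin' by simp
  moreover from this have "pderiv (pderiv c) = smult (1 / h) (smult (1 / h)
      (pcompose (pderiv (pderiv [:0, 0, 3 * e - h * e', h * e' - 2 * e:])) [:- a / h, 1 / h:]))"
    by (simp only: pderiv_smult pderiv_pcompose lin') simp
  ultimately have c1: "poly (pderiv c) t =
      1 / h * (2 * ((t - a) / h) * (3 * e - h * e') + 3 * ((t - a) / h)\<^sup>2 * (h * e' - 2 * e))"
    and c2': "poly (pderiv (pderiv c)) t =
      1 / h * (1 / h * (2 * (3 * e - h * e') + 6 * ((t - a) / h) * (h * e' - 2 * e)))" for t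
    by (simp_all only: poly_smult poly_pcompose lin cubic)
  have c2: "poly (pderiv (pderiv c)) t =
    (e * (6 - 12 * ((t - a) / h)) + h * e' * (6 * ((t - a) / h) - 2)) / h\<^sup>2" for t
  proof -
    have "2 * (3 * e - h * e') + 6 * y * (h * e' - 2 * e) = e * (6 - 12 * y) + h * e' * (6 * y - 2)" for y
      by (simp add: algebra_simps)
    moreover have "1 / h * (1 / h * X) = X / h\<^sup>2" for X by (simp add: power2_eq_square)
    ultimately show ?thesis unfolding c2' by (simp only:)
  qed
  have y: "0 \<le> (t - a) / h" "(t - a) / h \<le> 1" if "t \<in> {a..b}" for t
    using that h by (auto simp: h_def divide_simps)
  have yb: "(b - a) / h = 1" using h by (simp add: h_def)
  show ?thesis
  proof
    show "degree c \<le> 3" unfolding c_def by (simp add: degree_pcompose)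
    show "poly c a = 0" "poly (pderiv c) a = 0" unfolding c0 c1 by simp_all
    show "poly c b = e" unfolding c0 yb by simp
    show "poly (pderiv c) b = e'" unfolding c1 yb using h by (simp add: algebra_simps)
    have bounds: "\<bar>poly c t\<bar> \<le> \<bar>e\<bar> + (b - a) * \<bar>e'\<bar> \<and>
        \<bar>poly (pderiv (pderiv c)) t\<bar> \<le> 6 * (\<bar>e\<bar> + (b - a) * \<bar>e'\<bar>) / (b - a)\<^sup>2"
      if t: "t \<in> {a..b}" for t
    proof -
    define z where "z = (t - a) / h"
    have z: "0 \<le> z" "z \<le> 1" using y[OF t] by (simp_all add: z_def)
    have "poly c t = e * (z\<^sup>2 * (3 - 2 * z)) + h * e' * (z\<^sup>2 * (z - 1))"
      unfolding c0 z_def[symmetric] by (simp add: power2_eq_square power3_eq_cube algebra_simps)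
    also have "\<bar>\<dots>\<bar> \<le> \<bar>e\<bar> * \<bar>z\<^sup>2 * (3 - 2 * z)\<bar> + h * \<bar>e'\<bar> * \<bar>z\<^sup>2 * (z - 1)\<bar>"
      using h by (intro order_trans[OF abs_triangle_ineq]) (simp add: abs_mult)
    also have "\<dots> \<le> \<bar>e\<bar> * 1 + h * \<bar>e'\<bar> * 1"
    proof (intro add_mono mult_left_mono)
      have "0 \<le> (1 - z)\<^sup>2 * (1 + 2 * z)" using z by simp
      then have "z\<^sup>2 * (3 - 2 * z) \<le> 1" by (simp add: power2_eq_square algebra_simps)
      moreover have "0 \<le> z\<^sup>2 * (3 - 2 * z)" using z by simp
      ultimately show "\<bar>z\<^sup>2 * (3 - 2 * z)\<bar> \<le> 1" by simp
      have "\<bar>z\<^sup>2\<bar> \<le> 1" "\<bar>z - 1\<bar> \<le> 1" using z by (auto simp: power_le_one)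
      then show "\<bar>z\<^sup>2 * (z - 1)\<bar> \<le> 1" unfolding abs_mult by (intro mult_le_one) auto
    qed (use h in auto)
    finally have p0: "\<bar>poly c t\<bar> \<le> \<bar>e\<bar> + (b - a) * \<bar>e'\<bar>" by (simp add: h_def)
    have "\<bar>e * (6 - 12 * z) + h * e' * (6 * z - 2)\<bar> \<le> \<bar>e\<bar> * \<bar>6 - 12 * z\<bar> + h * \<bar>e'\<bar> * \<bar>6 * z - 2\<bar>"
      using h by (intro order_trans[OF abs_triangle_ineq]) (simp add: abs_mult)
    also have "\<dots> \<le> \<bar>e\<bar> * 6 + h * \<bar>e'\<bar> * 6"
      using z h by (intro add_mono mult_left_mono) auto
    finally have "\<bar>e * (6 - 12 * z) + h * e' * (6 * z - 2)\<bar> / h\<^sup>2 \<le> (\<bar>e\<bar> * 6 + h * \<bar>e'\<bar> * 6) / h\<^sup>2"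
      by (intro divide_right_mono) auto
    then have "\<bar>poly (pderiv (pderiv c)) t\<bar> \<le> 6 * (\<bar>e\<bar> + (b - a) * \<bar>e'\<bar>) / (b - a)\<^sup>2"
      unfolding c2 z_def[symmetric] by (simp add: h_def[symmetric] algebra_simps)
    with p0 show ?thesis by blast
    qed
    then show "\<forall>t\<in>{a..b}. \<bar>poly c t\<bar> \<le> \<bar>e\<bar> + (b - a) * \<bar>e'\<bar>"
      "\<forall>t\<in>{a..b}. \<bar>poly (pderiv (pderiv c)) t\<bar> \<le> 6 * (\<bar>e\<bar> + (b - a) * \<bar>e'\<bar>) / (b - a)\<^sup>2"
      by blast+
  qed
qed

text \<open>
  The Taylor polynomial at \<open>a\<close> misses value and slope at \<open>b\<close> by
  remainders of orders \<open>p + 1\<close> and \<open>p\<close>; the cubic that removes them is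
  no larger than the remainder itself. This is where \<open>p \<ge> 3\<close> is used on a cell.
\<close>

lemma hermite_local:
  fixes a b M :: real
  assumes "a < b" "3 \<le> p"
    and D: "\<And>k t. k \<le> p \<Longrightarrow> t \<in> {a..b} \<Longrightarrow> (D k has_real_derivative D (Suc k) t) (at t within {a..b})"
    and M: "\<And>t. t \<in> {a..b} \<Longrightarrow> \<bar>D (Suc p) t\<bar> \<le> M"
  shows "\<exists>Q. degree Q \<le> p \<and> poly Q a = D 0 a \<and> poly (pderiv Q) a = D 1 a \<and>
     poly Q b = D 0 b \<and> poly (pderiv Q) b = D 1 b \<and>
     (\<forall>t\<in>{a..b}. \<bar>D 0 t - poly Q t\<bar> \<le> 13 * M * (b - a) ^ (p + 1) \<and>
        \<bar>D 2 t - poly (pderiv (pderiv Q)) t\<bar> \<le> 13 * M * (b - a) ^ (p - 1))"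
proof -
  define h where "h = b - a"
  have h: "h > 0" using assms by (simp add: h_def)
  obtain T where T: "degree T \<le> p" "\<And>k. k \<le> p \<Longrightarrow> poly ((pderiv ^^ k) T) a = D k a"
    using taylor_poly_exists[of p a "\<lambda>k. D k a"] by blast
  have R: "\<bar>D k t - poly ((pderiv ^^ k) T) t\<bar> \<le> M * h ^ (Suc p - k)" if "k \<le> p" "t \<in> {a..b}" for k t
    using taylor_remainder_bound[OF D M T _ that(2), where j = "Suc p - k"] that by (simp add: h_def)
  have b: "b \<in> {a..b}" using assms by simp
  have M0: "0 \<le> M" using M[OF b] by linarith
  let ?e = "D 0 b - poly T b" and ?e' = "D 1 b - poly (pderiv T) b"
  have e: "\<bar>?e\<bar> + h * \<bar>?e'\<bar> \<le> 2 * M * h ^ (p + 1)"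
  proof -
    have "\<bar>?e\<bar> \<le> M * h ^ (p + 1)" using R[of 0 b] b by simp
    moreover have "h * \<bar>?e'\<bar> \<le> h * (M * h ^ p)"
      using R[of 1 b] b h assms(2) by (intro mult_left_mono) auto
    ultimately show ?thesis by (simp add: algebra_simps)
  qed
  obtain c where c: "degree c \<le> 3" "poly c a = 0" "poly (pderiv c) a = 0" "poly c b = ?e"
    "poly (pderiv c) b = ?e'"
    "\<forall>t\<in>{a..b}. \<bar>poly c t\<bar> \<le> \<bar>?e\<bar> + h * \<bar>?e'\<bar>"
    "\<forall>t\<in>{a..b}. \<bar>poly (pderiv (pderiv c)) t\<bar> \<le> 6 * (\<bar>?e\<bar> + h * \<bar>?e'\<bar>) / h\<^sup>2"
    by (rule cubic_correction[OF assms(1), of ?e ?e', folded h_def])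
  have "\<bar>D 0 t - poly (T + c) t\<bar> \<le> 13 * M * h ^ (p + 1)" if t: "t \<in> {a..b}" for t
  proof -
    have "\<bar>D 0 t - poly T t\<bar> \<le> M * h ^ (p + 1)" using R[of 0 t] t by simp
    moreover have "\<bar>poly c t\<bar> \<le> 2 * M * h ^ (p + 1)" using c(6)[rule_format, OF t] e by linarith
    moreover have "0 \<le> M * h ^ (p + 1)" using M0 h by simp
    ultimately show ?thesis by simp
  qed
  moreover have "\<bar>D 2 t - poly (pderiv (pderiv (T + c))) t\<bar> \<le> 13 * M * h ^ (p - 1)" if t: "t \<in> {a..b}" for t
  proof -
    have p: "p + 1 = (p - 1) + 2" "Suc p - 2 = p - 1" using assms(2) by auto
    have "\<bar>D 2 t - poly (pderiv (pderiv T)) t\<bar> \<le> M * h ^ (p - 1)"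
      using R[of 2 t] t assms(2) by (simp add: numeral_2_eq_2)
    moreover have "\<bar>poly (pderiv (pderiv c)) t\<bar> \<le> 12 * M * h ^ (p - 1)"
    proof -
      have "\<bar>poly (pderiv (pderiv c)) t\<bar> \<le> 6 * (2 * M * h ^ (p + 1)) / h\<^sup>2"
        using c(7)[rule_format, OF t] e by (elim order_trans) (intro divide_right_mono mult_left_mono, auto)
      also have "\<dots> = 12 * M * h ^ (p - 1)"
        using h unfolding p(1) power_add by simp
      finally show ?thesis .
    qed
    ultimately show ?thesis by (simp add: pderiv_add)
  qed
  moreover have "degree (T + c) \<le> p" using T(1) c(1) assms(2) by (intro degree_add_le) auto
  moreover have "poly T a = D 0 a" "poly (pderiv T) a = D 1 a" using T(2)[of 0] T(2)[of 1] assms(2) by auto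
  ultimately show ?thesis
    using c(2-5) by (intro exI[of _ "T + c"]) (simp add: pderiv_add h_def)
qed

text \<open>
  The \<open>k\<close>-th member is the \<open>k\<close>-th derivative of the zeroth one, with
  one-sided derivatives at the end points.
\<close>

definition deriv_family :: "nat \<Rightarrow> (nat \<Rightarrow> real \<Rightarrow> real) \<Rightarrow> bool" where
  "deriv_family K D \<longleftrightarrow> (\<forall>k<K. \<forall>t\<in>{0..1}. (D k has_real_derivative D (Suc k) t) (at t within {0..1}))"

text \<open>
  The bounds \<open>b0\<close> and \<open>b2\<close> are functions because the error of a layer
  decays with the layer itself; a uniform bound would lose the factor
  \<open>\<epsilon>\<^sup>1\<^sup>/\<^sup>2\<close> that comes from the \<open>L\<^sub>2\<close>
  norm of the exponential. Boundary data are interpolated so that approximations of functions in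
  \<open>H\<^sub>0\<^sup>2\<close> stay in this space.
\<close>

definition spline_approx :: "nat \<Rightarrow> nat \<Rightarrow> (nat \<Rightarrow> real) \<Rightarrow> (nat \<Rightarrow> real \<Rightarrow> real) \<Rightarrow>
    (real \<Rightarrow> real) \<Rightarrow> (real \<Rightarrow> real) \<Rightarrow> (nat \<Rightarrow> real poly) \<Rightarrow> bool" where
  "spline_approx p N x D b0 b2 Q \<longleftrightarrow> C1_pieces p N x Q \<and>
     poly (Q 0) 0 = D 0 0 \<and> poly (pderiv (Q 0)) 0 = D 1 0 \<and>
     poly (Q (N - 1)) 1 = D 0 1 \<and> poly (pderiv (Q (N - 1))) 1 = D 1 1 \<and>
     (\<forall>i<N. \<forall>t\<in>{x i..x (Suc i)}. \<bar>D 0 t - poly (Q i) t\<bar> \<le> b0 t \<and>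
        \<bar>D 2 t - poly (pderiv (pderiv (Q i))) t\<bar> \<le> b2 t)"

lemma spline_approx_add:
  assumes "spline_approx p N x D b0 b2 Q" "spline_approx p N x E c0 c2 R"
  shows "spline_approx p N x (\<lambda>k t. D k t + E k t) (\<lambda>t. b0 t + c0 t) (\<lambda>t. b2 t + c2 t) (\<lambda>i. Q i + R i)"
proof -
  have "C1_pieces p N x (\<lambda>i. Q i + R i)"
    using assms by (auto simp: spline_approx_def C1_pieces_def pderiv_add intro: degree_add_le)
  moreover have "\<bar>D 0 t + E 0 t - poly (Q i + R i) t\<bar> \<le> b0 t + c0 t \<and>
     \<bar>D 2 t + E 2 t - poly (pderiv (pderiv (Q i + R i))) t\<bar> \<le> b2 t + c2 t"
    if "i < N" "t \<in> {x i..x (Suc i)}" for i t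
  proof -
    have "\<bar>D 0 t - poly (Q i) t\<bar> \<le> b0 t" "\<bar>D 2 t - poly (pderiv (pderiv (Q i))) t\<bar> \<le> b2 t"
      "\<bar>E 0 t - poly (R i) t\<bar> \<le> c0 t" "\<bar>E 2 t - poly (pderiv (pderiv (R i))) t\<bar> \<le> c2 t"
      using assms that by (auto simp: spline_approx_def)
    then show ?thesis by (simp add: pderiv_add abs_le_iff)
  qed
  ultimately show ?thesis using assms by (simp add: spline_approx_def pderiv_add)
qed

text \<open>
  Layers at \<open>1\<close> are reflected to layers at \<open>0\<close>, which is possible
  because the mesh is symmetric.
\<close>

lemma spline_approx_reflect:
  assumes mesh: "is_mesh N x" and sym: "\<And>i. i \<le> N \<Longrightarrow> x (N - i) = 1 - x i"
    and app: "spline_approx p N x (\<lambda>k t. (-1) ^ k * D k (1 - t)) b0 b2 Q"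
  shows "spline_approx p N x D (\<lambda>t. b0 (1 - t)) (\<lambda>t. b2 (1 - t)) (\<lambda>i. pcompose (Q (N - 1 - i)) [:1, -1:])"
proof -
  let ?R = "\<lambda>i. pcompose (Q (N - 1 - i)) [:1, -1:]"
  have r0: "poly (?R i) t = poly (Q (N - 1 - i)) (1 - t)" for i t by (simp add: poly_pcompose)
  have r1: "poly (pderiv (?R i)) t = - poly (pderiv (Q (N - 1 - i))) (1 - t)" for i t
    by (simp add: pderiv_pcompose pderiv_pCons poly_pcompose)
  have r2: "poly (pderiv (pderiv (?R i))) t = poly (pderiv (pderiv (Q (N - 1 - i)))) (1 - t)" for i t
    by (simp add: pderiv_pcompose pderiv_pCons poly_pcompose pderiv_mult pderiv_minus)
  have N: "0 < N" by (rule is_mesh_pos[OF mesh])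
  have "C1_pieces p N x ?R"
    unfolding C1_pieces_def r0 r1
  proof (intro conjI allI impI)
    fix i assume "i < N"
    then show "degree (?R i) \<le> p"
      using app by (simp add: degree_pcompose spline_approx_def C1_pieces_def)
  next
    fix i assume i: "Suc i < N"
    define j where "j = N - 1 - Suc i"
    have j: "N - 1 - i = Suc j" "Suc j < N" "x (Suc j) = 1 - x (Suc i)"
      using i sym[of "Suc i"] by (auto simp: j_def Suc_diff_Suc)
    have "poly (Q j) (x (Suc j)) = poly (Q (Suc j)) (x (Suc j))"
      "poly (pderiv (Q j)) (x (Suc j)) = poly (pderiv (Q (Suc j))) (x (Suc j))"
      using app j(2) by (auto simp: spline_approx_def C1_pieces_def)
    then show "poly (Q (N - 1 - i)) (1 - x (Suc i)) = poly (Q (N - 1 - Suc i)) (1 - x (Suc i))"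
      "- poly (pderiv (Q (N - 1 - i))) (1 - x (Suc i)) = - poly (pderiv (Q (N - 1 - Suc i))) (1 - x (Suc i))"
      unfolding j_def[symmetric] j(1) j(3)[symmetric] by simp_all
  qed
  moreover have "\<bar>D 0 t - poly (?R i) t\<bar> \<le> b0 (1 - t) \<and> \<bar>D 2 t - poly (pderiv (pderiv (?R i))) t\<bar> \<le> b2 (1 - t)"
    if i: "i < N" and t: "t \<in> {x i..x (Suc i)}" for i t
  proof -
    have "x (N - 1 - i) = 1 - x (Suc i)" "x (Suc (N - 1 - i)) = 1 - x i"
      using sym[of i] sym[of "Suc i"] i by (auto simp: Suc_diff_Suc)
    then have "1 - t \<in> {x (N - 1 - i)..x (Suc (N - 1 - i))}" using t by auto
    moreover have "N - 1 - i < N" using N by simp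
    ultimately show ?thesis
      using app unfolding spline_approx_def r0 r2 by fastforce
  qed
  ultimately show ?thesis
    using app N unfolding spline_approx_def r0 r1 by simp
qed

lemma hermite_pieces:
  assumes mesh: "is_mesh N x" and "3 \<le> p" and D: "deriv_family (p + 1) D"
    and m: "\<And>i t. i < N \<Longrightarrow> t \<in> {x i..x (Suc i)} \<Longrightarrow> \<bar>D (Suc p) t\<bar> \<le> m i"
  obtains Q where "\<And>i. i < N \<Longrightarrow> degree (Q i) \<le> p"
    "\<And>i. i < N \<Longrightarrow> poly (Q i) (x i) = D 0 (x i) \<and> poly (pderiv (Q i)) (x i) = D 1 (x i)"
    "\<And>i. i < N \<Longrightarrow> poly (Q i) (x (Suc i)) = D 0 (x (Suc i)) \<and> poly (pderiv (Q i)) (x (Suc i)) = D 1 (x (Suc i))"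
    "\<And>i t. i < N \<Longrightarrow> t \<in> {x i..x (Suc i)} \<Longrightarrow>
       \<bar>D 0 t - poly (Q i) t\<bar> \<le> 13 * m i * (x (Suc i) - x i) ^ (p + 1) \<and>
       \<bar>D 2 t - poly (pderiv (pderiv (Q i))) t\<bar> \<le> 13 * m i * (x (Suc i) - x i) ^ (p - 1)"
proof -
  have "\<exists>Q. degree Q \<le> p \<and> poly Q (x i) = D 0 (x i) \<and> poly (pderiv Q) (x i) = D 1 (x i) \<and>
     poly Q (x (Suc i)) = D 0 (x (Suc i)) \<and> poly (pderiv Q) (x (Suc i)) = D 1 (x (Suc i)) \<and>
     (\<forall>t\<in>{x i..x (Suc i)}. \<bar>D 0 t - poly Q t\<bar> \<le> 13 * m i * (x (Suc i) - x i) ^ (p + 1) \<and>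
        \<bar>D 2 t - poly (pderiv (pderiv Q)) t\<bar> \<le> 13 * m i * (x (Suc i) - x i) ^ (p - 1))"
    if i: "i < N" for i
  proof (rule hermite_local)
    have sub: "{x i..x (Suc i)} \<subseteq> {0..1}"
      using is_mesh_range[OF mesh, of i] is_mesh_range[OF mesh, of "Suc i"] i by auto
    fix k t assume "k \<le> p" "t \<in> {x i..x (Suc i)}"
    then show "(D k has_real_derivative D (Suc k) t) (at t within {x i..x (Suc i)})"
      using D sub by (intro DERIV_subset[OF _ sub]) (auto simp: deriv_family_def)
  qed (use i m mesh assms(2) in \<open>auto simp: is_mesh_def\<close>)
  then obtain Q where "\<And>i. i < N \<Longrightarrow> degree (Q i) \<le> p \<and> poly (Q i) (x i) = D 0 (x i) \<and> poly (pderiv (Q i)) (x i) = D 1 (x i) \<and>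
     poly (Q i) (x (Suc i)) = D 0 (x (Suc i)) \<and> poly (pderiv (Q i)) (x (Suc i)) = D 1 (x (Suc i)) \<and>
     (\<forall>t\<in>{x i..x (Suc i)}. \<bar>D 0 t - poly (Q i) t\<bar> \<le> 13 * m i * (x (Suc i) - x i) ^ (p + 1) \<and>
        \<bar>D 2 t - poly (pderiv (pderiv (Q i))) t\<bar> \<le> 13 * m i * (x (Suc i) - x i) ^ (p - 1))"
    by metis
  then show ?thesis by (intro that[of Q]) (simp_all only: atomize_conj)
qed

lemma regular_part_approx:
  assumes mesh: "is_mesh N x" and step: "\<And>i. i < N \<Longrightarrow> x (Suc i) - x i \<le> H"
    and "3 \<le> p" and D: "deriv_family (p + 1) D"
    and M: "\<And>t. t \<in> {0..1} \<Longrightarrow> \<bar>D (Suc p) t\<bar> \<le> M"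
  shows "\<exists>Q. spline_approx p N x D (\<lambda>t. 13 * M * H ^ (p + 1)) (\<lambda>t. 13 * M * H ^ (p - 1)) Q"
proof -
  have "\<bar>D (Suc p) t\<bar> \<le> M" if "i < N" "t \<in> {x i..x (Suc i)}" for i t
    using M is_mesh_range[OF mesh, of i] is_mesh_range[OF mesh, of "Suc i"] that by auto
  then obtain Q where Q: "\<And>i. i < N \<Longrightarrow> degree (Q i) \<le> p"
    "\<And>i. i < N \<Longrightarrow> poly (Q i) (x i) = D 0 (x i) \<and> poly (pderiv (Q i)) (x i) = D 1 (x i)"
    "\<And>i. i < N \<Longrightarrow> poly (Q i) (x (Suc i)) = D 0 (x (Suc i)) \<and> poly (pderiv (Q i)) (x (Suc i)) = D 1 (x (Suc i))"
    "\<And>i t. i < N \<Longrightarrow> t \<in> {x i..x (Suc i)} \<Longrightarrow>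
       \<bar>D 0 t - poly (Q i) t\<bar> \<le> 13 * M * (x (Suc i) - x i) ^ (p + 1) \<and>
       \<bar>D 2 t - poly (pderiv (pderiv (Q i))) t\<bar> \<le> 13 * M * (x (Suc i) - x i) ^ (p - 1)"
    using hermite_pieces[OF mesh assms(3) D, of "\<lambda>_. M"] by metis
  have N: "0 < N" "x 0 = 0" "x N = 1" using is_mesh_pos[OF mesh] mesh by (auto simp: is_mesh_def)
  have M0: "0 \<le> M" using M[of 0] by simp
  have "C1_pieces p N x Q" using Q(1-3) unfolding C1_pieces_def by simp
  moreover have "13 * M * (x (Suc i) - x i) ^ n \<le> 13 * M * H ^ n" if "i < N" for i n
    using step[OF that] M0 mesh that
    by (intro mult_left_mono power_mono) (auto simp: is_mesh_def less_imp_le)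
  moreover have "poly (Q (N - 1)) 1 = D 0 1" "poly (pderiv (Q (N - 1))) 1 = D 1 1"
    using Q(3)[of "N - 1"] N by auto
  moreover have "poly (Q 0) 0 = D 0 0" "poly (pderiv (Q 0)) 0 = D 1 0"
    using Q(2)[of 0] N by auto
  ultimately show ?thesis
    unfolding spline_approx_def using Q(4) by (intro exI[of _ Q]) (meson order_trans)
qed

text \<open>
  Constant on \<open>[0,\<tau>]\<close> and decaying like the layer beyond; for \<open>\<tau> =
  0\<close> it is the exponential of the layer itself on \<open>[0,1]\<close>.
\<close>

definition layer_tail :: "real \<Rightarrow> real \<Rightarrow> real \<Rightarrow> real" where
  "layer_tail \<epsilon> \<tau> t = exp (- max 0 (t - \<tau>) / \<epsilon>)"

text \<open>
  The three terms bound the interpolation error on the fine cells, the cubic that cuts off the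
  layer together with the layer beyond \<open>\<tau>\<close>, and the cubic that restores the
  boundary data at \<open>1\<close>.
\<close>

definition layer_envelope :: "real \<Rightarrow> real \<Rightarrow> real \<Rightarrow> real \<Rightarrow> real" where
  "layer_envelope \<epsilon> \<tau> \<theta> t = \<theta> * layer_tail \<epsilon> 0 t
     + 6 * (1 + \<tau> / \<epsilon>) * exp (- \<tau> / \<epsilon>) * layer_tail \<epsilon> \<tau> t + 12 * exp (- 1 / \<epsilon>) / \<epsilon>"

text \<open>
  The approximation is \<open>Q i - q + r\<close> on the fine cells and \<open>r\<close> beyond
  \<open>\<tau>\<close>, with cubics \<open>q\<close> and \<open>r\<close> that have a double zero
  at \<open>0\<close>. The cubic \<open>q\<close> takes the value and slope of the layer at
  \<open>\<tau>\<close>, so that the pieces match there; spreading it over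
  \<open>[0,\<tau>]\<close> instead of one fine cell keeps its second derivative below
  \<open>\<epsilon>\<^sup>-\<^sup>2\<close> times the nodal data, because \<open>\<epsilon> \<le>
  \<tau>\<close>. The cubic \<open>r\<close> takes value and slope of the layer at
  \<open>1\<close>.
\<close>

lemma layer_part_approx:
  assumes mesh: "is_mesh N x" and p: "3 \<le> p" and D: "deriv_family (p + 1) D"
    and eps: "0 < \<epsilon>" "\<epsilon> \<le> \<tau>" "\<tau> < 1"
    and M: "\<And>k t. k \<le> p + 1 \<Longrightarrow> t \<in> {0..1} \<Longrightarrow> \<bar>D k t\<bar> \<le> M / \<epsilon> ^ k * exp (- t / \<epsilon>)"
    and n: "0 < n" "n < N" "x n = \<tau>"
    and step: "\<And>i. i < n \<Longrightarrow> x (Suc i) - x i \<le> \<rho> * \<epsilon>"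
    and \<theta>: "13 * exp \<rho> * \<rho> ^ (p + 1) \<le> \<theta>" "13 * exp \<rho> * \<rho> ^ (p - 1) \<le> \<theta>"
  shows "\<exists>Q. spline_approx p N x D (\<lambda>t. M * layer_envelope \<epsilon> \<tau> \<theta> t)
                (\<lambda>t. M / \<epsilon>\<^sup>2 * layer_envelope \<epsilon> \<tau> \<theta> t) Q"
proof -
  have M0: "0 \<le> M" using M[of 0 0] by simp
  have mesh_le: "x i \<le> x (Suc i)" if "i < N" for i using mesh that by (simp add: is_mesh_def less_imp_le)
  have x01: "{x i..x (Suc i)} \<subseteq> {0..1}" if "i < N" for i
    using is_mesh_range[OF mesh, of i] is_mesh_range[OF mesh, of "Suc i"] that by auto
  have rho0: "0 \<le> \<rho>"
    using step[of 0] mesh_le[of 0] n eps by (simp add: zero_le_mult_iff) (smt (verit) mult_neg_pos)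
  obtain Q where Q: "\<And>i. i < N \<Longrightarrow> degree (Q i) \<le> p"
    "\<And>i. i < N \<Longrightarrow> poly (Q i) (x i) = D 0 (x i) \<and> poly (pderiv (Q i)) (x i) = D 1 (x i)"
    "\<And>i. i < N \<Longrightarrow> poly (Q i) (x (Suc i)) = D 0 (x (Suc i)) \<and> poly (pderiv (Q i)) (x (Suc i)) = D 1 (x (Suc i))"
    "\<And>i t. i < N \<Longrightarrow> t \<in> {x i..x (Suc i)} \<Longrightarrow>
       \<bar>D 0 t - poly (Q i) t\<bar> \<le> 13 * (M / \<epsilon> ^ Suc p * exp (- x i / \<epsilon>)) * (x (Suc i) - x i) ^ (p + 1) \<and>
       \<bar>D 2 t - poly (pderiv (pderiv (Q i))) t\<bar> \<le> 13 * (M / \<epsilon> ^ Suc p * exp (- x i / \<epsilon>)) * (x (Suc i) - x i) ^ (p - 1)"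
  proof (rule hermite_pieces[OF mesh p D])
    fix i t assume it: "i < N" "t \<in> {x i..x (Suc i)}"
    then have "t \<in> {0..1}" using x01 by blast
    then have "\<bar>D (Suc p) t\<bar> \<le> M / \<epsilon> ^ Suc p * exp (- t / \<epsilon>)" using M[of "Suc p" t] by simp
    also have "\<dots> \<le> M / \<epsilon> ^ Suc p * exp (- x i / \<epsilon>)"
      using it M0 eps by (intro mult_left_mono) (auto simp: divide_right_mono)
    finally show "\<bar>D (Suc p) t\<bar> \<le> M / \<epsilon> ^ Suc p * exp (- x i / \<epsilon>)" .
  qed blast
  \<comment> \<open>The derivative bound holds at the left node; moving it to \<open>t\<close> costs at most \<open>exp \<rho>\<close>.\<close>
  have fine: "13 * (M / \<epsilon> ^ Suc p * exp (- x i / \<epsilon>)) * (x (Suc i) - x i) ^ (p + 1 - m) \<le>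
      M / \<epsilon> ^ m * (\<theta> * layer_tail \<epsilon> 0 t)"
    if i: "i < n" and t: "t \<in> {x i..x (Suc i)}" and m: "m = 0 \<or> m = 2" for i t m
  proof -
    have iN: "i < N" using i n by simp
    have t0: "0 \<le> t" using x01[OF iN] t by auto
    have "(x (Suc i) - x i) ^ (p + 1 - m) \<le> (\<rho> * \<epsilon>) ^ (p + 1 - m)"
      using step[OF i] mesh_le[OF iN] by (intro power_mono) auto
    moreover have "exp (- x i / \<epsilon>) \<le> exp \<rho> * exp (- t / \<epsilon>)"
    proof -
      have "t - x i \<le> \<rho> * \<epsilon>" using t step[OF i] by auto
      then have "- x i / \<epsilon> \<le> \<rho> + - t / \<epsilon>" using eps by (simp add: field_simps)
      then show ?thesis by (simp flip: exp_add)
    qed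
    ultimately have "13 * (M / \<epsilon> ^ Suc p * exp (- x i / \<epsilon>)) * (x (Suc i) - x i) ^ (p + 1 - m) \<le>
        13 * (M / \<epsilon> ^ Suc p * (exp \<rho> * exp (- t / \<epsilon>))) * (\<rho> * \<epsilon>) ^ (p + 1 - m)"
      using M0 eps mesh_le[OF iN] by (intro mult_mono mult_left_mono) auto
    also have "\<dots> = M / \<epsilon> ^ m * ((13 * exp \<rho> * \<rho> ^ (p + 1 - m)) * exp (- t / \<epsilon>))"
    proof -
      have "\<epsilon> ^ Suc p = \<epsilon> ^ m * \<epsilon> ^ (p + 1 - m)" using m p by (auto simp flip: power_add)
      then show ?thesis using eps by (simp add: power_mult_distrib field_simps)
    qed
    also have "\<dots> \<le> M / \<epsilon> ^ m * (\<theta> * exp (- t / \<epsilon>))"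
      using M0 eps \<theta> m by (intro mult_left_mono mult_right_mono) (auto simp: numeral_2_eq_2)
    finally show ?thesis using t0 by (simp add: layer_tail_def)
  qed
  obtain q where q: "degree q \<le> 3" "poly q 0 = 0" "poly (pderiv q) 0 = 0" "poly q \<tau> = D 0 \<tau>"
    "poly (pderiv q) \<tau> = D 1 \<tau>"
    "\<forall>t\<in>{0..\<tau>}. \<bar>poly q t\<bar> \<le> \<bar>D 0 \<tau>\<bar> + (\<tau> - 0) * \<bar>D 1 \<tau>\<bar>"
    "\<forall>t\<in>{0..\<tau>}. \<bar>poly (pderiv (pderiv q)) t\<bar> \<le> 6 * (\<bar>D 0 \<tau>\<bar> + (\<tau> - 0) * \<bar>D 1 \<tau>\<bar>) / (\<tau> - 0)\<^sup>2"
    by (rule cubic_correction[of 0 \<tau> "D 0 \<tau>" "D 1 \<tau>"]) (use eps in auto)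
  obtain r where r: "degree r \<le> 3" "poly r 0 = 0" "poly (pderiv r) 0 = 0" "poly r 1 = D 0 1"
    "poly (pderiv r) 1 = D 1 1"
    "\<forall>t\<in>{0..1}. \<bar>poly r t\<bar> \<le> \<bar>D 0 1\<bar> + (1 - 0) * \<bar>D 1 1\<bar>"
    "\<forall>t\<in>{0..1}. \<bar>poly (pderiv (pderiv r)) t\<bar> \<le> 6 * (\<bar>D 0 1\<bar> + (1 - 0) * \<bar>D 1 1\<bar>) / (1 - 0)\<^sup>2"
    by (rule cubic_correction[OF zero_less_one])
  have nodal: "\<bar>D 0 s\<bar> + s * \<bar>D 1 s\<bar> \<le> M * ((1 + s / \<epsilon>) * exp (- s / \<epsilon>))" if "s \<in> {0..1}" for s
  proof -
    have "s * \<bar>D 1 s\<bar> \<le> s * (M / \<epsilon> * exp (- s / \<epsilon>))"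
      using M[of 1 s] that by (intro mult_left_mono) auto
    then show ?thesis using M[of 0 s] that by (simp add: algebra_simps)
  qed
  have q_bound: "\<bar>poly q t\<bar> \<le> M * (6 * (1 + \<tau> / \<epsilon>) * exp (- \<tau> / \<epsilon>) * layer_tail \<epsilon> \<tau> t)"
    "\<bar>poly (pderiv (pderiv q)) t\<bar> \<le> M / \<epsilon>\<^sup>2 * (6 * (1 + \<tau> / \<epsilon>) * exp (- \<tau> / \<epsilon>) * layer_tail \<epsilon> \<tau> t)"
    if t: "t \<in> {0..\<tau>}" for t
  proof -
    have one: "layer_tail \<epsilon> \<tau> t = 1" using t by (simp add: layer_tail_def)
    let ?B = "M * ((1 + \<tau> / \<epsilon>) * exp (- \<tau> / \<epsilon>))"
    have B0: "0 \<le> ?B" using M0 eps by simp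
    have B: "\<bar>D 0 \<tau>\<bar> + (\<tau> - 0) * \<bar>D 1 \<tau>\<bar> \<le> ?B" using nodal[of \<tau>] eps by simp
    then have "\<bar>poly q t\<bar> \<le> 6 * ?B" using q(6)[rule_format, OF t] B0 by linarith
    then show "\<bar>poly q t\<bar> \<le> M * (6 * (1 + \<tau> / \<epsilon>) * exp (- \<tau> / \<epsilon>) * layer_tail \<epsilon> \<tau> t)"
      by (simp only: one mult_1_right mult_ac times_divide_eq_left times_divide_eq_right)
    have "6 * (\<bar>D 0 \<tau>\<bar> + (\<tau> - 0) * \<bar>D 1 \<tau>\<bar>) / (\<tau> - 0)\<^sup>2 \<le> 6 * ?B / (\<tau> - 0)\<^sup>2"
      by (intro divide_right_mono mult_left_mono B) simp_all
    then have "\<bar>poly (pderiv (pderiv q)) t\<bar> \<le> 6 * ?B / \<tau>\<^sup>2"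
      using q(7)[rule_format, OF t] unfolding diff_zero by (rule order_trans[rotated])
    also have "\<dots> \<le> 6 * ?B / \<epsilon>\<^sup>2"
      using B0 eps by (intro divide_left_mono power_mono) auto
    finally show "\<bar>poly (pderiv (pderiv q)) t\<bar> \<le> M / \<epsilon>\<^sup>2 * (6 * (1 + \<tau> / \<epsilon>) * exp (- \<tau> / \<epsilon>) * layer_tail \<epsilon> \<tau> t)"
      by (simp only: one mult_1_right mult_ac times_divide_eq_left times_divide_eq_right)
  qed
  have r_bound: "\<bar>poly r t\<bar> \<le> M * (12 * exp (- 1 / \<epsilon>) / \<epsilon>)"
    "\<bar>poly (pderiv (pderiv r)) t\<bar> \<le> M / \<epsilon>\<^sup>2 * (12 * exp (- 1 / \<epsilon>) / \<epsilon>)"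
    if t: "t \<in> {0..1}" for t
  proof -
    let ?B = "M * (12 * exp (- 1 / \<epsilon>) / \<epsilon>)"
    have "1 + 1 / \<epsilon> \<le> 2 / \<epsilon>" using eps by (simp add: field_simps)
    then have "M * ((1 + 1 / \<epsilon>) * exp (- 1 / \<epsilon>)) \<le> M * (2 / \<epsilon> * exp (- 1 / \<epsilon>))"
      using M0 by (intro mult_left_mono mult_right_mono) auto
    then have "6 * (\<bar>D 0 1\<bar> + (1 - 0) * \<bar>D 1 1\<bar>) \<le> 6 * (M * (2 / \<epsilon> * exp (- 1 / \<epsilon>)))"
      using nodal[of 1] by simp
    then have B: "6 * (\<bar>D 0 1\<bar> + (1 - 0) * \<bar>D 1 1\<bar>) \<le> ?B" by (simp add: mult_ac)
    then show "\<bar>poly r t\<bar> \<le> ?B" using r(6)[rule_format, OF t] by simp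
    have "\<bar>poly (pderiv (pderiv r)) t\<bar> \<le> ?B * 1" using r(7)[rule_format, OF t] B by simp
    also have "\<dots> \<le> ?B * (1 / \<epsilon>\<^sup>2)"
      using M0 eps by (intro mult_left_mono) (auto simp: divide_simps power_le_one)
    finally show "\<bar>poly (pderiv (pderiv r)) t\<bar> \<le> M / \<epsilon>\<^sup>2 * (12 * exp (- 1 / \<epsilon>) / \<epsilon>)"
      by (simp add: mult_ac)
  qed
  define R where "R i = (if i < n then Q i - q + r else r)" for i
  have N: "0 < N" "x 0 = 0" "x N = 1" using is_mesh_pos[OF mesh] mesh by (auto simp: is_mesh_def)
  have "C1_pieces p N x R"
    unfolding C1_pieces_def
  proof (intro conjI allI impI)
    fix i assume "i < N"
    then show "degree (R i) \<le> p"
      using Q(1) q(1) r(1) p by (auto simp: R_def intro!: degree_add_le degree_diff_le)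
  next
    fix i assume i: "Suc i < N"
    consider "Suc i < n" | "Suc i = n" | "n \<le> i" by linarith
    then have "poly (R i) (x (Suc i)) = poly (R (Suc i)) (x (Suc i)) \<and>
       poly (pderiv (R i)) (x (Suc i)) = poly (pderiv (R (Suc i))) (x (Suc i))"
    proof cases
      case 1
      then show ?thesis using Q(3)[of i] Q(2)[of "Suc i"] i by (simp add: R_def pderiv_add pderiv_diff)
    next
      case 2
      then have "x (Suc i) = \<tau>" using n by simp
      then show ?thesis using Q(3)[of i] q i 2 by (simp add: R_def pderiv_add pderiv_diff)
    qed (simp add: R_def)
    then show "poly (R i) (x (Suc i)) = poly (R (Suc i)) (x (Suc i))"
      "poly (pderiv (R i)) (x (Suc i)) = poly (pderiv (R (Suc i))) (x (Suc i))" by auto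
  qed
  moreover have "poly (R 0) 0 = D 0 0" "poly (pderiv (R 0)) 0 = D 1 0"
    using Q(2)[of 0] q r n N by (simp_all add: R_def pderiv_add pderiv_diff)
  moreover have "poly (R (N - 1)) 1 = D 0 1" "poly (pderiv (R (N - 1))) 1 = D 1 1"
  proof -
    have "R (N - 1) = r" using n by (auto simp: R_def)
    then show "poly (R (N - 1)) 1 = D 0 1" "poly (pderiv (R (N - 1))) 1 = D 1 1"
      using r(4,5) by simp_all
  qed
  moreover have "\<bar>D 0 t - poly (R i) t\<bar> \<le> M * layer_envelope \<epsilon> \<tau> \<theta> t \<and>
      \<bar>D 2 t - poly (pderiv (pderiv (R i))) t\<bar> \<le> M / \<epsilon>\<^sup>2 * layer_envelope \<epsilon> \<tau> \<theta> t"
    if i: "i < N" and t: "t \<in> {x i..x (Suc i)}" for i t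
  proof -
    have t01: "t \<in> {0..1}" using x01[OF i] t by auto
    have th0: "0 \<le> \<theta>" using \<theta>(1) rho0 by (intro order_trans[OF _ \<theta>(1)]) simp
    show ?thesis
    proof (cases "i < n")
      case True
      have "x (Suc i) \<le> x n" by (rule is_mesh_le[OF mesh]) (use True n in auto)
      then have tt: "t \<in> {0..\<tau>}" using t01 t n by auto
      have "\<bar>D 0 t - poly (Q i) t\<bar> \<le> M * (\<theta> * layer_tail \<epsilon> 0 t)"
        using Q(4)[OF i t] fine[OF True t, of 0] by simp
      moreover have "\<bar>D 2 t - poly (pderiv (pderiv (Q i))) t\<bar> \<le> M / \<epsilon>\<^sup>2 * (\<theta> * layer_tail \<epsilon> 0 t)"
        using Q(4)[OF i t] fine[OF True t, of 2] by (simp add: numeral_2_eq_2)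
      moreover have "poly (R i) t = poly (Q i) t - poly q t + poly r t"
        "poly (pderiv (pderiv (R i))) t =
          poly (pderiv (pderiv (Q i))) t - poly (pderiv (pderiv q)) t + poly (pderiv (pderiv r)) t"
        using True by (simp_all add: R_def pderiv_add pderiv_diff)
      moreover have tri: "\<bar>d - (a - b + c)\<bar> \<le> A + B + C"
        if "\<bar>d - a\<bar> \<le> A" "\<bar>b\<bar> \<le> B" "\<bar>c\<bar> \<le> C" for a b c d A B C :: real
        using that by linarith
      ultimately show ?thesis
        unfolding layer_envelope_def distrib_left
        by (simp only:) (intro conjI tri q_bound[OF tt, unfolded distrib_left] r_bound[OF t01])
    next
      case False
      have "x n \<le> x i" by (rule is_mesh_le[OF mesh]) (use False n i in auto)
      then have tt: "\<tau> \<le> t" using t n by auto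
      \<comment> \<open>Here only \<open>r\<close> is left of the approximation, and the layer itself is part of the error.\<close>
      have et: "exp (- t / \<epsilon>) = exp (- \<tau> / \<epsilon>) * layer_tail \<epsilon> \<tau> t"
        using tt by (simp add: layer_tail_def flip: exp_add) (simp add: diff_divide_distrib)
      have "1 \<le> 6 * (1 + \<tau> / \<epsilon>)" using eps by (simp add: add_increasing2)
      then have "exp (- t / \<epsilon>) \<le> 6 * (1 + \<tau> / \<epsilon>) * (exp (- \<tau> / \<epsilon>) * layer_tail \<epsilon> \<tau> t)"
        unfolding et using mult_right_mono[of 1 _ "exp (- \<tau> / \<epsilon>) * layer_tail \<epsilon> \<tau> t"]
        by (simp only: mult_1_left) (simp add: layer_tail_def)
      then have ee: "exp (- t / \<epsilon>) \<le> \<theta> * layer_tail \<epsilon> 0 t + 6 * (1 + \<tau> / \<epsilon>) * exp (- \<tau> / \<epsilon>) * layer_tail \<epsilon> \<tau> t"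
        using th0 by (simp add: layer_tail_def mult.assoc add_increasing)
      have "\<bar>D 0 t\<bar> \<le> M * (\<theta> * layer_tail \<epsilon> 0 t + 6 * (1 + \<tau> / \<epsilon>) * exp (- \<tau> / \<epsilon>) * layer_tail \<epsilon> \<tau> t)"
        using M[of 0 t] t01 mult_left_mono[OF ee M0] by simp
      moreover have "\<bar>D 2 t\<bar> \<le> M / \<epsilon>\<^sup>2 * (\<theta> * layer_tail \<epsilon> 0 t + 6 * (1 + \<tau> / \<epsilon>) * exp (- \<tau> / \<epsilon>) * layer_tail \<epsilon> \<tau> t)"
      proof -
        have "\<bar>D 2 t\<bar> \<le> M / \<epsilon>\<^sup>2 * exp (- t / \<epsilon>)" using M[of 2 t] t01 p by simp
        also have "\<dots> \<le> M / \<epsilon>\<^sup>2 * (\<theta> * layer_tail \<epsilon> 0 t + 6 * (1 + \<tau> / \<epsilon>) * exp (- \<tau> / \<epsilon>) * layer_tail \<epsilon> \<tau> t)"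
          using M0 by (intro mult_left_mono[OF ee]) simp
        finally show ?thesis .
      qed
      ultimately show ?thesis
        using r_bound[OF t01] False
        unfolding layer_envelope_def distrib_left R_def
        by (simp only: if_False) linarith
    qed
  qed
  ultimately show ?thesis unfolding spline_approx_def by blast
qed

section \<open>The Shishkin mesh and the size of the layer error\<close>

lemma shishkin_mesh_cases:
  fixes n :: nat
  assumes n: "0 < n" and \<tau>: "\<tau> = shishkin_tau \<sigma> \<epsilon> (4 * n)"
  shows "i \<le> n \<Longrightarrow> shishkin_mesh \<sigma> \<epsilon> (4 * n) i = real i * (\<tau> / n)"
    and "n \<le> i \<Longrightarrow> i \<le> 3 * n \<Longrightarrow>
      shishkin_mesh \<sigma> \<epsilon> (4 * n) i = \<tau> + (real i - n) * ((1 - 2 * \<tau>) / (2 * n))"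
    and "3 * n \<le> i \<Longrightarrow> shishkin_mesh \<sigma> \<epsilon> (4 * n) i = 1 - \<tau> + (real i - 3 * n) * (\<tau> / n)"
proof -
  have eq: "shishkin_mesh \<sigma> \<epsilon> (4 * n) i =
     (if i \<le> n then real i * (\<tau> / n)
      else if i \<le> 3 * n then \<tau> + (real i - n) * ((1 - 2 * \<tau>) / (2 * n))
      else 1 - \<tau> + (real i - 3 * n) * (\<tau> / n))" for i
  proof -
    have "real i \<le> real (4 * n) / 4 \<longleftrightarrow> i \<le> n" by simp
    moreover have "real i \<le> 3 * real (4 * n) / 4 \<longleftrightarrow> i \<le> 3 * n"
    proof -
      have "3 * real (4 * n) / 4 = real (3 * n)" by simp
      then show ?thesis by (simp only: of_nat_le_iff)
    qed
    ultimately show ?thesis by (simp add: shishkin_mesh_def Let_def \<tau>)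
  qed
  show "i \<le> n \<Longrightarrow> shishkin_mesh \<sigma> \<epsilon> (4 * n) i = real i * (\<tau> / n)" by (simp add: eq)
  show "n \<le> i \<Longrightarrow> i \<le> 3 * n \<Longrightarrow>
      shishkin_mesh \<sigma> \<epsilon> (4 * n) i = \<tau> + (real i - n) * ((1 - 2 * \<tau>) / (2 * n))"
    using n by (cases "i = n") (simp_all add: eq)
  show "3 * n \<le> i \<Longrightarrow> shishkin_mesh \<sigma> \<epsilon> (4 * n) i = 1 - \<tau> + (real i - 3 * n) * (\<tau> / n)"
  proof (cases "i = 3 * n")
    case True
    have "\<tau> + (real (3 * n) - n) * ((1 - 2 * \<tau>) / (2 * n)) = 1 - \<tau>"
      using n by (simp add: field_simps)
    then show ?thesis using n by (simp add: eq True)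
  qed (simp add: eq)
qed

lemma shishkin_mesh_facts:
  fixes n :: nat
  assumes n: "0 < n" and \<tau>: "\<tau> = shishkin_tau \<sigma> \<epsilon> (4 * n)" "0 < \<tau>" "\<tau> \<le> 1 / 4"
  defines "x \<equiv> shishkin_mesh \<sigma> \<epsilon> (4 * n)"
  shows "is_mesh (4 * n) x" "x n = \<tau>"
    and "\<And>i. i < n \<Longrightarrow> x (Suc i) - x i = \<tau> / n"
    and "\<And>i. i < 4 * n \<Longrightarrow> x (Suc i) - x i \<le> 1 / (2 * n)"
    and "\<And>i. i \<le> 4 * n \<Longrightarrow> x (4 * n - i) = 1 - x i"
proof -
  define d where "d = (1 - 2 * \<tau>) / (2 * n)"
  define q where "q = \<tau> / n"
  have nq: "\<tau> = n * q" using n by (simp add: q_def)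
  note c = shishkin_mesh_cases[OF n \<tau>(1), folded x_def d_def q_def]
  have s1: "x (Suc i) - x i = q" if "i < n" for i
    using that c(1)[of i] c(1)[of "Suc i"] by (simp add: algebra_simps)
  have s2: "x (Suc i) - x i = d" if "n \<le> i" "i < 3 * n" for i
    using that c(2)[of i] c(2)[of "Suc i"] by (simp add: algebra_simps)
  have s3: "x (Suc i) - x i = q" if "3 * n \<le> i" for i
    using that c(3)[of i] c(3)[of "Suc i"] by (simp add: algebra_simps)
  show "\<And>i. i < n \<Longrightarrow> x (Suc i) - x i = \<tau> / n" using s1 by (simp add: q_def)
  have steps: "x (Suc i) - x i = q \<or> x (Suc i) - x i = d" for i
    using s1[of i] s2[of i] s3[of i] by linarith
  have pos: "0 < q" "0 < d" unfolding d_def q_def using n \<tau> by auto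
  show "\<And>i. i < 4 * n \<Longrightarrow> x (Suc i) - x i \<le> 1 / (2 * n)"
  proof -
    fix i
    have "q \<le> 1 / (2 * n)" "d \<le> 1 / (2 * n)"
      unfolding d_def q_def using n \<tau> by (simp_all add: divide_simps)
    then show "x (Suc i) - x i \<le> 1 / (2 * n)" using steps[of i] by argo
  qed
  have "x i < x (Suc i)" for i using steps[of i] pos by argo
  moreover have "x 0 = 0" using c(1)[of 0] by simp
  moreover have "x (4 * n) = 1" using c(3)[of "4 * n"] nq by simp
  ultimately show "is_mesh (4 * n) x" by (simp add: is_mesh_def)
  show "x n = \<tau>" using c(1)[of n] nq by simp
  show "x (4 * n - i) = 1 - x i" if i: "i \<le> 4 * n" for i
  proof -
    consider "i \<le> n" | "n \<le> i" "i \<le> 3 * n" | "3 * n \<le> i" by linarith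
    then show ?thesis
    proof cases
      case 1
      then show ?thesis using c(1)[of i] c(3)[of "4 * n - i"] nq by (simp add: of_nat_diff algebra_simps)
    next
      case 2
      have "2 * n * d = 1 - 2 * \<tau>" using n by (simp add: d_def)
      moreover have "n \<le> 4 * n - i" "4 * n - i \<le> 3 * n" using 2 by auto
      ultimately show ?thesis using 2 c(2)[of i] c(2)[of "4 * n - i"] by (simp add: of_nat_diff algebra_simps)
    next
      case 3
      moreover from this have "4 * n - i \<le> n" by simp
      ultimately show ?thesis using i c(3)[of i] c(1)[of "4 * n - i"] nq by (simp add: of_nat_diff algebra_simps)
    qed
  qed
qed

lemma layer_tail_continuous: "continuous_on S (layer_tail \<epsilon> \<tau>)"
proof -
  have "layer_tail \<epsilon> \<tau> = (\<lambda>t. exp (- max 0 (t - \<tau>) / \<epsilon>))" by (auto simp: layer_tail_def)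
  then show ?thesis by (simp add: divide_inverse) (intro continuous_intros)
qed

lemma layer_tail_sq_integral:
  assumes "0 < \<epsilon>" "0 \<le> \<tau>" "\<tau> \<le> 1"
  shows "(LINT t|Omega_measure. (layer_tail \<epsilon> \<tau> t)\<^sup>2) \<le> \<tau> + \<epsilon>"
proof -
  \<comment> \<open>An antiderivative of the squared tail; it is continuous and differentiable except at \<open>\<tau>\<close>.\<close>
  define F where "F t = min t \<tau> + \<epsilon> / 2 * (1 - exp (- (2 / \<epsilon>) * max 0 (t - \<tau>)))" for t
  have "((\<lambda>t. (layer_tail \<epsilon> \<tau> t)\<^sup>2) has_integral F 1 - F 0) {0..1}"
  proof (rule fundamental_theorem_of_calculus_interior_strong[of "{\<tau>}"])
    show "continuous_on {0..1} F" unfolding F_def by (intro continuous_intros)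
    fix t assume t: "t \<in> {0<..<1} - {\<tau>}"
    have "(F has_real_derivative (layer_tail \<epsilon> \<tau> t)\<^sup>2) (at t)"
    proof (cases "t < \<tau>")
      case True
      have "((\<lambda>t. t) has_real_derivative 1) (at t)" by simp
      then have "(F has_real_derivative 1) (at t)"
        by (rule has_field_derivative_transform_within_open[of _ _ _ "{..<\<tau>}"])
           (use True in \<open>auto simp: F_def\<close>)
      then show ?thesis using True by (simp add: layer_tail_def)
    next
      case False
      have "((\<lambda>t. \<tau> + \<epsilon> / 2 * (1 - exp (- (2 / \<epsilon>) * (t - \<tau>)))) has_real_derivative
          exp (- (2 / \<epsilon>) * (t - \<tau>))) (at t)"
        using assms by (auto intro!: derivative_eq_intros simp: field_simps)
      then have "(F has_real_derivative exp (- (2 / \<epsilon>) * (t - \<tau>))) (at t)"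
        by (rule has_field_derivative_transform_within_open[of _ _ _ "{\<tau><..}"])
           (use False t in \<open>auto simp: F_def\<close>)
      moreover have "(layer_tail \<epsilon> \<tau> t)\<^sup>2 = exp (- (2 / \<epsilon>) * (t - \<tau>))"
      proof -
        have "(layer_tail \<epsilon> \<tau> t)\<^sup>2 = exp (2 * (- (t - \<tau>) / \<epsilon>))"
          unfolding exp_double using False by (simp add: layer_tail_def)
        also have "2 * (- (t - \<tau>) / \<epsilon>) = - (2 / \<epsilon>) * (t - \<tau>)"
          by (simp add: divide_inverse algebra_simps)
        finally show ?thesis .
      qed
      ultimately show ?thesis by simp
    qed
    then show "(F has_vector_derivative (layer_tail \<epsilon> \<tau> t)\<^sup>2) (at t)"
      by (simp add: has_real_derivative_iff_has_vector_derivative)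
  qed auto
  then have "(LINT t|Omega_measure. (layer_tail \<epsilon> \<tau> t)\<^sup>2) = F 1 - F 0"
    by (intro integral_Omega_of_has_integral bm_intros bm_continuous layer_tail_continuous)
  also have "\<dots> \<le> \<tau> + \<epsilon>"
  proof -
    have "F 0 = 0" using assms by (simp add: F_def)
    moreover have "F 1 \<le> \<tau> + \<epsilon> / 2 * 1"
      unfolding F_def using assms by (intro add_mono mult_left_mono) auto
    ultimately show ?thesis using assms by simp
  qed
  finally show ?thesis .
qed

lemma layer_envelope_continuous: "continuous_on S (layer_envelope \<epsilon> \<tau> \<theta>)"
  unfolding layer_envelope_def by (intro continuous_intros layer_tail_continuous)

lemma three_squares: "(a + b + c)\<^sup>2 \<le> 3 * a\<^sup>2 + 3 * b\<^sup>2 + 3 * (c::real)\<^sup>2"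
proof -
  have "0 \<le> (a - b)\<^sup>2 + (b - c)\<^sup>2 + (a - c)\<^sup>2" by simp
  then show ?thesis by (simp add: power2_eq_square algebra_simps)
qed

lemma layer_envelope_sq_integral:
  assumes "0 < \<epsilon>" "0 \<le> \<tau>" "\<tau> \<le> 1"
  shows "(LINT t|Omega_measure. (layer_envelope \<epsilon> \<tau> \<theta> t)\<^sup>2) \<le>
    3 * \<theta>\<^sup>2 * \<epsilon> + 3 * (6 * (1 + \<tau> / \<epsilon>) * exp (- \<tau> / \<epsilon>))\<^sup>2 * (\<tau> + \<epsilon>) + 3 * (12 * exp (- 1 / \<epsilon>) / \<epsilon>)\<^sup>2"
proof -
  let ?c = "6 * (1 + \<tau> / \<epsilon>) * exp (- \<tau> / \<epsilon>)" and ?d = "12 * exp (- 1 / \<epsilon>) / \<epsilon>"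
  note bm = bm_continuous[OF layer_tail_continuous] bm_continuous[OF layer_envelope_continuous]
  have "(LINT t|Omega_measure. (layer_envelope \<epsilon> \<tau> \<theta> t)\<^sup>2) \<le>
     (LINT t|Omega_measure. 3 * \<theta>\<^sup>2 * (layer_tail \<epsilon> 0 t)\<^sup>2 + 3 * ?c\<^sup>2 * (layer_tail \<epsilon> \<tau> t)\<^sup>2 + 3 * ?d\<^sup>2)"
    using three_squares[of "\<theta> * layer_tail \<epsilon> 0 _" "?c * layer_tail \<epsilon> \<tau> _" ?d]
    by (intro Omega_integral_mono bm_intros bm) (simp only: layer_envelope_def power_mult_distrib mult.assoc)
  also have "\<dots> = 3 * \<theta>\<^sup>2 * (LINT t|Omega_measure. (layer_tail \<epsilon> 0 t)\<^sup>2)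
      + 3 * ?c\<^sup>2 * (LINT t|Omega_measure. (layer_tail \<epsilon> \<tau> t)\<^sup>2) + (LINT t|Omega_measure. 3 * ?d\<^sup>2)"
    by (subst Omega_integral_add, (intro bm_intros bm)+, subst Omega_integral_add, (intro bm_intros bm)+)
       (simp only: integral_mult_right_zero)
  also have "(LINT t|Omega_measure. 3 * ?d\<^sup>2) = 3 * ?d\<^sup>2"
    by (simp add: measure_restrict_space)
  also have "3 * \<theta>\<^sup>2 * (LINT t|Omega_measure. (layer_tail \<epsilon> 0 t)\<^sup>2)
      + 3 * ?c\<^sup>2 * (LINT t|Omega_measure. (layer_tail \<epsilon> \<tau> t)\<^sup>2) + 3 * ?d\<^sup>2 \<le>
      3 * \<theta>\<^sup>2 * (0 + \<epsilon>) + 3 * ?c\<^sup>2 * (\<tau> + \<epsilon>) + 3 * ?d\<^sup>2"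
    using assms by (intro add_mono mult_left_mono layer_tail_sq_integral order_refl) auto
  finally show ?thesis by simp
qed

definition theta_const :: "nat \<Rightarrow> real \<Rightarrow> real" where
  "theta_const p \<sigma> = 13 * exp (4 * \<sigma>) * (4 * \<sigma>) ^ (p + 1)"

definition envelope_const :: "nat \<Rightarrow> real \<Rightarrow> real" where
  "envelope_const p \<sigma> = 3 * (theta_const p \<sigma>)\<^sup>2 + 864 * \<sigma> ^ 3 + 11664"

lemma ln_N_ge_1: "N \<ge> 4 \<Longrightarrow> 1 \<le> ln (real N)"
  using exp_le by (subst ln_ge_iff) auto

text \<open>
  With \<open>\<tau> / \<epsilon> = \<sigma> ln N\<close> the cut-off contributes \<open>(ln
  N)\<^sup>3 N\<^sup>-\<^sup>2\<^sup>\<sigma>\<close>, and \<open>3 \<le> 2 (p - 1)\<close>. In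
  the boundary term, \<open>\<tau> \<le> 1/4\<close> makes half of the exponent
  \<open>1/\<epsilon>\<close> sufficient for the power of \<open>N\<close>; the rest of the
  exponential beats the negative powers of \<open>\<epsilon>\<close>.
\<close>

lemma layer_envelope_shishkin:
  assumes p: "3 \<le> p" and \<sigma>: "real p - 1 \<le> \<sigma>" and eps: "0 < \<epsilon>" "\<epsilon> \<le> 1"
    and N: "4 \<le> N" and \<tau>: "\<tau> = \<sigma> * \<epsilon> * ln (real N)" "\<tau> \<le> 1 / 4"
  defines "\<eta> \<equiv> (ln (real N) / real N) ^ (p - 1)"
  shows "(LINT t|Omega_measure. (layer_envelope \<epsilon> \<tau> (theta_const p \<sigma> * \<eta>) t)\<^sup>2) \<le>
    envelope_const p \<sigma> * \<epsilon> * \<eta>\<^sup>2"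
proof -
  define l where "l = ln (real N)"
  have l: "1 \<le> l" unfolding l_def by (rule ln_N_ge_1[OF N])
  have \<sigma>2: "2 \<le> \<sigma>" using p \<sigma> by linarith
  have L: "\<tau> / \<epsilon> = \<sigma> * l" using eps by (simp add: \<tau> l_def)
  have L1: "1 \<le> \<sigma> * l" using \<sigma>2 l by (metis mult_mono mult_1 order_trans one_le_numeral zero_le_one le_numeral_extra(1))
  have l3: "l ^ 3 \<le> (l ^ (p - 1))\<^sup>2"
  proof -
    have "l ^ 3 \<le> l ^ (2 * (p - 1))" using l p by (intro power_increasing) auto
    then show ?thesis by (simp add: power_mult[symmetric] mult.commute)
  qed
  have decay: "exp (- \<tau> / \<epsilon>) \<le> 1 / real N ^ (p - 1)"
  proof -
    have "real (p - 1) * l \<le> \<sigma> * l" using \<sigma> p l by (intro mult_right_mono) (auto simp: of_nat_diff)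
    then have "exp (- \<tau> / \<epsilon>) \<le> exp (- (real (p - 1) * l))" using L by simp
    also have "\<dots> = 1 / real N ^ (p - 1)"
    proof -
      have "exp (real (p - 1) * l) = real N ^ (p - 1)"
        using N by (simp only: exp_of_nat_mult l_def) simp
      then show ?thesis by (simp only: exp_minus inverse_eq_divide)
    qed
    finally show ?thesis .
  qed
  have eta: "\<eta> = l ^ (p - 1) / real N ^ (p - 1)" by (simp add: \<eta>_def l_def power_divide)
  have eta_ge: "1 / real N ^ (p - 1) \<le> \<eta>" unfolding eta
    using l by (intro divide_right_mono) (auto simp: one_le_power)
  have eta0: "0 \<le> \<eta>" using l by (simp add: eta)
  have T2: "(6 * (1 + \<tau> / \<epsilon>) * exp (- \<tau> / \<epsilon>))\<^sup>2 * (\<tau> + \<epsilon>) \<le> 288 * \<sigma> ^ 3 * \<epsilon> * \<eta>\<^sup>2"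
  proof -
    have te: "\<tau> + \<epsilon> = \<epsilon> * (1 + \<tau> / \<epsilon>)" using eps by (simp add: field_simps)
    have "(6 * (1 + \<tau> / \<epsilon>) * exp (- \<tau> / \<epsilon>))\<^sup>2 * (\<tau> + \<epsilon>) =
        36 * \<epsilon> * (1 + \<sigma> * l) ^ 3 * (exp (- \<tau> / \<epsilon>))\<^sup>2"
      unfolding te L by (simp only: power_mult_distrib) (simp add: power2_eq_square power3_eq_cube)
    also have "\<dots> \<le> 36 * \<epsilon> * (2 * (\<sigma> * l)) ^ 3 * (1 / real N ^ (p - 1))\<^sup>2"
      using L1 eps decay by (intro mult_mono mult_left_mono power_mono) auto
    also have "\<dots> = 288 * \<sigma> ^ 3 * \<epsilon> * (l ^ 3 * (1 / real N ^ (p - 1))\<^sup>2)"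
      by (simp add: power_mult_distrib)
    also have "\<dots> \<le> 288 * \<sigma> ^ 3 * \<epsilon> * ((l ^ (p - 1))\<^sup>2 * (1 / real N ^ (p - 1))\<^sup>2)"
      using \<sigma>2 eps l3 by (intro mult_left_mono mult_right_mono) auto
    also have "(l ^ (p - 1))\<^sup>2 * (1 / real N ^ (p - 1))\<^sup>2 = \<eta>\<^sup>2"
      unfolding eta by (simp add: power_divide)
    finally show ?thesis .
  qed
  have T3: "(12 * exp (- 1 / \<epsilon>) / \<epsilon>)\<^sup>2 \<le> 3888 * \<epsilon> * \<eta>\<^sup>2"
  proof -
    define y where "y = exp (- (1 / (2 * \<epsilon>)))"
    have "y \<le> exp (- \<tau> / \<epsilon>)"
      unfolding y_def using \<tau>(2) eps by (simp add: field_simps)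
    then have y: "0 \<le> y" "y \<le> \<eta>" using decay eta_ge by (simp add: y_def, linarith)
    \<comment> \<open>The third root of the exponential is below \<open>3 \<epsilon>\<close>, so that the full exponential provides three powers of \<open>\<epsilon>\<close>.\<close>
    define z where "z = exp (- (1 / (3 * \<epsilon>)))"
    have "1 / (3 * \<epsilon>) \<le> exp (1 / (3 * \<epsilon>))" using exp_ge_add_one_self[of "1 / (3 * \<epsilon>)"] by linarith
    then have z: "0 \<le> z" "z \<le> 3 * \<epsilon>"
      using eps by (auto simp: z_def exp_minus field_simps)
    have "(exp (- 1 / \<epsilon>))\<^sup>2 = y\<^sup>2 * z ^ 3"
    proof -
      have "y\<^sup>2 = exp (- 1 / \<epsilon>)" "z ^ 3 = exp (- 1 / \<epsilon>)"
        unfolding y_def z_def by (simp_all flip: exp_of_nat_mult)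
      then show ?thesis by (simp add: power2_eq_square)
    qed
    also have "\<dots> \<le> \<eta>\<^sup>2 * (3 * \<epsilon>) ^ 3" using y z by (intro mult_mono power_mono) auto
    finally have "144 * (exp (- 1 / \<epsilon>))\<^sup>2 / \<epsilon>\<^sup>2 \<le> 144 * (\<eta>\<^sup>2 * (3 * \<epsilon>) ^ 3) / \<epsilon>\<^sup>2"
      by (intro divide_right_mono mult_left_mono) auto
    also have "\<dots> = 3888 * \<epsilon> * \<eta>\<^sup>2"
      using eps by (simp add: power_mult_distrib power2_eq_square power3_eq_cube)
    finally show ?thesis by (simp add: power_mult_distrib power_divide)
  qed
  have "(LINT t|Omega_measure. (layer_envelope \<epsilon> \<tau> (theta_const p \<sigma> * \<eta>) t)\<^sup>2) \<le>
    3 * (theta_const p \<sigma> * \<eta>)\<^sup>2 * \<epsilon> + 3 * (6 * (1 + \<tau> / \<epsilon>) * exp (- \<tau> / \<epsilon>))\<^sup>2 * (\<tau> + \<epsilon>)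
      + 3 * (12 * exp (- 1 / \<epsilon>) / \<epsilon>)\<^sup>2"
    using \<sigma>2 eps l \<tau> by (intro layer_envelope_sq_integral) (auto simp: l_def)
  also have "\<dots> \<le> 3 * (theta_const p \<sigma> * \<eta>)\<^sup>2 * \<epsilon> + 3 * (288 * \<sigma> ^ 3 * \<epsilon> * \<eta>\<^sup>2) + 3 * (3888 * \<epsilon> * \<eta>\<^sup>2)"
    using T2 T3 by simp
  also have "\<dots> = envelope_const p \<sigma> * \<epsilon> * \<eta>\<^sup>2"
    by (simp add: envelope_const_def power_mult_distrib algebra_simps)
  finally show ?thesis .
qed

lemma Omega_integral_reflect:
  fixes f :: "real \<Rightarrow> real"
  assumes "continuous_on {0..1} f"
  shows "(LINT t|Omega_measure. f (1 - t)) = (LINT t|Omega_measure. f t)"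
proof -
  have "((\<lambda>t. f ((-1) * t + 1)) has_integral (1 / \<bar>-1\<bar> ^ DIM(real)) *\<^sub>R integral {0..1} f)
      ((\<lambda>t. (1 / (-1)) *\<^sub>R t + - ((1 / (-1)) *\<^sub>R 1)) ` cbox 0 1)"
    using has_integral_affinity[of f "integral {0..1} f" 0 1 "-1" 1]
      integrable_integral[OF integrable_continuous_real[OF assms]] by simp
  moreover have "(\<lambda>t. (1 / (-1)) *\<^sub>R t + - ((1 / (-1)) *\<^sub>R 1)) ` cbox 0 (1::real) = {0..1}"
    using image_affinity_atLeastAtMost[of "-1" 1 0 "1::real"] by simp
  ultimately have "((\<lambda>t. f (1 - t)) has_integral integral {0..1} f) {0..1}" by simp
  moreover have "continuous_on {0..1} (\<lambda>t. f (1 - t))"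
    by (rule continuous_on_compose2[OF assms]) (auto intro!: continuous_intros)
  ultimately show ?thesis
    using integral_Omega_of_has_integral bm_continuous integral_Omega_eq assms by metis
qed

text \<open>
  An exceptional set \<open>S\<close> is allowed since second derivatives of splines are undefined
  at the nodes. The term \<open>b (1 - t)\<close> is the bound for the layer at the other end.
\<close>

lemma sq_integral_of_envelope_bound:
  assumes e: "bounded_measurable e" and S: "finite S"
    and b: "continuous_on {0..1} b" "(LINT t|Omega_measure. (b t)\<^sup>2) \<le> B"
    and bound: "\<And>t. t \<in> Omega - S \<Longrightarrow> \<bar>e t\<bar> \<le> A + c * b t + c * b (1 - t)"
  shows "(LINT t|Omega_measure. (e t)\<^sup>2) \<le> 3 * A\<^sup>2 + 6 * c\<^sup>2 * B"
proof -
  have b': "continuous_on {0..1} (\<lambda>t. b (1 - t))"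
    by (rule continuous_on_compose2[OF b(1)]) (auto intro!: continuous_intros)
  note bm = bm_continuous[OF b(1)] bm_continuous[OF b']
  have "(LINT t|Omega_measure. (e t)\<^sup>2) \<le>
     (LINT t|Omega_measure. 3 * A\<^sup>2 + 3 * c\<^sup>2 * (b t)\<^sup>2 + 3 * c\<^sup>2 * (b (1 - t))\<^sup>2)"
  proof (rule integral_mono_AE)
    have "S \<in> null_sets lebesgue"
      using negligible_finite[OF S] by (simp only: negligible_iff_null_sets)
    then have "AE t in lebesgue. t \<notin> S" by (rule AE_not_in)
    then have "AE t in Omega_measure. t \<notin> S" by (subst AE_restrict_space_iff) (auto elim: eventually_mono)
    moreover have "AE t in Omega_measure. t \<in> Omega" using AE_space[of Omega_measure] by simp
    ultimately show "AE t in Omega_measure. (e t)\<^sup>2 \<le> 3 * A\<^sup>2 + 3 * c\<^sup>2 * (b t)\<^sup>2 + 3 * c\<^sup>2 * (b (1 - t))\<^sup>2"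
    proof eventually_elim
      case (elim t)
      have "(e t)\<^sup>2 = \<bar>e t\<bar>\<^sup>2" by simp
      also have "\<dots> \<le> (A + c * b t + c * b (1 - t))\<^sup>2" using bound[of t] elim by (intro power_mono) auto
      also have "\<dots> \<le> 3 * A\<^sup>2 + 3 * (c * b t)\<^sup>2 + 3 * (c * b (1 - t))\<^sup>2" by (rule three_squares)
      finally show ?case by (simp add: power_mult_distrib)
    qed
  qed (intro bm_integrable bm_intros bm e)+
  also have "\<dots> = (LINT t|Omega_measure. 3 * A\<^sup>2) + 3 * c\<^sup>2 * (LINT t|Omega_measure. (b t)\<^sup>2)
      + 3 * c\<^sup>2 * (LINT t|Omega_measure. (b (1 - t))\<^sup>2)"
    by (subst Omega_integral_add, (intro bm_intros bm)+, subst Omega_integral_add, (intro bm_intros bm)+)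
       (simp only: integral_mult_right_zero)
  also have "(LINT t|Omega_measure. (b (1 - t))\<^sup>2) = (LINT t|Omega_measure. (b t)\<^sup>2)"
    by (rule Omega_integral_reflect[of "\<lambda>t. (b t)\<^sup>2"]) (intro continuous_intros b)
  also have "(LINT t|Omega_measure. 3 * A\<^sup>2) = 3 * A\<^sup>2"
    by (simp add: measure_restrict_space)
  also have "3 * A\<^sup>2 + 3 * c\<^sup>2 * (LINT t|Omega_measure. (b t)\<^sup>2) + 3 * c\<^sup>2 * (LINT t|Omega_measure. (b t)\<^sup>2)
      \<le> 3 * A\<^sup>2 + 3 * c\<^sup>2 * B + 3 * c\<^sup>2 * B"
    using b(2) by (intro add_mono mult_left_mono order_refl) auto
  finally show ?thesis by (simp add: mult_ac)
qed

section \<open>Approximation of functions with two layers\<close>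

lemma deriv_family_continuous: "deriv_family K D \<Longrightarrow> k < K \<Longrightarrow> continuous_on {0..1} (D k)"
  by (auto simp: deriv_family_def intro!: DERIV_continuous_on)

lemma deriv_family_add:
  "deriv_family K D \<Longrightarrow> deriv_family K E \<Longrightarrow> deriv_family K (\<lambda>k t. D k t + E k t)"
  by (auto simp: deriv_family_def intro!: DERIV_add)

lemma deriv_family_mono: "deriv_family K D \<Longrightarrow> J \<le> K \<Longrightarrow> deriv_family J D"
  by (auto simp: deriv_family_def)

lemma deriv_family_shift_cmult:
  "deriv_family (K + m) D \<Longrightarrow> deriv_family K (\<lambda>k t. c * D (k + m) t)"
  by (auto simp: deriv_family_def intro!: DERIV_cmult)

lemma deriv_family_reflect:
  assumes "deriv_family K D"
  shows "deriv_family K (\<lambda>k t. (-1) ^ k * D k (1 - t))"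
  unfolding deriv_family_def
proof (intro allI ballI impI)
  fix k t assume k: "k < K" and t: "t \<in> {0..1::real}"
  have "(D k has_real_derivative D (Suc k) (1 - t)) (at (1 - t) within (\<lambda>t. 1 - t) ` {0..1})"
    using assms k t by (auto simp: deriv_family_def)
  then have "((D k \<circ> (\<lambda>t. 1 - t)) has_real_derivative D (Suc k) (1 - t) * (- 1)) (at t within {0..1})"
    by (rule DERIV_image_chain) (auto intro!: derivative_eq_intros)
  then have "((\<lambda>t. (-1) ^ k * D k (1 - t)) has_real_derivative (-1) ^ k * (D (Suc k) (1 - t) * (- 1))) (at t within {0..1})"
    unfolding comp_def by (rule DERIV_cmult)
  then show "((\<lambda>t. (-1) ^ k * D k (1 - t)) has_real_derivative (-1) ^ Suc k * D (Suc k) (1 - t)) (at t within {0..1})"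
    by simp
qed

lemma C_space_deriv_family: "g \<in> C_space K \<Longrightarrow> deriv_family K (\<lambda>k. (deriv01 ^^ k) g)"
proof -
  assume g: "g \<in> C_space K"
  have "((deriv01 ^^ k) g has_real_derivative deriv01 ((deriv01 ^^ k) g) t) (at t within {0..1})"
    if "k < K" "t \<in> {0..1}" for k t
  proof -
    have "(deriv01 ^^ k) g differentiable (at t within {0..1})"
      using g that by (auto simp: C_space_def differentiable_on_def)
    then show ?thesis
      unfolding deriv01_def has_real_derivative_iff_has_vector_derivative vector_derivative_works .
  qed
  then show ?thesis by (simp add: deriv_family_def)
qed

lemma deriv_family_piecewise_C2:
  assumes D: "deriv_family K D" "3 \<le> K" and w: "\<And>t. t \<in> {0..1} \<Longrightarrow> w t = D 0 t"
  shows "piecewise_C2 w (D 1) (D 2)"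
proof -
  have d: "(D k has_real_derivative D (Suc k) t) (at t within {0..1})" if "k < 3" "t \<in> {0..1}" for k t
    using D that by (auto simp: deriv_family_def)
  have "(w has_real_derivative D 1 t) (at t within {0..1})" if "t \<in> {0..1}" for t
    using has_field_derivative_transform_within[OF d[of 0 t], of 1 w] w that by simp
  moreover have "(D 1 has_real_derivative D 2 t) (at t)" if "t \<in> Omega" for t
    using DERIV_subset[OF d[of 1 t], of Omega] at_within_open[of t Omega] that
    by (simp add: numeral_2_eq_2) force
  moreover have "continuous_on {0..1} (D 1)" "bounded_measurable (D 2)"
    using D by (auto intro!: bm_continuous deriv_family_continuous)
  ultimately show ?thesis
    unfolding piecewise_C2_def by (intro conjI ballI exI[of _ "{}"]) auto
qed

text \<open>
  The first summand comes from the regular part, where cells are no wider than \<open>2/N\<close>,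
  and the second one from the two layers.
\<close>

definition approx_const :: "nat \<Rightarrow> real \<Rightarrow> real" where
  "approx_const p \<sigma> = 3 * (13 * 2 ^ (p + 1))\<^sup>2 + 6 * envelope_const p \<sigma>"

lemma approx_const_bound:
  assumes "0 \<le> \<sigma>" "0 \<le> m" "c * \<epsilon> = m"
  shows "3 * (13 * 2 ^ (p + 1) * M * \<eta>)\<^sup>2 + 6 * c * (envelope_const p \<sigma> * \<epsilon> * \<eta>\<^sup>2)
    \<le> approx_const p \<sigma> * (M\<^sup>2 + m) * \<eta>\<^sup>2"
proof -
  let ?a = "3 * (13 * 2 ^ (p + 1))\<^sup>2 :: real" and ?b = "6 * envelope_const p \<sigma>"
  have ab: "0 \<le> ?a" "0 \<le> ?b" using assms by (simp_all add: envelope_const_def)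
  have "3 * (13 * 2 ^ (p + 1) * M * \<eta>)\<^sup>2 + 6 * c * (envelope_const p \<sigma> * \<epsilon> * \<eta>\<^sup>2)
      = (?a * M\<^sup>2 + ?b * m) * \<eta>\<^sup>2"
    unfolding assms(3)[symmetric] by (simp add: power_mult_distrib algebra_simps)
  also have "\<dots> \<le> ((?a + ?b) * (M\<^sup>2 + m)) * \<eta>\<^sup>2"
  proof (rule mult_right_mono)
    have "0 \<le> ?a * m" "0 \<le> ?b * M\<^sup>2" using ab assms(2) by (auto intro: mult_nonneg_nonneg)
    then show "?a * M\<^sup>2 + ?b * m \<le> (?a + ?b) * (M\<^sup>2 + m)" by (simp add: distrib_left distrib_right)
  qed simp
  finally show ?thesis by (simp add: approx_const_def)
qed

text \<open>
  The amplitude \<open>Ml\<close> of the layers enters with the factor \<open>\<epsilon>\<close>,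
  the square of the \<open>L\<^sub>2\<close> norm of the exponential, and the second derivative
  costs \<open>\<epsilon>\<^sup>-\<^sup>2\<close>, hence \<open>\<epsilon>\<^sup>-\<^sup>3\<close>
  in the square. Both scalings in which the lemma is used turn these weights into constants.
\<close>

lemma layered_function_approx:
  assumes p: "3 \<le> p" and \<sigma>: "real p - 1 \<le> \<sigma>" and eps: "0 < \<epsilon>" "\<epsilon> \<le> 1"
    and N: "4 \<le> N" "4 dvd N" and \<tau>: "\<sigma> * \<epsilon> * ln (real N) \<le> 1 / 4"
    and fam: "deriv_family (p + 1) R" "deriv_family (p + 1) L" "deriv_family (p + 1) L'"
    and R: "\<And>t. t \<in> {0..1} \<Longrightarrow> \<bar>R (Suc p) t\<bar> \<le> M"
    and L: "\<And>k t. k \<le> p + 1 \<Longrightarrow> t \<in> {0..1} \<Longrightarrow> \<bar>L k t\<bar> \<le> Ml / \<epsilon> ^ k * exp (- t / \<epsilon>)"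
    and L': "\<And>k t. k \<le> p + 1 \<Longrightarrow> t \<in> {0..1} \<Longrightarrow> \<bar>L' k t\<bar> \<le> Ml / \<epsilon> ^ k * exp (- (1 - t) / \<epsilon>)"
    and G_def: "G = (\<lambda>k t. R k t + L k t + L' k t)"
  defines "\<eta> \<equiv> (ln (real N) / real N) ^ (p - 1)"
    and "x \<equiv> shishkin_mesh \<sigma> \<epsilon> N"
  obtains s s1 s2 where "s \<in> spline_space p N x" "piecewise_C2 s s1 s2"
    "\<And>\<xi>. \<xi> \<in> {0, 1} \<Longrightarrow> s \<xi> = G 0 \<xi> \<and> s1 \<xi> = G 1 \<xi>"
    "(LINT t|Omega_measure. (G 0 t - s t)\<^sup>2) \<le> approx_const p \<sigma> * (M\<^sup>2 + \<epsilon> * Ml\<^sup>2) * \<eta>\<^sup>2"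
    "(LINT t|Omega_measure. (G 2 t - s2 t)\<^sup>2) \<le> approx_const p \<sigma> * (M\<^sup>2 + Ml\<^sup>2 / \<epsilon> ^ 3) * \<eta>\<^sup>2"
proof -
  obtain n where n: "N = 4 * n" "0 < n" using N by (auto elim!: dvdE)
  define T where "T = shishkin_tau \<sigma> \<epsilon> N"
  define l where "l = ln (real N)"
  have l1: "1 \<le> l" unfolding l_def by (rule ln_N_ge_1[OF N(1)])
  have lN: "l \<le> real N" unfolding l_def using N by (intro ln_bound) auto
  have \<sigma>2: "2 \<le> \<sigma>" using p \<sigma> by linarith
  have Tl: "T = \<sigma> * \<epsilon> * l" by (simp add: T_def l_def shishkin_tau_def)
  have L1: "1 \<le> \<sigma> * l" using mult_mono[of 1 \<sigma> 1 l] \<sigma>2 l1 by simp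
  have T: "\<epsilon> \<le> T" "0 < T" "T \<le> 1 / 4"
  proof -
    have "\<epsilon> * 1 \<le> \<epsilon> * (\<sigma> * l)" using L1 eps by (intro mult_left_mono) auto
    then show "\<epsilon> \<le> T" by (simp add: Tl mult_ac)
    then show "0 < T" using eps by simp
    show "T \<le> 1 / 4" using \<tau> by (simp add: Tl l_def)
  qed
  have "T = shishkin_tau \<sigma> \<epsilon> (4 * n)" by (simp add: T_def n)
  note mf = shishkin_mesh_facts[OF n(2) this T(2,3), folded n(1), folded x_def]
  note mesh = mf(1)
  define \<delta> where "\<delta> = l / real N"
  have \<delta>: "0 \<le> \<delta>" "\<delta> \<le> 1" using l1 lN N by (auto simp: \<delta>_def)
  have eta: "\<eta> = \<delta> ^ (p - 1)" by (simp add: \<eta>_def \<delta>_def l_def)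
  have eta0: "0 \<le> \<eta>" using \<delta> by (simp add: eta)
  have M0: "0 \<le> M" using R[of 0] by simp
  have Ml0: "0 \<le> Ml" using L[of 0 0] by simp
  define \<rho> where "\<rho> = 4 * \<sigma> * \<delta>"
  have step: "x (Suc i) - x i \<le> \<rho> * \<epsilon>" if "i < n" for i
  proof -
    have "x (Suc i) - x i = T / n" by (rule mf(3)[OF that])
    also have "\<dots> = \<rho> * \<epsilon>" using n by (simp add: \<rho>_def \<delta>_def Tl field_simps)
    finally show ?thesis by simp
  qed
  have rho_pow: "13 * exp \<rho> * \<rho> ^ m \<le> theta_const p \<sigma> * \<eta>" if m: "p - 1 \<le> m" "m \<le> p + 1" for m
  proof -
    have "\<rho> \<le> 4 * \<sigma>" using \<delta> \<sigma>2 by (simp add: \<rho>_def mult_left_le)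
    moreover have "\<rho> ^ m \<le> (4 * \<sigma>) ^ (p + 1) * \<delta> ^ (p - 1)"
    proof -
      have "\<rho> ^ m = (4 * \<sigma>) ^ m * \<delta> ^ m" by (simp add: \<rho>_def power_mult_distrib)
      also have "\<dots> \<le> (4 * \<sigma>) ^ (p + 1) * \<delta> ^ (p - 1)"
        using \<delta> \<sigma>2 m by (intro mult_mono power_increasing power_decreasing) auto
      finally show ?thesis .
    qed
    ultimately have "13 * exp \<rho> * \<rho> ^ m \<le> 13 * exp (4 * \<sigma>) * ((4 * \<sigma>) ^ (p + 1) * \<delta> ^ (p - 1))"
      using \<sigma>2 \<delta> by (intro mult_mono) (auto simp: \<rho>_def)
    then show ?thesis by (simp add: theta_const_def eta mult_ac)
  qed
  let ?env = "layer_envelope \<epsilon> T (theta_const p \<sigma> * \<eta>)"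
  obtain QR where QR: "spline_approx p N x R (\<lambda>t. 13 * M * (2 / real N) ^ (p + 1)) (\<lambda>t. 13 * M * (2 / real N) ^ (p - 1)) QR"
  proof -
    have "x (Suc i) - x i \<le> 2 / real N" if "i < N" for i
      using mf(4)[of i] that n by simp
    then show ?thesis using regular_part_approx[OF mesh _ p fam(1) R] that by blast
  qed
  have layer: "\<exists>Q. spline_approx p N x D (\<lambda>t. Ml * ?env t) (\<lambda>t. Ml / \<epsilon>\<^sup>2 * ?env t) Q"
    if "deriv_family (p + 1) D"
      "\<And>k t. k \<le> p + 1 \<Longrightarrow> t \<in> {0..1} \<Longrightarrow> \<bar>D k t\<bar> \<le> Ml / \<epsilon> ^ k * exp (- t / \<epsilon>)" for D
    using T eps n mf(2) rho_pow[of "p + 1"] rho_pow[of "p - 1"]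
    by (intro layer_part_approx[OF mesh p that(1) _ _ _ that(2), where n = n and \<rho> = \<rho>])
       (auto intro: step)
  obtain QL where QL: "spline_approx p N x L (\<lambda>t. Ml * ?env t) (\<lambda>t. Ml / \<epsilon>\<^sup>2 * ?env t) QL"
    using layer[OF fam(2) L] by blast
  have "\<bar>(-1) ^ k * L' k (1 - t)\<bar> \<le> Ml / \<epsilon> ^ k * exp (- t / \<epsilon>)" if "k \<le> p + 1" "t \<in> {0..1}" for k t
    using L'[of k "1 - t"] that by (simp add: abs_mult power_abs)
  then obtain Q' where "spline_approx p N x (\<lambda>k t. (-1) ^ k * L' k (1 - t)) (\<lambda>t. Ml * ?env t) (\<lambda>t. Ml / \<epsilon>\<^sup>2 * ?env t) Q'"
    using layer[OF deriv_family_reflect[OF fam(3)]] by blast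
  from spline_approx_reflect[OF mesh _ this] mf(5)[folded n(1)] obtain QL' where
    QL': "spline_approx p N x L' (\<lambda>t. Ml * ?env (1 - t)) (\<lambda>t. Ml / \<epsilon>\<^sup>2 * ?env (1 - t)) QL'"
    using n(1) by blast
  define Q where "Q i = QR i + QL i + QL' i" for i
  have app: "spline_approx p N x G
      (\<lambda>t. 13 * M * (2 / real N) ^ (p + 1) + Ml * ?env t + Ml * ?env (1 - t))
      (\<lambda>t. 13 * M * (2 / real N) ^ (p - 1) + Ml / \<epsilon>\<^sup>2 * ?env t + Ml / \<epsilon>\<^sup>2 * ?env (1 - t)) Q"
    using spline_approx_add[OF spline_approx_add[OF QR QL] QL'] by (simp add: G_def Q_def[abs_def])
  obtain s s1 where s: "s \<in> spline_space p N x"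
    "piecewise_C2 s s1 (piecewise_poly N x (\<lambda>i. pderiv (pderiv (Q i))))"
    "\<And>i t. i < N \<Longrightarrow> t \<in> {x i..x (Suc i)} \<Longrightarrow> s t = poly (Q i) t \<and> s1 t = poly (pderiv (Q i)) t"
    using glue_C1_pieces[OF mesh, of p Q] app unfolding spline_approx_def by metis
  define s2 where "s2 = piecewise_poly N x (\<lambda>i. pderiv (pderiv (Q i)))"
  note pw = s(2)[folded s2_def]
  have ends: "s \<xi> = G 0 \<xi> \<and> s1 \<xi> = G 1 \<xi>" if "\<xi> \<in> {0, 1}" for \<xi>
  proof -
    have N0: "0 < N" "x 0 = 0" "x N = 1" using is_mesh_pos[OF mesh] mesh by (auto simp: is_mesh_def)
    have "0 \<in> {x 0..x (Suc 0)}" "1 \<in> {x (N - 1)..x (Suc (N - 1))}"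
      using N0 is_mesh_le[OF mesh, of 0 "Suc 0"] is_mesh_le[OF mesh, of "N - 1" N] by auto
    then show ?thesis
      using that s(3)[of 0 0] s(3)[of "N - 1" 1] app N0 unfolding spline_approx_def by auto
  qed
  have reg: "13 * M * (2 / real N) ^ m \<le> 13 * 2 ^ (p + 1) * M * \<eta>" if "p - 1 \<le> m" "m \<le> p + 1" for m
  proof -
    have "(2 / real N) ^ m = 2 ^ m * (1 / real N) ^ m" by (simp add: power_divide)
    also have "\<dots> \<le> 2 ^ (p + 1) * (1 / real N) ^ (p - 1)"
      using that N by (intro mult_mono power_increasing power_decreasing) auto
    also have "\<dots> \<le> 2 ^ (p + 1) * \<delta> ^ (p - 1)"
      using l1 by (intro mult_left_mono power_mono) (auto simp: \<delta>_def divide_right_mono)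
    finally have "13 * M * (2 / real N) ^ m \<le> 13 * M * (2 ^ (p + 1) * \<delta> ^ (p - 1))"
      using M0 by (intro mult_left_mono) auto
    then show ?thesis by (simp add: eta mult_ac)
  qed
  have env: "continuous_on {0..1} ?env"
    "(LINT t|Omega_measure. (?env t)\<^sup>2) \<le> envelope_const p \<sigma> * \<epsilon> * \<eta>\<^sup>2"
    using layer_envelope_shishkin[OF p \<sigma> eps N(1), of T] T
    by (auto simp: layer_envelope_continuous Tl l_def \<eta>_def)
  have famG: "deriv_family (p + 1) G" unfolding G_def by (intro deriv_family_add fam)
  note bG = bm_continuous[OF deriv_family_continuous[OF famG]]
  have "(LINT t|Omega_measure. (G 0 t - s t)\<^sup>2) \<le>
      3 * (13 * 2 ^ (p + 1) * M * \<eta>)\<^sup>2 + 6 * Ml\<^sup>2 * (envelope_const p \<sigma> * \<epsilon> * \<eta>\<^sup>2)"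
  proof (rule sq_integral_of_envelope_bound[OF _ finite.emptyI env])
    show "bounded_measurable (\<lambda>t. G 0 t - s t)"
      using p by (intro bm_intros bG piecewise_C2_bm[OF pw]) auto
    fix t assume "t \<in> Omega - {}"
    then obtain i where i: "i < N" "t \<in> {x i..x (Suc i)}"
      using is_mesh_cover[OF mesh, of t] by auto
    then have "\<bar>G 0 t - s t\<bar> \<le> 13 * M * (2 / real N) ^ (p + 1) + Ml * ?env t + Ml * ?env (1 - t)"
      using app s(3)[OF i] unfolding spline_approx_def by simp
    also have "\<dots> \<le> 13 * 2 ^ (p + 1) * M * \<eta> + Ml * ?env t + Ml * ?env (1 - t)"
      using reg[of "p + 1"] by simp
    finally show "\<bar>G 0 t - s t\<bar> \<le> 13 * 2 ^ (p + 1) * M * \<eta> + Ml * ?env t + Ml * ?env (1 - t)" .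
  qed
  also have "\<dots> \<le> approx_const p \<sigma> * (M\<^sup>2 + \<epsilon> * Ml\<^sup>2) * \<eta>\<^sup>2"
    using eps \<sigma>2 by (intro approx_const_bound) auto
  finally have e0: "(LINT t|Omega_measure. (G 0 t - s t)\<^sup>2) \<le> approx_const p \<sigma> * (M\<^sup>2 + \<epsilon> * Ml\<^sup>2) * \<eta>\<^sup>2" .
  have "(LINT t|Omega_measure. (G 2 t - s2 t)\<^sup>2) \<le>
      3 * (13 * 2 ^ (p + 1) * M * \<eta>)\<^sup>2 + 6 * (Ml / \<epsilon>\<^sup>2)\<^sup>2 * (envelope_const p \<sigma> * \<epsilon> * \<eta>\<^sup>2)"
  proof (rule sq_integral_of_envelope_bound[OF _ _ env])
    show "bounded_measurable (\<lambda>t. G 2 t - s2 t)"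
      using p by (intro bm_intros bG piecewise_C2_bm[OF pw]) auto
    show "finite (x ` {..N})" by simp
    fix t assume "t \<in> Omega - x ` {..N}"
    then obtain i where i: "i < N" "t \<in> {x i<..<x (Suc i)}" by (rule off_nodes_in_cell[OF mesh])
    then have "\<bar>G 2 t - s2 t\<bar> \<le> 13 * M * (2 / real N) ^ (p - 1) + Ml / \<epsilon>\<^sup>2 * ?env t + Ml / \<epsilon>\<^sup>2 * ?env (1 - t)"
      using app piecewise_poly_cell[OF mesh i] unfolding spline_approx_def s2_def by simp
    also have "\<dots> \<le> 13 * 2 ^ (p + 1) * M * \<eta> + Ml / \<epsilon>\<^sup>2 * ?env t + Ml / \<epsilon>\<^sup>2 * ?env (1 - t)"
      using reg[of "p - 1"] by simp
    finally show "\<bar>G 2 t - s2 t\<bar> \<le> 13 * 2 ^ (p + 1) * M * \<eta> + Ml / \<epsilon>\<^sup>2 * ?env t + Ml / \<epsilon>\<^sup>2 * ?env (1 - t)" .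
  qed
  also have "\<dots> \<le> approx_const p \<sigma> * (M\<^sup>2 + Ml\<^sup>2 / \<epsilon> ^ 3) * \<eta>\<^sup>2"
    using eps \<sigma>2 by (intro approx_const_bound) (auto simp: power2_eq_square power3_eq_cube)
  finally have e2: "(LINT t|Omega_measure. (G 2 t - s2 t)\<^sup>2) \<le> approx_const p \<sigma> * (M\<^sup>2 + Ml\<^sup>2 / \<epsilon> ^ 3) * \<eta>\<^sup>2" .
  show ?thesis by (rule that[OF s(1) pw ends e0 e2])
qed

section \<open>The error estimate\<close>

lemma powr_three_halves: "0 < (\<epsilon>::real) \<Longrightarrow> \<epsilon> powr (3/2) = \<epsilon> * sqrt \<epsilon>"
proof -
  assume e: "0 < \<epsilon>"
  have "\<epsilon> powr (3/2) = \<epsilon> powr (1 + 1/2)" by simp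
  also have "\<dots> = \<epsilon> * sqrt \<epsilon>" using e by (subst powr_add) (simp add: powr_half_sqrt)
  finally show ?thesis .
qed

text \<open>
  The layers of \<open>\<epsilon>\<^sup>3\<^sup>/\<^sup>2 u''\<close> have the same shape as those
  of \<open>u\<close> with an amplitude larger by
  \<open>\<epsilon>\<^sup>-\<^sup>1\<^sup>/\<^sup>2\<close>.
\<close>

lemma layer_bound_shift:
  fixes \<epsilon> C X :: real
  assumes "0 < \<epsilon>" "\<bar>D (k + 2) t\<bar> \<le> C * (1 / \<epsilon> ^ (k + 2)) * X"
  shows "\<bar>\<epsilon> powr (3/2) * D (k + 2) t\<bar> \<le> C / sqrt \<epsilon> / \<epsilon> ^ k * X"
proof -
  have "\<bar>\<epsilon> powr (3/2) * D (k + 2) t\<bar> \<le> (\<epsilon> * sqrt \<epsilon>) * (C * (1 / \<epsilon> ^ (k + 2)) * X)"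
    unfolding abs_mult powr_three_halves[OF assms(1)] using assms by (intro mult_mono) auto
  also have "(\<epsilon> * sqrt \<epsilon>) * (C * (1 / \<epsilon> ^ (k + 2)) * X) = (\<epsilon> * sqrt \<epsilon> / \<epsilon>\<^sup>2) * (C / \<epsilon> ^ k * X)"
    using assms(1) by (simp add: power_add power2_eq_square field_simps)
  also have "\<epsilon> * sqrt \<epsilon> / \<epsilon>\<^sup>2 = 1 / sqrt \<epsilon>"
  proof -
    have "sqrt \<epsilon> * sqrt \<epsilon> = \<epsilon>" using assms(1) by simp
    then show ?thesis using assms(1) by (simp add: field_simps power2_eq_square)
  qed
  finally show ?thesis by (simp add: mult_ac)
qed

theorem theorem7:
  fixes p :: nat and \<sigma> lam C0 :: real
  assumes "p \<ge> 3" and "\<sigma> \<ge> real p - 1" and "lam \<ge> 3" and "C0 > 0"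
  shows "\<exists>C>0. \<forall>(\<epsilon>::real) (N::nat) (f::real \<Rightarrow> real) (u::real \<Rightarrow> real)
            (uh::real \<Rightarrow> real) (vh::real \<Rightarrow> real).
      0 < \<epsilon> \<and> \<epsilon> \<le> 1 \<and> N \<ge> 4 \<and> 4 dvd N \<and> \<sigma> * \<epsilon> * ln (real N) \<le> 1 / 4 \<and>
      f \<in> L2_space \<and> bvp_solution \<epsilon> f u \<and> layer_decomposition \<epsilon> f (p + 3) C0 u \<and>
      fe_solution p N (shishkin_mesh \<sigma> \<epsilon> N) lam \<epsilon> f (uh, vh)
      \<longrightarrow> balanced_norm \<epsilon> (\<lambda>x. u x - uh x, \<lambda>x. \<epsilon> powr (3/2) * weak_deriv 2 u x - vh x)
            \<le> C * (ln (real N) / real N) ^ (p - 1)"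
proof -
  define K where "K = (8 * lam\<^sup>2 + 66) * (8 * approx_const p \<sigma> * C0\<^sup>2)"
  have \<sigma>0: "0 \<le> \<sigma>" using assms by linarith
  have ac0: "0 \<le> approx_const p \<sigma>" using \<sigma>0 by (simp add: approx_const_def envelope_const_def)
  have K0: "0 \<le> K" using ac0 by (simp add: K_def)
  have main: "balanced_norm \<epsilon> (\<lambda>x. u x - uh x, \<lambda>x. \<epsilon> powr (3/2) * weak_deriv 2 u x - vh x)
      \<le> (sqrt K + 1) * (ln (real N) / real N) ^ (p - 1)"
    if eps: "0 < \<epsilon>" "\<epsilon> \<le> 1" and N: "N \<ge> 4" "4 dvd N" and \<tau>: "\<sigma> * \<epsilon> * ln (real N) \<le> 1 / 4"
      and f: "f \<in> L2_space" and bvp: "bvp_solution \<epsilon> f u"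
      and dec: "layer_decomposition \<epsilon> f (p + 3) C0 u"
      and fe: "fe_solution p N (shishkin_mesh \<sigma> \<epsilon> N) lam \<epsilon> f (uh, vh)"
    for \<epsilon> :: real and N :: nat and f u uh vh :: "real \<Rightarrow> real"
  proof -
    define k where "k = \<epsilon> powr (3/2)"
    define \<eta> where "\<eta> = (ln (real N) / real N) ^ (p - 1)"
    define x where "x = shishkin_mesh \<sigma> \<epsilon> N"
    have ln1: "1 \<le> ln (real N)" by (rule ln_N_ge_1[OF N(1)])
    have eta0: "0 \<le> \<eta>" using ln1 by (simp add: \<eta>_def)
    have k: "k = \<epsilon> * sqrt \<epsilon>" "0 < k" "k \<le> 1" "k\<^sup>2 = \<epsilon> ^ 3" "\<epsilon> powr (5/2) * k = \<epsilon> ^ 4"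
    proof -
      show ks: "k = \<epsilon> * sqrt \<epsilon>" unfolding k_def by (rule powr_three_halves[OF eps(1)])
      then show "0 < k" "k \<le> 1" using eps by (auto intro!: mult_le_one)
      show "k\<^sup>2 = \<epsilon> ^ 3" "\<epsilon> powr (5/2) * k = \<epsilon> ^ 4"
        unfolding k_def powr_identities(1,2)[OF eps(1)]
        using powr_identities(3)[OF eps(1)] by (simp_all add: power_numeral_reduce mult.assoc)
    qed
    obtain n where n: "N = 4 * n" "0 < n" using N by (auto elim!: dvdE)
    have mesh: "is_mesh N x"
    proof -
      have "2 \<le> \<sigma>" using assms by linarith
      then have "0 < shishkin_tau \<sigma> \<epsilon> (4 * n)" "shishkin_tau \<sigma> \<epsilon> (4 * n) \<le> 1 / 4"
        using eps ln1 \<tau> n by (auto simp: shishkin_tau_def)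
      from shishkin_mesh_facts(1)[OF n(2) refl this] show ?thesis by (simp add: x_def n)
    qed
    from dec obtain ur u0 u1 where mem: "ur \<in> C_space (p + 3)" "u0 \<in> C_space (p + 3)" "u1 \<in> C_space (p + 3)"
      and sum: "\<And>t. t \<in> {0..1} \<Longrightarrow> u t = u0 t + ur t + u1 t"
      and bound: "\<forall>t\<in>{0..1}. \<forall>j\<le>p + 3.
           \<bar>(deriv01 ^^ j) ur t\<bar> \<le> C0 \<and>
           \<bar>(deriv01 ^^ j) u0 t\<bar> \<le> C0 * (1 / \<epsilon> ^ j) * exp (- t / \<epsilon>) \<and>
           \<bar>(deriv01 ^^ j) u1 t\<bar> \<le> C0 * (1 / \<epsilon> ^ j) * exp (- (1 - t) / \<epsilon>)"
      and ode: "AE t in Omega_measure. \<epsilon> ^ 4 * (deriv01 ^^ 4) ur t + 4 * ur t = f t"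
        "\<forall>t\<in>Omega. \<epsilon> ^ 4 * (deriv01 ^^ 4) u0 t + 4 * u0 t = 0"
        "\<forall>t\<in>Omega. \<epsilon> ^ 4 * (deriv01 ^^ 4) u1 t + 4 * u1 t = 0"
      unfolding layer_decomposition_def by blast
    define R L L' where "R j = (deriv01 ^^ j) ur" and "L j = (deriv01 ^^ j) u0"
      and "L' j = (deriv01 ^^ j) u1" for j
    have bR: "\<bar>R j t\<bar> \<le> C0" and bL: "\<bar>L j t\<bar> \<le> C0 * (1 / \<epsilon> ^ j) * exp (- t / \<epsilon>)"
      and bL': "\<bar>L' j t\<bar> \<le> C0 * (1 / \<epsilon> ^ j) * exp (- (1 - t) / \<epsilon>)"
      if "j \<le> p + 3" "t \<in> {0..1}" for j t
      using bound that unfolding R_def L_def L'_def by blast+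
    define G where "G = (\<lambda>j t. R j t + L j t + L' j t)"
    have fam: "deriv_family (p + 3) R" "deriv_family (p + 3) L" "deriv_family (p + 3) L'"
      using mem[THEN C_space_deriv_family] by (simp_all add: R_def[abs_def] L_def[abs_def] L'_def[abs_def])
    then have famG: "deriv_family (p + 3) G" unfolding G_def by (intro deriv_family_add)
    have uG: "u t = G 0 t" if "t \<in> {0..1}" for t
      using sum[OF that] by (simp add: G_def R_def L_def L'_def)
    have u: "piecewise_C2 u (G 1) (G 2)"
      using assms(1) by (intro deriv_family_piecewise_C2[OF famG _ uG]) auto
    have v: "piecewise_C2 (\<lambda>t. k * G 2 t) (\<lambda>t. k * G 3 t) (\<lambda>t. k * G 4 t)"
    proof -
      have "deriv_family (p + 1) (\<lambda>j t. k * G (j + 2) t)"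
        using famG by (intro deriv_family_shift_cmult) (simp add: numeral_3_eq_3)
      from deriv_family_piecewise_C2[OF this, of "\<lambda>t. k * G 2 t"] assms(1)
      show ?thesis by (simp add: numeral_2_eq_2 numeral_3_eq_3 eval_nat_numeral)
    qed
    note bm = piecewise_C2_bm[OF u] piecewise_C2_bm[OF v]
    have bc: "u 0 = 0" "G 1 0 = 0" "u 1 = 0" "G 1 1 = 0"
      using bvp piecewise_C2_H20_iff[OF u] by (auto simp: bvp_solution_def)
    obtain uI uI1 uI2 where uI: "uI \<in> spline_space p N x" "piecewise_C2 uI uI1 uI2"
      "\<And>\<xi>. \<xi> \<in> {0, 1} \<Longrightarrow> uI \<xi> = G 0 \<xi> \<and> uI1 \<xi> = G 1 \<xi>"
      "(LINT t|Omega_measure. (G 0 t - uI t)\<^sup>2) \<le> approx_const p \<sigma> * (C0\<^sup>2 + \<epsilon> * C0\<^sup>2) * \<eta>\<^sup>2"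
      "(LINT t|Omega_measure. (G 2 t - uI2 t)\<^sup>2) \<le> approx_const p \<sigma> * (C0\<^sup>2 + C0\<^sup>2 / \<epsilon> ^ 3) * \<eta>\<^sup>2"
    proof (rule layered_function_approx[OF assms(1,2) eps N \<tau>, of R L L' C0 C0 G, folded \<eta>_def x_def])
      show "deriv_family (p + 1) R" "deriv_family (p + 1) L" "deriv_family (p + 1) L'"
        using fam by (auto elim: deriv_family_mono)
      fix j t assume t: "t \<in> {0..1::real}"
      show "\<bar>R (Suc p) t\<bar> \<le> C0" using t by (intro bR) auto
      assume "j \<le> p + 1"
      then show "\<bar>L j t\<bar> \<le> C0 / \<epsilon> ^ j * exp (- t / \<epsilon>)" "\<bar>L' j t\<bar> \<le> C0 / \<epsilon> ^ j * exp (- (1 - t) / \<epsilon>)"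
        using bL[of j t] bL'[of j t] t by auto
    qed (rule G_def, rule that)
    obtain vI vI1 vI2 where vI: "vI \<in> spline_space p N x" "piecewise_C2 vI vI1 vI2"
      "(LINT t|Omega_measure. (k * G 2 t - vI t)\<^sup>2) \<le> approx_const p \<sigma> * (C0\<^sup>2 + \<epsilon> * (C0 / sqrt \<epsilon>)\<^sup>2) * \<eta>\<^sup>2"
      "(LINT t|Omega_measure. (k * G 4 t - vI2 t)\<^sup>2) \<le>
         approx_const p \<sigma> * (C0\<^sup>2 + (C0 / sqrt \<epsilon>)\<^sup>2 / \<epsilon> ^ 3) * \<eta>\<^sup>2"
    proof (rule layered_function_approx[OF assms(1,2) eps N \<tau>, of "\<lambda>j t. k * R (j + 2) t"
          "\<lambda>j t. k * L (j + 2) t" "\<lambda>j t. k * L' (j + 2) t" C0 "C0 / sqrt \<epsilon>" "\<lambda>j t. k * G (j + 2) t",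
          folded \<eta>_def x_def])
      show "deriv_family (p + 1) (\<lambda>j t. k * R (j + 2) t)" "deriv_family (p + 1) (\<lambda>j t. k * L (j + 2) t)"
        "deriv_family (p + 1) (\<lambda>j t. k * L' (j + 2) t)"
        by (intro deriv_family_shift_cmult; use fam in \<open>simp add: numeral_3_eq_3\<close>)+
      fix t :: real assume t: "t \<in> {0..1}"
      have "\<bar>R (Suc p + 2) t\<bar> \<le> C0" using t by (intro bR) auto
      then show "\<bar>k * R (Suc p + 2) t\<bar> \<le> C0"
        unfolding abs_mult using k(2,3) mult_mono[of k 1 "\<bar>R (Suc p + 2) t\<bar>" C0] by simp
      fix j assume j: "j \<le> p + 1"
      show "\<bar>k * L (j + 2) t\<bar> \<le> C0 / sqrt \<epsilon> / \<epsilon> ^ j * exp (- t / \<epsilon>)"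
        unfolding k_def by (rule layer_bound_shift[OF eps(1)]) (rule bL, use t j in auto)
      show "\<bar>k * L' (j + 2) t\<bar> \<le> C0 / sqrt \<epsilon> / \<epsilon> ^ j * exp (- (1 - t) / \<epsilon>)"
        unfolding k_def by (rule layer_bound_shift[OF eps(1)]) (rule bL', use t j in auto)
    next
      show "(\<lambda>j t. k * G (j + 2) t) = (\<lambda>j t. k * R (j + 2) t + k * L (j + 2) t + k * L' (j + 2) t)"
        by (simp add: G_def distrib_left)
    next
      fix s s1 s2
      assume "s \<in> spline_space p N x" "piecewise_C2 s s1 s2"
        "(LINT t|Omega_measure. (k * G (0 + 2) t - s t)\<^sup>2) \<le> approx_const p \<sigma> * (C0\<^sup>2 + \<epsilon> * (C0 / sqrt \<epsilon>)\<^sup>2) * \<eta>\<^sup>2"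
        "(LINT t|Omega_measure. (k * G (2 + 2) t - s2 t)\<^sup>2) \<le>
           approx_const p \<sigma> * (C0\<^sup>2 + (C0 / sqrt \<epsilon>)\<^sup>2 / \<epsilon> ^ 3) * \<eta>\<^sup>2"
      moreover have "0 + 2 = (2::nat)" "2 + 2 = (4::nat)" by simp_all
      ultimately show thesis using that by (simp only:)
    qed
    have uhvh: "uh \<in> spline_space p N x" "vh \<in> spline_space p N x" "uh \<in> H20_space"
      using fe by (auto simp: fe_solution_def Vh_space_def V_space_def x_def)
    obtain uh2 where uh: "piecewise_C2 uh (deriv01 uh) uh2"
      by (rule spline_space_piecewise_C2[OF mesh uhvh(1)])
    obtain vh2 where vh: "piecewise_C2 vh (deriv01 vh) vh2"
      by (rule spline_space_piecewise_C2[OF mesh uhvh(2)])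
    have bch: "uh 0 = 0" "deriv01 uh 0 = 0" "uh 1 = 0" "deriv01 uh 1 = 0"
      using uhvh(3) piecewise_C2_H20_iff[OF uh] by auto
    have bcI: "uI 0 = 0" "uI1 0 = 0" "uI 1 = 0" "uI1 1 = 0"
      using uI(3)[of 0] uI(3)[of 1] bc uG[of 0] uG[of 1] by auto
    note xu = piecewise_C2_diff[OF uI(2) uh] and xv = piecewise_C2_diff[OF vI(2) vh]
    have test: "(\<lambda>t. uI t - uh t, \<lambda>t. vI t - vh t) \<in> Vh_space p N x"
      using spline_space_diff[OF mesh uI(1) uhvh(1)] spline_space_diff[OF mesh vI(1) uhvh(2)]
        piecewise_C2_H20_iff[OF xu] bch bcI piecewise_C2_H2[OF xv]
      by (simp add: Vh_space_def V_space_def)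
    have galerkin: "bilinear_B lam \<epsilon> (uh, vh) (\<lambda>t. uI t - uh t, \<lambda>t. vI t - vh t) =
        functional_F \<epsilon> f (\<lambda>t. uI t - uh t, \<lambda>t. vI t - vh t)"
      using fe test unfolding fe_solution_def x_def[symmetric] by blast
    \<comment> \<open>The layer components solve the homogeneous equation, so \<open>f\<close> is recovered from the whole of \<open>u\<close>.\<close>
    have f_eq: "AE t in Omega_measure. f t = \<epsilon> powr (5/2) * (k * G 4 t) + 4 * u t"
    proof -
      have "AE t in Omega_measure. t \<in> Omega" using AE_space[of Omega_measure] by simp
      with ode(1) show ?thesis
      proof eventually_elim
        case (elim t)
        have "\<epsilon> powr (5/2) * (k * G 4 t) = \<epsilon> ^ 4 * G 4 t" using k(5) by (metis mult.assoc)
        moreover have "u t = u0 t + ur t + u1 t" using elim by (intro sum) auto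
        ultimately show ?case
          using elim(1) ode(2,3)[rule_format, OF elim(2)]
          by (simp add: G_def R_def L_def L'_def distrib_left)
      qed
    qed
    have quasi: "balanced_sq \<epsilon> (\<lambda>t. u t - uh t) (\<lambda>t. G 2 t - uh2 t) (\<lambda>t. k * G 2 t - vh t) (\<lambda>t. k * G 4 t - vh2 t)
      \<le> (8 * lam\<^sup>2 + 66) *
        balanced_sq \<epsilon> (\<lambda>t. u t - uI t) (\<lambda>t. G 2 t - uI2 t) (\<lambda>t. k * G 2 t - vI t) (\<lambda>t. k * G 4 t - vI2 t)"
      using f by (intro quasi_optimality[OF assms(3) eps u v uh vh uI(2) vI(2) _ _ _ f_eq galerkin])
        (auto simp: bc bc[unfolded One_nat_def] bch bcI k_def L2_space_def)
    have inter: "balanced_sq \<epsilon> (\<lambda>t. u t - uI t) (\<lambda>t. G 2 t - uI2 t) (\<lambda>t. k * G 2 t - vI t) (\<lambda>t. k * G 4 t - vI2 t)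
      \<le> 8 * approx_const p \<sigma> * C0\<^sup>2 * \<eta>\<^sup>2"
    proof -
      let ?c = "approx_const p \<sigma> * C0\<^sup>2 * \<eta>\<^sup>2"
      have c0: "0 \<le> ?c" using ac0 by simp
      note bI = piecewise_C2_bm[OF uI(2)] piecewise_C2_bm[OF vI(2)]
      have "(LINT t|Omega_measure. (u t - uI t)\<^sup>2) = (LINT t|Omega_measure. (G 0 t - uI t)\<^sup>2)"
        by (intro Bochner_Integration.integral_cong) (auto simp: uG)
      also have "\<dots> \<le> approx_const p \<sigma> * (C0\<^sup>2 + \<epsilon> * C0\<^sup>2) * \<eta>\<^sup>2" by (rule uI(4))
      also have "\<dots> = ?c + \<epsilon> * ?c" by (simp add: algebra_simps)
      also have "\<dots> \<le> 2 * ?c" using mult_right_mono[OF eps(2) c0] by simp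
      finally have 1: "(LINT t|Omega_measure. (u t - uI t)\<^sup>2) \<le> 2 * ?c" .
      have "\<epsilon> ^ 3 * (LINT t|Omega_measure. (G 2 t - uI2 t)\<^sup>2) \<le>
          \<epsilon> ^ 3 * (approx_const p \<sigma> * (C0\<^sup>2 + C0\<^sup>2 / \<epsilon> ^ 3) * \<eta>\<^sup>2)"
        using eps by (intro mult_left_mono uI(5)) auto
      also have "\<dots> = \<epsilon> ^ 3 * ?c + ?c" using eps by (simp add: field_simps)
      also have "\<dots> \<le> 2 * ?c"
        using mult_right_mono[OF power_le_one[of \<epsilon> 3] c0] eps by simp
      finally have 2: "\<epsilon> ^ 3 * (LINT t|Omega_measure. (G 2 t - uI2 t)\<^sup>2) \<le> 2 * ?c" .
      have sq: "(C0 / sqrt \<epsilon>)\<^sup>2 = C0\<^sup>2 / \<epsilon>" using eps by (simp add: power_divide)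
      have 3: "(LINT t|Omega_measure. (k * G 2 t - vI t)\<^sup>2) \<le> 2 * ?c"
        using vI(3) eps unfolding sq by (simp add: algebra_simps)
      have "\<epsilon> ^ 4 * (LINT t|Omega_measure. (k * G 4 t - vI2 t)\<^sup>2) \<le>
          \<epsilon> ^ 4 * (approx_const p \<sigma> * (C0\<^sup>2 + (C0 / sqrt \<epsilon>)\<^sup>2 / \<epsilon> ^ 3) * \<eta>\<^sup>2)"
        using eps by (intro mult_left_mono vI(4)) auto
      also have "\<dots> = \<epsilon> ^ 4 * ?c + ?c"
        unfolding sq using eps by (simp add: field_simps power_numeral_reduce)
      also have "\<dots> \<le> 2 * ?c"
        using mult_right_mono[OF power_le_one[of \<epsilon> 4] c0] eps by simp
      finally have 4: "\<epsilon> ^ 4 * (LINT t|Omega_measure. (k * G 4 t - vI2 t)\<^sup>2) \<le> 2 * ?c" .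
      have "balanced_sq \<epsilon> (\<lambda>t. u t - uI t) (\<lambda>t. G 2 t - uI2 t) (\<lambda>t. k * G 2 t - vI t) (\<lambda>t. k * G 4 t - vI2 t) =
         (LINT t|Omega_measure. (u t - uI t)\<^sup>2) + \<epsilon> ^ 3 * (LINT t|Omega_measure. (G 2 t - uI2 t)\<^sup>2)
         + (LINT t|Omega_measure. (k * G 2 t - vI t)\<^sup>2) + \<epsilon> ^ 4 * (LINT t|Omega_measure. (k * G 4 t - vI2 t)\<^sup>2)"
        unfolding balanced_sq_def
        by (subst Omega_integral_add, (intro bm_intros bm bI)+, subst Omega_integral_add, (intro bm_intros bm bI)+,
            subst Omega_integral_add, (intro bm_intros bm bI)+) (simp only: integral_mult_right_zero)
      then show ?thesis using 1 2 3 4 by simp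
    qed
    have meas: "(\<lambda>t. \<epsilon> powr (3/2) * weak_deriv 2 u t - vh t) \<in> borel_measurable Omega_measure"
      by (intro borel_measurable_diff borel_measurable_times borel_measurable_const
          piecewise_C2_weak_deriv_eq(1)[OF u] bm_measurable piecewise_C2_bm[OF vh])
    have ae: "AE t in Omega_measure. k * G 2 t - vh t = \<epsilon> powr (3/2) * weak_deriv 2 u t - vh t"
      using piecewise_C2_weak_deriv_eq(2)[OF u] by eventually_elim (simp add: k_def)
    have "(balanced_norm \<epsilon> (\<lambda>x. u x - uh x, \<lambda>x. \<epsilon> powr (3/2) * weak_deriv 2 u x - vh x))\<^sup>2 =
        balanced_sq \<epsilon> (\<lambda>t. u t - uh t) (\<lambda>t. G 2 t - uh2 t) (\<lambda>t. k * G 2 t - vh t) (\<lambda>t. k * G 4 t - vh2 t)"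
      by (rule balanced_norm_eq[OF piecewise_C2_diff[OF u uh] piecewise_C2_diff[OF v vh] meas ae eps(1)])
    also have "\<dots> \<le> (8 * lam\<^sup>2 + 66) * (8 * approx_const p \<sigma> * C0\<^sup>2 * \<eta>\<^sup>2)"
      using inter by (intro order_trans[OF quasi] mult_left_mono) auto
    also have "\<dots> = K * \<eta>\<^sup>2" by (simp add: K_def mult.assoc)
    finally have "balanced_norm \<epsilon> (\<lambda>x. u x - uh x, \<lambda>x. \<epsilon> powr (3/2) * weak_deriv 2 u x - vh x) \<le> sqrt (K * \<eta>\<^sup>2)"
      by (rule real_le_rsqrt)
    also have "\<dots> = sqrt K * \<eta>" using eta0 by (simp add: real_sqrt_mult)
    also have "\<dots> \<le> (sqrt K + 1) * \<eta>" using eta0 by (intro mult_right_mono) auto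
    finally show ?thesis by (simp only: \<eta>_def)
  qed
  show ?thesis
    by (rule exI[of _ "sqrt K + 1"]) (use main K0 in \<open>auto simp: add_nonneg_pos\<close>)
qed

end
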